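(* Let $n\ge 1$ be an integer and let $\mathcal{A}$ be a unital $C^*$-algebra generated by $n$ self-adjoint elements. Then for all positive integers $l\ge\{\sqrt{n-1}\}$ and $k\ge 3$, one has $\mathrm{Pgen}(\mathrm{M}_{kl}(\mathcal{A}))\le k$.
   Context: For a real number $x\ge 0$, $\{x\}$ denotes the least natural number greater than or equal to $x$. $C^*(S)$ denotes the $C^*$-subalgebra generated by a set $S$. $\mathrm{M}_r(\mathcal{A})$ is the $C^*$-algebra of $r\times r$ matrices over $\mathcal{A}$. Definition. A unital $C^*$-algebra $\mathcal{E}$ is said to be generated by $n$ ($n\ge 2$) mutually unitarily equivalent and almost mutually orthogonal projections if for every $\epsilon>0$ there exist projections $p_1,\dots,p_n$ in $\mathcal{E}$ such that: (1) $p_1+\cdots+p_n$ is invertible in $\mathcal{E}$; (2) $C^*(p_1,\dots,p_n)=\mathcal{E}$; (3) for all $i\ne j$, $p_i$ is unitarily equivalent to $p_j$ in $\mathcal{E}$ (that is, $p_j=up_iu^*$ for some unitary $u\in\mathcal{E}$) and $\|p_ip_j\|<\epsilon$. Definition. For a finitely generated unital $C^*$-algebra $\mathcal{E}$, $\mathrm{Pgen}(\mathcal{E})$ is the least integer $k\ge 2$ such that $\mathcal{E}$ is generated by $k$ mutually unitarily equivalent and almost mutually orthogonal projections; if no such $k$ exists, $\mathrm{Pgen}(\mathcal{E})=\infty$. *)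

theory Defs
  imports "HOL-Analysis.Analysis" "HOL-Algebra.Algebra" "HOL-Algebra.Algebraic_Closure_Type" "HOL-Library.Extended_Nat"
begin

section \<open>Unital C*-algebras as structures with a carrier\<close>

record 'a cstar = "(complex, 'a) module" +
  star :: "'a \<Rightarrow> 'a"
  cnorm :: "'a \<Rightarrow> real"

text \<open>The distance is set to 0 outside the carrier only because the locale
  \<^locale>\<open>Metric_space\<close> asks for nonnegativity and symmetry on the whole type.\<close>

definition cdist :: "'a cstar \<Rightarrow> 'a \<Rightarrow> 'a \<Rightarrow> real" where
  "cdist A x y =
     (if x \<in> carrier A \<and> y \<in> carrier A then cnorm A (x \<ominus>\<^bsub>A\<^esub> y) else 0)"

text \<open>The zero algebra is not excluded, since \<^term>\<open>\<one>\<^bsub>A\<^esub> \<noteq> \<zero>\<^bsub>A\<^esub>\<close> is not required.\<close>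

locale unital_cstar_algebra = ring A for A :: "'a cstar" (structure) +
  assumes complex_module: "module (ring_of_type_algebra :: complex ring) A"
    and smult_mult_left:
      "\<lbrakk>x \<in> carrier A; y \<in> carrier A\<rbrakk> \<Longrightarrow> (c \<odot> x) \<otimes> y = c \<odot> (x \<otimes> y)"
    and smult_mult_right:
      "\<lbrakk>x \<in> carrier A; y \<in> carrier A\<rbrakk> \<Longrightarrow> x \<otimes> (c \<odot> y) = c \<odot> (x \<otimes> y)"
    and star_closed: "x \<in> carrier A \<Longrightarrow> star A x \<in> carrier A"
    and star_star: "x \<in> carrier A \<Longrightarrow> star A (star A x) = x"
    and star_add:
      "\<lbrakk>x \<in> carrier A; y \<in> carrier A\<rbrakk> \<Longrightarrow> star A (x \<oplus> y) = star A x \<oplus> star A y"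
    and star_smult: "x \<in> carrier A \<Longrightarrow> star A (c \<odot> x) = cnj c \<odot> star A x"
    and star_mult:
      "\<lbrakk>x \<in> carrier A; y \<in> carrier A\<rbrakk> \<Longrightarrow> star A (x \<otimes> y) = star A y \<otimes> star A x"
    and cnorm_nonneg: "x \<in> carrier A \<Longrightarrow> 0 \<le> cnorm A x"
    and cnorm_eq_0_iff: "x \<in> carrier A \<Longrightarrow> cnorm A x = 0 \<longleftrightarrow> x = \<zero>"
    and cnorm_triangle:
      "\<lbrakk>x \<in> carrier A; y \<in> carrier A\<rbrakk> \<Longrightarrow> cnorm A (x \<oplus> y) \<le> cnorm A x + cnorm A y"
    and cnorm_smult: "x \<in> carrier A \<Longrightarrow> cnorm A (c \<odot> x) = cmod c * cnorm A x"
    and cnorm_mult: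
      "\<lbrakk>x \<in> carrier A; y \<in> carrier A\<rbrakk> \<Longrightarrow> cnorm A (x \<otimes> y) \<le> cnorm A x * cnorm A y"
    and cstar_identity: "x \<in> carrier A \<Longrightarrow> cnorm A (star A x \<otimes> x) = (cnorm A x)\<^sup>2"
    and complete: "Metric_space.mcomplete (carrier A) (cdist A)"

text \<open>C*-subalgebras are not required to contain the unit.\<close>

definition cstar_subalgebra :: "'a cstar \<Rightarrow> 'a set \<Rightarrow> bool" where
  "cstar_subalgebra A B \<longleftrightarrow>
     B \<subseteq> carrier A \<and> \<zero>\<^bsub>A\<^esub> \<in> B \<and>
     (\<forall>x\<in>B. \<forall>y\<in>B. x \<oplus>\<^bsub>A\<^esub> y \<in> B \<and> x \<otimes>\<^bsub>A\<^esub> y \<in> B) \<and>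
     (\<forall>x\<in>B. \<forall>c. c \<odot>\<^bsub>A\<^esub> x \<in> B) \<and>
     (\<forall>x\<in>B. star A x \<in> B) \<and>
     closedin (Metric_space.mtopology (carrier A) (cdist A)) B"

definition cstar_generated :: "'a cstar \<Rightarrow> 'a set \<Rightarrow> 'a set" where
  "cstar_generated A S = \<Inter>{B. cstar_subalgebra A B \<and> S \<subseteq> B}"

definition self_adjoint :: "'a cstar \<Rightarrow> 'a \<Rightarrow> bool" where
  "self_adjoint A x \<longleftrightarrow> x \<in> carrier A \<and> star A x = x"

definition cstar_projection :: "'a cstar \<Rightarrow> 'a \<Rightarrow> bool" where
  "cstar_projection A p \<longleftrightarrow> self_adjoint A p \<and> p \<otimes>\<^bsub>A\<^esub> p = p"

definition cstar_unitary :: "'a cstar \<Rightarrow> 'a \<Rightarrow> bool" where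
  "cstar_unitary A u \<longleftrightarrow>
     u \<in> carrier A \<and> star A u \<otimes>\<^bsub>A\<^esub> u = \<one>\<^bsub>A\<^esub> \<and> u \<otimes>\<^bsub>A\<^esub> star A u = \<one>\<^bsub>A\<^esub>"

definition unitarily_equivalent :: "'a cstar \<Rightarrow> 'a \<Rightarrow> 'a \<Rightarrow> bool" where
  "unitarily_equivalent A p q \<longleftrightarrow>
     (\<exists>u. cstar_unitary A u \<and> q = u \<otimes>\<^bsub>A\<^esub> p \<otimes>\<^bsub>A\<^esub> star A u)"

definition generated_by_self_adjoints :: "'a cstar \<Rightarrow> nat \<Rightarrow> bool" where
  "generated_by_self_adjoints A n \<longleftrightarrow>
     (\<exists>a :: nat \<Rightarrow> 'a. (\<forall>i<n. self_adjoint A (a i)) \<and>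
        cstar_generated A (a ` {..<n}) = carrier A)"

section \<open>Generation by almost orthogonal, unitarily equivalent projections\<close>

definition generated_by_almost_orthogonal_projections :: "'a cstar \<Rightarrow> nat \<Rightarrow> bool" where
  "generated_by_almost_orthogonal_projections E n \<longleftrightarrow>
     2 \<le> n \<and>
     (\<forall>\<epsilon>>0. \<exists>p :: nat \<Rightarrow> 'a.
        (\<forall>i<n. cstar_projection E (p i)) \<and>
        (\<Oplus>\<^bsub>E\<^esub>i\<in>{..<n}. p i) \<in> Units E \<and>
        cstar_generated E (p ` {..<n}) = carrier E \<and>
        (\<forall>i<n. \<forall>j<n. i \<noteq> j \<longrightarrow>
           unitarily_equivalent E (p i) (p j) \<and> cnorm E (p i \<otimes>\<^bsub>E\<^esub> p j) < \<epsilon>))"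

text \<open>The infimum of the empty set in \<^typ>\<open>enat\<close> is \<^term>\<open>\<infinity> :: enat\<close>.\<close>

definition Pgen :: "'a cstar \<Rightarrow> enat" where
  "Pgen E = Inf {enat k |k. 2 \<le> k \<and> generated_by_almost_orthogonal_projections E k}"

section \<open>Matrix algebras\<close>

text \<open>An \<open>r \<times> r\<close> matrix over \<open>A\<close> is an extensional function on the index pairs
  \<open>(i, j)\<close> with \<open>i, j < r\<close>. The C*-norm is the operator norm for the action on the Hilbert
  \<open>A\<close>-module \<open>A\<^sup>r\<close>, whose norm is \<open>\<parallel>x\<parallel> = \<parallel>\<Sum>\<^sub>i x\<^sub>i\<^sup>* x\<^sub>i\<parallel>\<^sup>1\<^sup>/\<^sup>2\<close>; it is the unique norm making
  the *-algebra of matrices a C*-algebra.\<close>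

definition col_space :: "nat \<Rightarrow> 'a cstar \<Rightarrow> (nat \<Rightarrow> 'a) set" where
  "col_space r A = {..<r} \<rightarrow>\<^sub>E carrier A"

definition col_norm :: "nat \<Rightarrow> 'a cstar \<Rightarrow> (nat \<Rightarrow> 'a) \<Rightarrow> real" where
  "col_norm r A x = sqrt (cnorm A (\<Oplus>\<^bsub>A\<^esub>i\<in>{..<r}. star A (x i) \<otimes>\<^bsub>A\<^esub> x i))"

definition mat_col :: "nat \<Rightarrow> 'a cstar \<Rightarrow> (nat \<times> nat \<Rightarrow> 'a) \<Rightarrow> (nat \<Rightarrow> 'a) \<Rightarrow> nat \<Rightarrow> 'a" where
  "mat_col r A T x = (\<lambda>i\<in>{..<r}. \<Oplus>\<^bsub>A\<^esub>j\<in>{..<r}. T (i, j) \<otimes>\<^bsub>A\<^esub> x j)"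

definition mat_norm :: "nat \<Rightarrow> 'a cstar \<Rightarrow> (nat \<times> nat \<Rightarrow> 'a) \<Rightarrow> real" where
  "mat_norm r A T =
     Sup {col_norm r A (mat_col r A T x) |x. x \<in> col_space r A \<and> col_norm r A x \<le> 1}"

definition mat_algebra :: "nat \<Rightarrow> 'a cstar \<Rightarrow> (nat \<times> nat \<Rightarrow> 'a) cstar" where
  "mat_algebra r A =
     \<lparr> carrier = {..<r} \<times> {..<r} \<rightarrow>\<^sub>E carrier A,
       mult = (\<lambda>S T. \<lambda>(i, j)\<in>{..<r} \<times> {..<r}. \<Oplus>\<^bsub>A\<^esub>h\<in>{..<r}. S (i, h) \<otimes>\<^bsub>A\<^esub> T (h, j)),
       one = (\<lambda>(i, j)\<in>{..<r} \<times> {..<r}. if i = j then \<one>\<^bsub>A\<^esub> else \<zero>\<^bsub>A\<^esub>),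
       ring.zero = (\<lambda>_\<in>{..<r} \<times> {..<r}. \<zero>\<^bsub>A\<^esub>),
       ring.add = (\<lambda>S T. \<lambda>ij\<in>{..<r} \<times> {..<r}. S ij \<oplus>\<^bsub>A\<^esub> T ij),
       smult = (\<lambda>c T. \<lambda>ij\<in>{..<r} \<times> {..<r}. c \<odot>\<^bsub>A\<^esub> T ij),
       star = (\<lambda>T. \<lambda>(i, j)\<in>{..<r} \<times> {..<r}. star A (T (j, i))),
       cnorm = mat_norm r A \<rparr>"

end

theory Submission
  imports Defs
begin

text \<open>Write \<open>E = M\<^sub>k\<^sub>l(A)\<close> as \<open>k \<times> k\<close> blocks of size \<open>l\<close>, with diagonal block units \<open>P b\<close>. For a small
  \<open>x\<close> mapping block \<open>b\<close> into the other blocks, \<open>v = x + (1 - x\<^sup>* x)\<^sup>1\<^sup>/\<^sup>2 P b\<close> is a partial isometry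
  with initial projection \<open>P b\<close>, so \<open>p b = v v\<^sup>*\<close> is a projection near \<open>P b\<close>. Nearness gives the
  invertible sum, the small products and (by polar decomposition) the unitary equivalence.

  Take \<open>p 0 = P 0\<close>. For \<open>b \<noteq> 0, 2\<close> let \<open>x\<close> be diagonal with distinct small entries in position
  \<open>(0, b)\<close>: the corner \<open>P 0 (p b) P 0\<close> then yields the diagonal matrix units by interpolation. For
  \<open>b = 2\<close> let \<open>x\<close> be a small multiple of the identity in position \<open>(0, 2)\<close> and of a matrix \<open>Y\<close> in
  position \<open>(1, 2)\<close>: the corner \<open>P 0 (p 2) P 1\<close> is a multiple of \<open>Y\<^sup>*\<close>, and \<open>Y\<close> has enough entries to
  store all generators of \<open>A\<close> together with units that connect the diagonal ones.

  That the operator norm makes \<open>E\<close> a C*-algebra rests on the positivity of \<open>a\<^sup>* a\<close>, which is derived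
  from the axioms without spectral theory: \<open>a\<close> is called positive if \<open>\<parallel>t - a\<parallel> \<le> t\<close> for large \<open>t\<close>,
  and the only functional calculus used is the square root of an element at distance less than
  \<open>1\<close> from \<open>1\<close>.\<close>

text \<open>The corner of \<open>p 2\<close> at block 0 alone carries no data, since
  \<open>P 0 (p 2) P 0\<close> is \<open>t * t\<close> times \<open>P 0\<close>; hence the third
  block. In the corner from block 0 to block 1 the square root \<open>Z\<close> drops out, because
  it commutes with \<open>P 2\<close>, so \<open>Y\<close> is read off exactly although
  \<open>Z\<close> has no formula. The identity in position \<open>(0, 2)\<close> leaves the star of
  \<open>Y\<close> bare in that corner and later connects block 2 with block 0.

  The remaining obstacle is that block 2 is reached only through \<open>Z\<close>: the projections
  give \<open>t Z (V 2 0)\<close>. By then the whole corner at block 0 is generated, so the inverse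
  of \<open>Z\<close>, carried from block 2 to block 0, is available and cancels it.

  Smallness of the parameters matters only for the estimates; the generation argument needs a
  nonzero \<open>t\<close> and distinct \<open>s i\<close> in the open unit interval. Norms are
  controlled entry by entry, which costs a factor \<open>(k * l)^2\<close> that \<open>t\<close> has
  to absorb. Positivity of \<open>star a \<otimes> a\<close> enters the operator norm through two
  facts: a column norm bounds each entry, and the Cauchy-Schwarz inequality for
  \<open>A\<close>-valued inner products.\<close>

context unital_cstar_algebra
begin

section \<open>Norms and limits\<close>

abbreviation nrm :: "'a \<Rightarrow> real" ("\<parallel>_\<parallel>") where "\<parallel>x\<parallel> \<equiv> cnorm A x"

lemma
  shows smult_closed [simp, intro]: "x \<in> carrier A \<Longrightarrow> c \<odot> x \<in> carrier A"
    and smult_l_distr: "x \<in> carrier A \<Longrightarrow> (c + d) \<odot> x = c \<odot> x \<oplus> d \<odot> x"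
    and smult_r_distr: "\<lbrakk>x \<in> carrier A; y \<in> carrier A\<rbrakk> \<Longrightarrow> c \<odot> (x \<oplus> y) = c \<odot> x \<oplus> c \<odot> y"
    and smult_smult: "x \<in> carrier A \<Longrightarrow> c \<odot> (d \<odot> x) = (c * d) \<odot> x"
    and smult_one [simp]: "x \<in> carrier A \<Longrightarrow> 1 \<odot> x = x"
proof -
  interpret M: module "ring_of_type_algebra :: complex ring" A by (rule complex_module)
  show "x \<in> carrier A \<Longrightarrow> c \<odot> x \<in> carrier A"
    using M.smult_closed[of c x] by (simp add: ring_of_type_algebra_def)
  show "x \<in> carrier A \<Longrightarrow> (c + d) \<odot> x = c \<odot> x \<oplus> d \<odot> x"
    using M.smult_l_distr[of c d x] by (simp add: ring_of_type_algebra_def)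
  show "\<lbrakk>x \<in> carrier A; y \<in> carrier A\<rbrakk> \<Longrightarrow> c \<odot> (x \<oplus> y) = c \<odot> x \<oplus> c \<odot> y"
    using M.smult_r_distr[of c x y] by (simp add: ring_of_type_algebra_def)
  show "x \<in> carrier A \<Longrightarrow> c \<odot> (d \<odot> x) = (c * d) \<odot> x"
    using M.smult_assoc1[of c d x] by (simp add: ring_of_type_algebra_def)
  show "x \<in> carrier A \<Longrightarrow> 1 \<odot> x = x"
    using M.smult_one[of x] by (simp add: ring_of_type_algebra_def)
qed

declare star_closed [simp, intro] star_star [simp] cnorm_nonneg [simp]

lemma smult_zero_left [simp]: "x \<in> carrier A \<Longrightarrow> 0 \<odot> x = \<zero>"
  using smult_l_distr[of x 0 0] by (simp add: add.r_cancel_one')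

lemma smult_zero_right [simp]: "c \<odot> \<zero> = \<zero>"
  using smult_r_distr[of \<zero> \<zero> c] by (simp add: add.r_cancel_one')

lemma smult_minus_left: "x \<in> carrier A \<Longrightarrow> (- c) \<odot> x = \<ominus> (c \<odot> x)"
  using smult_l_distr[of x "- c" c] by (simp add: minus_equality)

lemma smult_minus_right: "x \<in> carrier A \<Longrightarrow> c \<odot> (\<ominus> x) = \<ominus> (c \<odot> x)"
  using smult_r_distr[of "\<ominus> x" x c] by (simp add: minus_equality l_neg)

lemma smult_diff_right:
  "\<lbrakk>x \<in> carrier A; y \<in> carrier A\<rbrakk> \<Longrightarrow> c \<odot> (x \<ominus> y) = c \<odot> x \<ominus> c \<odot> y"
  by (simp add: a_minus_def smult_r_distr smult_minus_right)

lemma smult_diff_left: "x \<in> carrier A \<Longrightarrow> (c - d) \<odot> x = c \<odot> x \<ominus> d \<odot> x"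
  using smult_l_distr[of x c "- d"] by (simp add: a_minus_def smult_minus_left)

text \<open>Multiplication is not commutative, so the right unit law is handed to
  \<open>algebra\<close> as a rule of its own.\<close>

declare r_one [algebra ring "ring.zero A" "ring.add A" "a_inv A" "a_minus A" "one A" "mult A"]

lemma diff_self [simp]: "x \<in> carrier A \<Longrightarrow> x \<ominus> x = \<zero>"
  by (simp add: a_minus_def r_neg)

lemma add_self: "x \<in> carrier A \<Longrightarrow> x \<oplus> x = 2 \<odot> x"
  using smult_l_distr[of x 1 1] by simp

lemma star_zero [simp]: "star A \<zero> = \<zero>"
  using star_smult[of \<zero> 0] by simp

lemma star_minus: "x \<in> carrier A \<Longrightarrow> star A (\<ominus> x) = \<ominus> star A x"
  using star_add[of "\<ominus> x" x] by (simp add: minus_equality l_neg)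

lemma star_diff:
  "\<lbrakk>x \<in> carrier A; y \<in> carrier A\<rbrakk> \<Longrightarrow> star A (x \<ominus> y) = star A x \<ominus> star A y"
  by (simp add: a_minus_def star_add star_minus)

lemma star_one [simp]: "star A \<one> = \<one>"
  using star_mult[of "star A \<one>" \<one>] by simp

lemma cnorm_zero [simp]: "\<parallel>\<zero>\<parallel> = 0"
  by (simp add: cnorm_eq_0_iff)

lemma cnorm_minus: "x \<in> carrier A \<Longrightarrow> \<parallel>\<ominus> x\<parallel> = \<parallel>x\<parallel>"
  using cnorm_smult[of x "-1"] by (simp add: smult_minus_left)

lemma cnorm_diff_triangle:
  "\<lbrakk>x \<in> carrier A; y \<in> carrier A\<rbrakk> \<Longrightarrow> \<parallel>x \<ominus> y\<parallel> \<le> \<parallel>x\<parallel> + \<parallel>y\<parallel>"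
  using cnorm_triangle[of x "\<ominus> y"] by (simp add: a_minus_def cnorm_minus)

lemma minus_swap: "\<lbrakk>x \<in> carrier A; y \<in> carrier A\<rbrakk> \<Longrightarrow> \<ominus> (x \<ominus> y) = y \<ominus> x"
  by (simp add: a_minus_def minus_add a_comm)

lemma cnorm_diff_commute: "\<lbrakk>x \<in> carrier A; y \<in> carrier A\<rbrakk> \<Longrightarrow> \<parallel>x \<ominus> y\<parallel> = \<parallel>y \<ominus> x\<parallel>"
  by (metis cnorm_minus minus_swap minus_closed)

lemma diff_add_diff:
  "\<lbrakk>x \<in> carrier A; y \<in> carrier A; z \<in> carrier A\<rbrakk> \<Longrightarrow> (x \<ominus> y) \<oplus> (y \<ominus> z) = x \<ominus> z"
  by algebra

lemma cnorm_diff_triangle3: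
  "\<lbrakk>x \<in> carrier A; y \<in> carrier A; z \<in> carrier A\<rbrakk> \<Longrightarrow> \<parallel>x \<ominus> z\<parallel> \<le> \<parallel>x \<ominus> y\<parallel> + \<parallel>y \<ominus> z\<parallel>"
  by (metis cnorm_triangle diff_add_diff minus_closed)

lemma cnorm_le_diff:
  "\<lbrakk>x \<in> carrier A; y \<in> carrier A\<rbrakk> \<Longrightarrow> \<parallel>x\<parallel> \<le> \<parallel>x \<ominus> y\<parallel> + \<parallel>y\<parallel>"
  using cnorm_triangle[of "x \<ominus> y" y] by (simp add: a_minus_def a_assoc l_neg)

text \<open>The C*-identity gives \<open>\<parallel>y\<parallel>^2 \<le> \<parallel>star
  y\<parallel> * \<parallel>y\<parallel>\<close>; cancel, then use this for \<open>x\<close> and for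
  its star.\<close>

lemma cnorm_star [simp]:
  assumes "x \<in> carrier A"
  shows "\<parallel>star A x\<parallel> = \<parallel>x\<parallel>"
proof -
  have *: "\<parallel>y\<parallel> \<le> \<parallel>star A y\<parallel>" if "y \<in> carrier A" for y
  proof (cases "\<parallel>y\<parallel> = 0")
    case False
    have "\<parallel>y\<parallel> * \<parallel>y\<parallel> \<le> \<parallel>star A y\<parallel> * \<parallel>y\<parallel>"
      using cstar_identity[of y] cnorm_mult[of "star A y" y] that by (simp add: power2_eq_square)
    then show ?thesis
      using False cnorm_nonneg[OF that] by (simp add: mult_le_cancel_right)
  qed (use that in simp)
  show ?thesis
    using *[of x] *[of "star A x"] assms by simp
qed

text \<open>Only an inequality, because the zero algebra is allowed: there the unit has norm
  0.\<close>

lemma cnorm_one_le: "\<parallel>\<one>\<parallel> \<le> 1"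
proof -
  have "\<parallel>\<one>\<parallel> = (\<parallel>\<one>\<parallel>)\<^sup>2" using cstar_identity[of \<one>] by simp
  then have "\<parallel>\<one>\<parallel> = 0 \<or> \<parallel>\<one>\<parallel> = 1" by (auto simp: power2_eq_square)
  then show ?thesis by auto
qed

lemma cnorm_smult_one_le: "\<parallel>c \<odot> \<one>\<parallel> \<le> cmod c"
  using mult_left_mono[OF cnorm_one_le, of "cmod c"] by (simp add: cnorm_smult)

lemma cnorm_square: "\<lbrakk>x \<in> carrier A; star A x = x\<rbrakk> \<Longrightarrow> \<parallel>x \<otimes> x\<parallel> = (\<parallel>x\<parallel>)\<^sup>2"
  using cstar_identity[of x] by simp

lemma cnorm_star': "x \<in> carrier A \<Longrightarrow> \<parallel>x \<otimes> star A x\<parallel> = (\<parallel>x\<parallel>)\<^sup>2"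
  using cstar_identity[of "star A x"] by simp

lemma smult_one_left: "x \<in> carrier A \<Longrightarrow> (c \<odot> \<one>) \<otimes> x = c \<odot> x"
  by (simp add: smult_mult_left)

lemma smult_one_right: "x \<in> carrier A \<Longrightarrow> x \<otimes> (c \<odot> \<one>) = c \<odot> x"
  by (simp add: smult_mult_right)

sublocale metric: Metric_space "carrier A" "cdist A"
proof
  show "0 \<le> cdist A x y" for x y
    by (simp add: cdist_def)
  show "cdist A x y = cdist A y x" for x y
    by (auto simp: cdist_def cnorm_diff_commute)
  show "cdist A x y = 0 \<longleftrightarrow> x = y" if "x \<in> carrier A" "y \<in> carrier A" for x y
    using that by (simp add: cdist_def cnorm_eq_0_iff)
  show "cdist A x z \<le> cdist A x y + cdist A y z"
    if "x \<in> carrier A" "y \<in> carrier A" "z \<in> carrier A" for x y z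
    using that by (simp add: cdist_def cnorm_diff_triangle3)
qed

section \<open>Norm limits and a contraction principle\<close>

definition tends :: "(nat \<Rightarrow> 'a) \<Rightarrow> 'a \<Rightarrow> bool" where
  "tends s l \<longleftrightarrow> range s \<subseteq> carrier A \<and> l \<in> carrier A \<and> (\<lambda>n. \<parallel>s n \<ominus> l\<parallel>) \<longlonglongrightarrow> 0"

lemma tends_iff_limitin:
  "range s \<subseteq> carrier A \<Longrightarrow> tends s l \<longleftrightarrow> limitin metric.mtopology s l sequentially"
  unfolding tends_def metric.limit_metric_sequentially lim_sequentially cdist_def
  by (auto simp: range_subsetD)

text \<open>Subalgebras are closed in the metric topology, whereas all limits below are norm limits
  in the sense of \<open>tends\<close>.\<close>

lemma closedin_iff_tends:
  "closedin metric.mtopology D \<longleftrightarrow>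
     D \<subseteq> carrier A \<and> (\<forall>s l. range s \<subseteq> D \<and> tends s l \<longrightarrow> l \<in> D)"
  unfolding metric.metric_closedin_iff_sequentially_closed
  using tends_iff_limitin by (metis subset_trans)

lemma tends_squeeze:
  assumes "range s \<subseteq> carrier A" "l \<in> carrier A" "\<And>n. \<parallel>s n \<ominus> l\<parallel> \<le> f n" "f \<longlonglongrightarrow> 0"
  shows "tends s l"
proof -
  have "(\<lambda>n. \<parallel>s n \<ominus> l\<parallel>) \<longlonglongrightarrow> 0"
    by (rule tendsto_sandwich[of "\<lambda>_. 0" _ _ f]) (use assms in \<open>auto simp: range_subsetD\<close>)
  then show ?thesis using assms by (simp add: tends_def)
qed

lemma tends_unique: "\<lbrakk>tends s l; tends s m\<rbrakk> \<Longrightarrow> l = m"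
  using metric.limitin_metric_unique[of s l sequentially m] tends_iff_limitin
  by (auto simp: tends_def)

lemma tends_star: "tends s l \<Longrightarrow> tends (\<lambda>n. star A (s n)) (star A l)"
  by (rule tends_squeeze[where f = "\<lambda>n. \<parallel>s n \<ominus> l\<parallel>"])
    (auto simp: tends_def range_subsetD star_diff[symmetric])

lemma tends_mult_left:
  assumes "tends s l" "x \<in> carrier A"
  shows "tends (\<lambda>n. x \<otimes> s n) (x \<otimes> l)"
proof (rule tends_squeeze)
  show "range (\<lambda>n. x \<otimes> s n) \<subseteq> carrier A" "x \<otimes> l \<in> carrier A"
    using assms by (auto simp: tends_def range_subsetD)
  show "\<parallel>x \<otimes> s n \<ominus> x \<otimes> l\<parallel> \<le> \<parallel>x\<parallel> * \<parallel>s n \<ominus> l\<parallel>" for n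
  proof -
    have c: "s n \<in> carrier A" "l \<in> carrier A"
      using assms by (auto simp: tends_def range_subsetD)
    then have "x \<otimes> s n \<ominus> x \<otimes> l = x \<otimes> (s n \<ominus> l)" using assms(2) by algebra
    then show ?thesis using c assms by (simp add: cnorm_mult)
  qed
  show "(\<lambda>n. \<parallel>x\<parallel> * \<parallel>s n \<ominus> l\<parallel>) \<longlonglongrightarrow> 0"
    using assms by (auto simp: tends_def intro: tendsto_mult_right_zero)
qed

text \<open>Obtained from left multiplication by passing to stars.\<close>

lemma tends_mult_right:
  assumes "tends s l" "x \<in> carrier A"
  shows "tends (\<lambda>n. s n \<otimes> x) (l \<otimes> x)"
proof -
  have "range s \<subseteq> carrier A" "l \<in> carrier A" using assms by (auto simp: tends_def)
  moreover have "tends (\<lambda>n. star A (star A x \<otimes> star A (s n))) (star A (star A x \<otimes> star A l))"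
    using assms by (intro tends_star tends_mult_left) auto
  ultimately show ?thesis
    using assms(2) by (simp add: star_mult range_subsetD)
qed

lemma tends_cnorm_le:
  assumes "tends s l" "\<And>n. \<parallel>s n\<parallel> \<le> r"
  shows "\<parallel>l\<parallel> \<le> r"
proof (rule field_le_epsilon)
  fix e :: real assume "e > 0"
  then obtain n where n: "\<parallel>s n \<ominus> l\<parallel> < e"
    using assms(1) unfolding tends_def lim_sequentially dist_real_def
    by (metis abs_ge_self le_refl diff_zero order_le_less_trans)
  have c: "s n \<in> carrier A" "l \<in> carrier A" using assms(1) by (auto simp: tends_def range_subsetD)
  then show "\<parallel>l\<parallel> \<le> r + e"
    using cnorm_le_diff[of l "s n"] cnorm_diff_commute[of "s n" l] n assms(2)[of n] by simp
qed

text \<open>Banach's fixed point theorem on a subset stable under limits. A property that is closed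
  and preserved by \<open>f\<close> can be put into \<open>D\<close> and is inherited by the fixed
  point; self-adjointness, norm bounds and commutation relations of inverses and square roots are
  obtained this way.\<close>

lemma contraction_fixed_point:
  assumes D: "D \<subseteq> carrier A" "D \<noteq> {}"
    and closed: "\<And>s l. \<lbrakk>range s \<subseteq> D; tends s l\<rbrakk> \<Longrightarrow> l \<in> D"
    and f: "\<And>x. x \<in> D \<Longrightarrow> f x \<in> D"
    and lip: "\<And>x y. \<lbrakk>x \<in> D; y \<in> D\<rbrakk> \<Longrightarrow> \<parallel>f x \<ominus> f y\<parallel> \<le> q * \<parallel>x \<ominus> y\<parallel>"
    and q: "0 \<le> q" "q < 1"
  obtains x where "x \<in> D" "f x = x"
proof -
  obtain x0 where x0: "x0 \<in> D" using D by auto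
  define s where "s n = (f ^^ n) x0" for n
  have sD: "s n \<in> D" for n unfolding s_def by (induction n) (auto simp: x0 f)
  have sc: "s n \<in> carrier A" for n using sD D by auto
  define d where "d = \<parallel>s 1 \<ominus> s 0\<parallel>"
  have step: "\<parallel>s (Suc n) \<ominus> s n\<parallel> \<le> q ^ n * d" for n
  proof (induction n)
    case (Suc n)
    have "\<parallel>s (Suc (Suc n)) \<ominus> s (Suc n)\<parallel> \<le> q * \<parallel>s (Suc n) \<ominus> s n\<parallel>"
      using lip[OF sD sD, of "Suc n" n] by (simp add: s_def)
    also have "\<dots> \<le> q * (q ^ n * d)" using Suc q by (intro mult_left_mono)
    finally show ?case by (simp add: mult.assoc)
  qed (simp add: d_def)
  have d0: "0 \<le> d" by (simp add: d_def sc)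
  \<comment> \<open>The bound is the closed form of the partial geometric sum of the steps from
    \<open>n\<close> to \<open>n + m\<close>.\<close>
  have dist: "\<parallel>s (n + m) \<ominus> s n\<parallel> \<le> (q ^ n - q ^ (n + m)) * d / (1 - q)" for n m
  proof (induction m)
    case (Suc m)
    have "\<parallel>s (n + Suc m) \<ominus> s n\<parallel> \<le> \<parallel>s (n + Suc m) \<ominus> s (n + m)\<parallel> + \<parallel>s (n + m) \<ominus> s n\<parallel>"
      by (intro cnorm_diff_triangle3 sc)
    also have "\<dots> \<le> q ^ (n + m) * d + (q ^ n - q ^ (n + m)) * d / (1 - q)"
      using step[of "n + m"] Suc by simp
    also have "\<dots> = (q ^ n - q ^ (n + Suc m)) * d / (1 - q)"
      using q by (simp add: field_simps)
    finally show ?case .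
  qed (simp add: sc)
  have dist': "\<parallel>s m \<ominus> s n\<parallel> \<le> q ^ n * d / (1 - q)" if "n \<le> m" for n m
  proof -
    have "\<parallel>s m \<ominus> s n\<parallel> \<le> (q ^ n - q ^ m) * d / (1 - q)"
      using dist[of n "m - n"] that by simp
    also have "\<dots> \<le> q ^ n * d / (1 - q)"
      using q d0 by (intro divide_right_mono mult_right_mono) auto
    finally show ?thesis .
  qed
  have lim0: "(\<lambda>n. q ^ n * d / (1 - q)) \<longlonglongrightarrow> 0"
    using tendsto_divide[OF tendsto_mult[OF LIMSEQ_realpow_zero[OF q] tendsto_const[of d]] tendsto_const[of "1 - q"]] q
    by simp
  have "metric.MCauchy s"
    unfolding metric.MCauchy_def
  proof (intro conjI allI impI)
    show "range s \<subseteq> carrier A" using sc by auto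
    fix e :: real assume "e > 0"
    then obtain N where N: "\<And>n. N \<le> n \<Longrightarrow> q ^ n * d / (1 - q) < e"
      using lim0 unfolding lim_sequentially dist_real_def by (metis abs_ge_self diff_zero order_le_less_trans)
    have "cdist A (s n) (s n') < e" if "N \<le> n" "N \<le> n'" for n n'
    proof (cases "n \<le> n'")
      case True
      then show ?thesis
        using dist'[of n n'] N[OF that(1)] cnorm_diff_commute[OF sc[of n] sc[of n']]
        by (simp add: cdist_def sc)
    next
      case False
      then show ?thesis
        using dist'[of n' n] N[OF that(2)] by (simp add: cdist_def sc)
    qed
    then show "\<exists>N. \<forall>n n'. N \<le> n \<longrightarrow> N \<le> n' \<longrightarrow> cdist A (s n) (s n') < e" by blast
  qed
  then obtain l where "limitin metric.mtopology s l sequentially"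
    using complete unfolding metric.mcomplete_def by blast
  then have l: "tends s l" using tends_iff_limitin sc by blast
  have lD: "l \<in> D" using closed[OF _ l] sD by auto
  then have lc: "l \<in> carrier A" "f l \<in> carrier A" using D f by auto
  have "tends (\<lambda>n. s (Suc n)) (f l)"
  proof (rule tends_squeeze)
    show "\<parallel>s (Suc n) \<ominus> f l\<parallel> \<le> q * \<parallel>s n \<ominus> l\<parallel>" for n
      using lip[OF sD lD, of n] by (simp add: s_def)
    show "(\<lambda>n. q * \<parallel>s n \<ominus> l\<parallel>) \<longlonglongrightarrow> 0"
      using l by (auto simp: tends_def intro: tendsto_mult_right_zero)
  qed (use sc lc in auto)
  moreover have "tends (\<lambda>n. s (Suc n)) l"
    using l LIMSEQ_Suc[of "\<lambda>n. \<parallel>s n \<ominus> l\<parallel>"] by (auto simp: tends_def)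
  ultimately have "f l = l" by (rule tends_unique)
  then show ?thesis using that lD by blast
qed

section \<open>Square roots and positive elements\<close>

lemma inv_commute:
  assumes "a \<in> Units A" "w \<in> carrier A" "w \<otimes> a = a \<otimes> w"
  shows "w \<otimes> inv a = inv a \<otimes> w"
proof -
  have c: "a \<in> carrier A" "inv a \<in> carrier A" using assms(1) by auto
  have "w \<otimes> inv a = inv a \<otimes> (a \<otimes> w) \<otimes> inv a"
    using assms c by (simp add: m_assoc[symmetric])
  also have "\<dots> = inv a \<otimes> w \<otimes> (a \<otimes> inv a)"
    unfolding assms(3)[symmetric] using assms(2) c by (simp only: m_assoc m_closed)
  finally show ?thesis using assms c by simp
qed

lemma star_inv:
  assumes "a \<in> Units A"
  shows "star A (inv a) = inv (star A a)"
proof -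
  have c: "a \<in> carrier A" "inv a \<in> carrier A" using assms by auto
  have "star A a \<otimes> star A (inv a) = \<one>" "star A (inv a) \<otimes> star A a = \<one>"
    using assms c by (simp_all add: star_mult[symmetric])
  then show ?thesis using c by (intro inv_char[symmetric]) auto
qed

lemma smult_Units:
  assumes "a \<in> Units A" "c \<noteq> 0"
  shows "c \<odot> a \<in> Units A"
proof -
  have "a \<in> carrier A" "inv a \<in> carrier A" using assms by auto
  then have "(inverse c \<odot> inv a) \<otimes> (c \<odot> a) = \<one>" "(c \<odot> a) \<otimes> (inverse c \<odot> inv a) = \<one>"
    using assms by (simp_all add: smult_mult_left smult_mult_right smult_smult)
  then show ?thesis using \<open>a \<in> carrier A\<close> \<open>inv a \<in> carrier A\<close> unfolding Units_def by blast
qed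

text \<open>The Neumann series in fixed-point form: for \<open>y = \<one> \<ominus> a\<close>, the
  equation \<open>z = \<one> \<oplus> y \<otimes> z\<close> says that \<open>z\<close> is a right
  inverse of \<open>a\<close>.\<close>

lemma Units_near_one:
  assumes a: "a \<in> carrier A" "\<parallel>\<one> \<ominus> a\<parallel> < 1"
  shows "a \<in> Units A"
proof -
  define y where "y = \<one> \<ominus> a"
  have y: "y \<in> carrier A" "\<parallel>y\<parallel> < 1" using a by (auto simp: y_def)
  have ay: "a = \<one> \<ominus> y" using a unfolding y_def by algebra
  \<comment> \<open>Commutation with \<open>y\<close> is kept in the domain so that the right
    inverse is also a left inverse.\<close>
  define D where "D = {z \<in> carrier A. z \<otimes> y = y \<otimes> z}"
  obtain z where z: "z \<in> D" "\<one> \<oplus> y \<otimes> z = z"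
  proof (rule contraction_fixed_point[of D "\<lambda>z. \<one> \<oplus> y \<otimes> z" "\<parallel>y\<parallel>"])
    show "D \<subseteq> carrier A" by (auto simp: D_def)
    show "D \<noteq> {}" using y by (auto simp: D_def intro!: exI[of _ \<zero>])
    show "l \<in> D" if s: "range s \<subseteq> D" "tends s l" for s l
    proof -
      have "l \<in> carrier A" using s by (auto simp: tends_def)
      moreover have "tends (\<lambda>n. s n \<otimes> y) (y \<otimes> l)"
        using tends_mult_left[OF s(2) y(1)] s(1) by (auto simp: D_def image_subset_iff)
      ultimately show ?thesis
        using tends_unique[OF tends_mult_right[OF s(2) y(1)]] by (simp add: D_def)
    qed
    show "\<one> \<oplus> y \<otimes> x \<in> D" if "x \<in> D" for x
      using that y by (simp add: D_def l_distr r_distr m_assoc)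
    show "\<parallel>(\<one> \<oplus> y \<otimes> x) \<ominus> (\<one> \<oplus> y \<otimes> x')\<parallel> \<le> \<parallel>y\<parallel> * \<parallel>x \<ominus> x'\<parallel>" if "x \<in> D" "x' \<in> D" for x x'
    proof -
      have c: "x \<in> carrier A" "x' \<in> carrier A" using that by (auto simp: D_def)
      then have "(\<one> \<oplus> y \<otimes> x) \<ominus> (\<one> \<oplus> y \<otimes> x') = y \<otimes> (x \<ominus> x')" using y by algebra
      then show ?thesis using c y by (simp add: cnorm_mult)
    qed
  qed (use y in auto)
  have zc: "z \<in> carrier A" "z \<otimes> y = y \<otimes> z" using z by (auto simp: D_def)
  have "a \<otimes> z = z \<ominus> y \<otimes> z" unfolding ay using zc y by algebra
  also have "\<dots> = (\<one> \<oplus> y \<otimes> z) \<ominus> y \<otimes> z" using z(2) by simp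
  also have "\<dots> = \<one>" using zc y by algebra
  finally have "a \<otimes> z = \<one>" .
  moreover have "z \<otimes> a = a \<otimes> z"
    unfolding ay using zc y by (simp add: a_minus_def l_distr r_distr l_minus r_minus)
  ultimately show ?thesis
    using a(1) zc unfolding Units_def by auto
qed

text \<open>With \<open>a = \<one> \<ominus> y\<close> and \<open>k = \<one> \<ominus> z\<close>,
  the equation \<open>k \<otimes> k = a\<close> becomes the fixed-point equation
  \<open>z = (y \<oplus> z \<otimes> z) / 2\<close>. The last two conclusions make \<open>k\<close>
  invertible and make square roots of commuting elements commute.\<close>

lemma sqrt_near_one:
  assumes a: "a \<in> carrier A" "star A a = a" "\<parallel>\<one> \<ominus> a\<parallel> < 1"
  obtains k where "k \<in> carrier A" "star A k = k" "k \<otimes> k = a" "\<parallel>\<one> \<ominus> k\<parallel> \<le> \<parallel>\<one> \<ominus> a\<parallel>"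
    "\<And>w. \<lbrakk>w \<in> carrier A; w \<otimes> a = a \<otimes> w\<rbrakk> \<Longrightarrow> w \<otimes> k = k \<otimes> w"
proof -
  define y where "y = \<one> \<ominus> a"
  define q where "q = \<parallel>y\<parallel>"
  have y: "y \<in> carrier A" "star A y = y" "\<parallel>y\<parallel> = q" using a by (auto simp: y_def q_def star_diff)
  have q: "0 \<le> q" "q < 1" using a by (auto simp: q_def y_def)
  have ay: "a = \<one> \<ominus> y" using a unfolding y_def by algebra
  \<comment> \<open>\<open>\<rho>\<close> is the smaller solution of
    \<open>\<rho> = (q + \<rho>^2) / 2\<close>, so the ball of radius \<open>\<rho>\<close> is
    mapped into itself; \<open>\<rho>\<close> is also the contraction constant.\<close>
  define \<rho> where "\<rho> = 1 - sqrt (1 - q)"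
  have \<rho>: "0 \<le> \<rho>" "\<rho> < 1" using q by (auto simp: \<rho>_def)
  have "(1 - \<rho>)\<^sup>2 = 1 - q" using q by (simp add: \<rho>_def)
  then have \<rho>q: "q + \<rho>\<^sup>2 = 2 * \<rho>" by (simp add: power2_eq_square algebra_simps)
  \<comment> \<open>Because \<open>sqrt (1 - q) \<ge> 1 - q\<close>; this yields the bound on
    \<open>\<one> \<ominus> k\<close>.\<close>
  have "\<rho> \<le> q"
    using real_le_rsqrt[of "1 - q" "1 - q"] q
    by (simp add: \<rho>_def power2_eq_square mult_left_le_one_le)
  define D where "D = {z \<in> carrier A. star A z = z \<and> \<parallel>z\<parallel> \<le> \<rho> \<and>
    (\<forall>w\<in>carrier A. w \<otimes> y = y \<otimes> w \<longrightarrow> w \<otimes> z = z \<otimes> w)}"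
  define f where "f z = (1/2) \<odot> (y \<oplus> z \<otimes> z)" for z
  obtain z where z: "z \<in> D" "f z = z"
  proof (rule contraction_fixed_point[of D f \<rho>])
    show "D \<subseteq> carrier A" by (auto simp: D_def)
    show "D \<noteq> {}" using \<rho> by (auto simp: D_def intro!: exI[of _ \<zero>])
    show "l \<in> D" if s: "range s \<subseteq> D" "tends s l" for s l
    proof -
      have sD: "s n \<in> D" for n using s by auto
      have "l \<in> carrier A" using s by (auto simp: tends_def)
      moreover have "star A l = l"
        using tends_star[OF s(2)] sD s(2) by (auto simp: D_def intro: tends_unique)
      moreover have "\<parallel>l\<parallel> \<le> \<rho>" using s(2) sD by (auto simp: D_def intro: tends_cnorm_le)
      moreover have "w \<otimes> l = l \<otimes> w" if w: "w \<in> carrier A" "w \<otimes> y = y \<otimes> w" for w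
      proof (rule tends_unique)
        show "tends (\<lambda>n. w \<otimes> s n) (w \<otimes> l)" by (intro tends_mult_left s w)
        show "tends (\<lambda>n. w \<otimes> s n) (l \<otimes> w)"
          using tends_mult_right[OF s(2) w(1)] sD w by (simp add: D_def)
      qed
      ultimately show ?thesis by (simp add: D_def)
    qed
    show "f z \<in> D" if "z \<in> D" for z
    proof -
      have c: "z \<in> carrier A" "star A z = z" "\<parallel>z\<parallel> \<le> \<rho>"
        and w: "\<And>w. \<lbrakk>w \<in> carrier A; w \<otimes> y = y \<otimes> w\<rbrakk> \<Longrightarrow> w \<otimes> z = z \<otimes> w"
        using that by (auto simp: D_def)
      have "\<parallel>z \<otimes> z\<parallel> \<le> \<rho>\<^sup>2"
        using c by (simp add: cnorm_square power_mono)
      then have "\<parallel>y \<oplus> z \<otimes> z\<parallel> \<le> 2 * \<rho>"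
        using cnorm_triangle[of y "z \<otimes> z"] c y \<rho>q by simp
      then have "\<parallel>f z\<parallel> \<le> \<rho>" using c y by (simp add: f_def cnorm_smult)
      moreover have "star A (f z) = f z"
        using c y by (simp add: f_def star_smult star_add star_mult)
      moreover have "u \<otimes> f z = f z \<otimes> u" if u: "u \<in> carrier A" "u \<otimes> y = y \<otimes> u" for u
      proof -
        have "u \<otimes> (z \<otimes> z) = z \<otimes> z \<otimes> u"
          using w[OF u] u c by (metis m_assoc)
        then show ?thesis
          using u c y by (simp add: f_def smult_mult_left smult_mult_right l_distr r_distr)
      qed
      ultimately show ?thesis using c y by (simp add: D_def f_def)
    qed
    show "\<parallel>f x \<ominus> f x'\<parallel> \<le> \<rho> * \<parallel>x \<ominus> x'\<parallel>" if "x \<in> D" "x' \<in> D" for x x'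
    proof -
      have c: "x \<in> carrier A" "x' \<in> carrier A" "\<parallel>x\<parallel> \<le> \<rho>" "\<parallel>x'\<parallel> \<le> \<rho>"
        using that by (auto simp: D_def)
      \<comment> \<open>A difference of squares in a form that does not use commutativity.\<close>
      have "(y \<oplus> x \<otimes> x) \<ominus> (y \<oplus> x' \<otimes> x') = x \<otimes> (x \<ominus> x') \<oplus> (x \<ominus> x') \<otimes> x'"
        using c y by algebra
      then have "f x \<ominus> f x' = (1/2) \<odot> (x \<otimes> (x \<ominus> x') \<oplus> (x \<ominus> x') \<otimes> x')"
        using c y by (simp add: f_def smult_diff_right[symmetric])
      then have "\<parallel>f x \<ominus> f x'\<parallel> = 1/2 * \<parallel>x \<otimes> (x \<ominus> x') \<oplus> (x \<ominus> x') \<otimes> x'\<parallel>"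
        using c by (simp add: cnorm_smult)
      also have "\<dots> \<le> 1/2 * (\<parallel>x\<parallel> * \<parallel>x \<ominus> x'\<parallel> + \<parallel>x \<ominus> x'\<parallel> * \<parallel>x'\<parallel>)"
        using c by (intro mult_left_mono order_trans[OF cnorm_triangle] add_mono cnorm_mult) auto
      also have "\<dots> \<le> 1/2 * (\<rho> * \<parallel>x \<ominus> x'\<parallel> + \<parallel>x \<ominus> x'\<parallel> * \<rho>)"
        using c by (intro mult_left_mono add_mono mult_right_mono) auto
      finally show ?thesis by (simp add: algebra_simps)
    qed
  qed (use \<rho> in auto)
  have zc: "z \<in> carrier A" "star A z = z" "\<parallel>z\<parallel> \<le> \<rho>" using z by (auto simp: D_def)
  have "z \<oplus> z = f z \<oplus> f z" using z by simp
  also have "\<dots> = y \<oplus> z \<otimes> z" using zc y by (simp add: add_self f_def smult_smult)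
  finally have zz: "z \<oplus> z = y \<oplus> z \<otimes> z" .
  define k where "k = \<one> \<ominus> z"
  have "k \<otimes> k = \<one> \<ominus> (z \<oplus> z) \<oplus> z \<otimes> z" unfolding k_def using zc by algebra
  also have "\<dots> = \<one> \<ominus> y" unfolding zz using zc y by algebra
  finally have "k \<otimes> k = a" using ay by simp
  moreover have "\<one> \<ominus> k = z" unfolding k_def using zc by algebra
  then have "\<parallel>\<one> \<ominus> k\<parallel> \<le> \<parallel>\<one> \<ominus> a\<parallel>" using zc(3) \<open>\<rho> \<le> q\<close> by (simp add: q_def y_def)
  moreover have "w \<otimes> k = k \<otimes> w" if w: "w \<in> carrier A" "w \<otimes> a = a \<otimes> w" for w
  proof -
    have "w \<otimes> y = y \<otimes> w"
      using w a(1) by (simp add: y_def a_minus_def l_distr r_distr l_minus r_minus)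
    then have "w \<otimes> z = z \<otimes> w" using z(1) w by (auto simp: D_def)
    then show ?thesis
      using w zc by (simp add: k_def a_minus_def l_distr r_distr l_minus r_minus)
  qed
  ultimately show ?thesis
    using that[of k] zc by (simp add: k_def star_diff)
qed

text \<open>\<open>h\<^sup>2 + k\<^sup>2 = z\<^sup>* z\<close> for \<open>z = h + i k\<close>, and \<open>h\<close> is the real part of \<open>z\<close>.\<close>

lemma cnorm_square_le_sum_squares:
  assumes h: "h \<in> carrier A" "star A h = h" and k: "k \<in> carrier A" "star A k = k"
    and hk: "h \<otimes> k = k \<otimes> h"
  shows "\<parallel>h \<otimes> h\<parallel> \<le> \<parallel>h \<otimes> h \<oplus> k \<otimes> k\<parallel>"
proof -
  define z where "z = h \<oplus> \<i> \<odot> k"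
  have z: "z \<in> carrier A" "star A z = h \<oplus> (-\<i>) \<odot> k"
    using h k by (auto simp: z_def star_add star_smult)
  have "star A z \<otimes> z = (h \<otimes> h \<oplus> (-\<i>) \<odot> (k \<otimes> h)) \<oplus> (\<i> \<odot> (h \<otimes> k) \<oplus> k \<otimes> k)"
    unfolding z using h k
    by (simp add: z_def l_distr r_distr smult_mult_left smult_mult_right smult_smult smult_r_distr)
  also have "\<dots> = h \<otimes> h \<oplus> k \<otimes> k"
    unfolding hk smult_minus_left[OF m_closed[OF k(1) h(1)]] using h k smult_closed[of "k \<otimes> h" \<i>] by algebra
  finally have zz: "star A z \<otimes> z = h \<otimes> h \<oplus> k \<otimes> k" .
  have "z \<oplus> star A z = (h \<oplus> h) \<oplus> (\<i> + - \<i>) \<odot> k"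
    unfolding z smult_l_distr[OF k(1)] using h k
    by (simp add: z_def a_ac)
  also have "\<dots> = 2 \<odot> h" using h k by (simp add: add_self)
  finally have "2 * \<parallel>h\<parallel> = \<parallel>z \<oplus> star A z\<parallel>" using h by (simp add: cnorm_smult)
  also have "\<dots> \<le> 2 * \<parallel>z\<parallel>" using cnorm_triangle[of z "star A z"] z(1) by simp
  finally have "(\<parallel>h\<parallel>)\<^sup>2 \<le> (\<parallel>z\<parallel>)\<^sup>2" using h by (simp add: power_mono)
  then show ?thesis using cstar_identity[OF z(1)] zz cnorm_square[OF h] by simp
qed

section \<open>Real scalars and positive elements\<close>

definition scalar :: "real \<Rightarrow> 'a" where "scalar t = complex_of_real t \<odot> \<one>"

lemma scalar_closed [simp, intro]: "scalar t \<in> carrier A"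
  by (simp add: scalar_def)

lemma scalar_one [simp]: "scalar 1 = \<one>"
  by (simp add: scalar_def)

lemma scalar_add: "scalar (s + t) = scalar s \<oplus> scalar t"
  by (simp add: scalar_def smult_l_distr)

lemma scalar_diff: "scalar (s - t) = scalar s \<ominus> scalar t"
  by (simp add: scalar_def smult_diff_left)

lemma smult_scalar: "complex_of_real s \<odot> scalar t = scalar (s * t)"
  by (simp add: scalar_def smult_smult)

lemma star_scalar [simp]: "star A (scalar t) = scalar t"
  by (simp add: scalar_def star_smult)

lemma cnorm_scalar_le: "\<parallel>scalar t\<parallel> \<le> \<bar>t\<bar>"
  using cnorm_smult_one_le[of "complex_of_real t"] by (simp add: scalar_def)

lemma scalar_mult_left: "x \<in> carrier A \<Longrightarrow> scalar t \<otimes> x = complex_of_real t \<odot> x"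
  by (simp add: scalar_def smult_one_left)

lemma scalar_mult_right: "x \<in> carrier A \<Longrightarrow> x \<otimes> scalar t = complex_of_real t \<odot> x"
  by (simp add: scalar_def smult_one_right)

lemma of_real_smult_smult:
  "x \<in> carrier A \<Longrightarrow> complex_of_real s \<odot> (complex_of_real t \<odot> x) = complex_of_real (s * t) \<odot> x"
  by (simp add: smult_smult)

text \<open>Asking for the bound only at large \<open>t\<close> makes closure under sums a matter of
  the triangle inequality. That every \<open>t \<ge> \<parallel>a\<parallel>\<close> then works is
  \<open>cnorm_scalar_minus_pos_le\<close>.\<close>

definition pos :: "'a \<Rightarrow> bool" where
  "pos a \<longleftrightarrow> a \<in> carrier A \<and> star A a = a \<and> (\<exists>T. \<forall>t\<ge>T. \<parallel>scalar t \<ominus> a\<parallel> \<le> t)"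

lemma posD: "pos a \<Longrightarrow> a \<in> carrier A" "pos a \<Longrightarrow> star A a = a"
  by (auto simp: pos_def)

text \<open>Scale \<open>h\<close> to \<open>g\<close> with
  \<open>\<parallel>g \<otimes> g\<parallel> < 1\<close> and let \<open>k\<close> be the square root
  of \<open>\<one> \<ominus> g \<otimes> g\<close>. It commutes with \<open>g\<close>, and
  \<open>k \<otimes> k \<oplus> g \<otimes> g = \<one>\<close>, so
  \<open>\<parallel>\<one> \<ominus> g \<otimes> g\<parallel> \<le> 1\<close> by
  \<open>cnorm_square_le_sum_squares\<close>.\<close>

lemma cnorm_scalar_minus_square_le:
  assumes h: "h \<in> carrier A" "star A h = h" and t: "(\<parallel>h\<parallel>)\<^sup>2 < t"
  shows "\<parallel>scalar t \<ominus> h \<otimes> h\<parallel> \<le> t"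
proof -
  have t0: "0 < t" using t zero_le_power2[of "\<parallel>h\<parallel>"] by linarith
  define g where "g = complex_of_real (1 / sqrt t) \<odot> h"
  have g: "g \<in> carrier A" "star A g = g" using h by (auto simp: g_def star_smult)
  have "1 / sqrt t * (1 / sqrt t) = 1 / t" using t0 by simp
  then have gg: "g \<otimes> g = complex_of_real (1 / t) \<odot> (h \<otimes> h)"
    using h by (simp only: g_def smult_mult_left smult_mult_right of_real_smult_smult smult_closed m_closed)
  have gn: "\<parallel>g \<otimes> g\<parallel> < 1"
    unfolding gg using h t t0 by (simp add: cnorm_smult cnorm_square del: of_real_divide)
  have "\<one> \<ominus> (\<one> \<ominus> g \<otimes> g) = g \<otimes> g" using g by algebra
  then have "\<parallel>\<one> \<ominus> (\<one> \<ominus> g \<otimes> g)\<parallel> < 1" using gn by simp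
  moreover have "\<one> \<ominus> g \<otimes> g \<in> carrier A" "star A (\<one> \<ominus> g \<otimes> g) = \<one> \<ominus> g \<otimes> g"
    using g by (auto simp: star_diff star_mult)
  ultimately obtain k where k: "k \<in> carrier A" "star A k = k" "k \<otimes> k = \<one> \<ominus> g \<otimes> g"
    "\<And>w. \<lbrakk>w \<in> carrier A; w \<otimes> (\<one> \<ominus> g \<otimes> g) = (\<one> \<ominus> g \<otimes> g) \<otimes> w\<rbrakk> \<Longrightarrow> w \<otimes> k = k \<otimes> w"
    using sqrt_near_one[of "\<one> \<ominus> g \<otimes> g"] by metis
  have "g \<otimes> (\<one> \<ominus> g \<otimes> g) = (\<one> \<ominus> g \<otimes> g) \<otimes> g" using g by algebra
  then have "k \<otimes> g = g \<otimes> k" using k(4)[of g] g by simp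
  then have "\<parallel>k \<otimes> k\<parallel> \<le> \<parallel>k \<otimes> k \<oplus> g \<otimes> g\<parallel>"
    by (intro cnorm_square_le_sum_squares k(1,2) g)
  also have "k \<otimes> k \<oplus> g \<otimes> g = \<one>" unfolding k(3) using g by algebra
  finally have "\<parallel>\<one> \<ominus> g \<otimes> g\<parallel> \<le> 1" using cnorm_one_le k(3) by simp
  moreover have "complex_of_real t \<odot> (g \<otimes> g) = h \<otimes> h"
    using h t0 unfolding gg by (subst of_real_smult_smult) auto
  then have "scalar t \<ominus> h \<otimes> h = complex_of_real t \<odot> (\<one> \<ominus> g \<otimes> g)"
    using g by (simp add: smult_diff_right scalar_def)
  ultimately show ?thesis using g t0 by (simp add: cnorm_smult)
qed

lemma pos_square:
  assumes "h \<in> carrier A" "star A h = h"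
  shows "pos (h \<otimes> h)"
  unfolding pos_def
  using assms cnorm_scalar_minus_square_le[OF assms]
  by (auto simp: star_mult intro!: exI[of _ "(\<parallel>h\<parallel>)\<^sup>2 + 1"])

lemma pos_add:
  assumes "pos a" "pos b"
  shows "pos (a \<oplus> b)"
proof -
  obtain S T where S: "\<And>t. S \<le> t \<Longrightarrow> \<parallel>scalar t \<ominus> a\<parallel> \<le> t" and T: "\<And>t. T \<le> t \<Longrightarrow> \<parallel>scalar t \<ominus> b\<parallel> \<le> t"
    using assms by (auto simp: pos_def)
  have c: "a \<in> carrier A" "b \<in> carrier A" "star A a = a" "star A b = b"
    using assms by (auto simp: pos_def)
  have "\<parallel>scalar t \<ominus> (a \<oplus> b)\<parallel> \<le> t" if "S + T \<le> t" for t
  proof -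
    have "scalar t = scalar S \<oplus> scalar (t - S)" using scalar_add[of S "t - S"] by simp
    then have "scalar t \<ominus> (a \<oplus> b) = (scalar S \<ominus> a) \<oplus> (scalar (t - S) \<ominus> b)"
      using c scalar_closed[of "S"]
        scalar_closed[of "t - S"] by algebra
    also have "\<parallel>\<dots>\<parallel> \<le> S + (t - S)"
      using c that by (intro order_trans[OF cnorm_triangle] add_mono S T) auto
    finally show ?thesis by simp
  qed
  then show ?thesis using c unfolding pos_def by (auto simp: star_add)
qed

lemma pos_scalar: "0 \<le> t \<Longrightarrow> pos (scalar t)"
  using pos_square[of "scalar (sqrt t)"]
  by (simp add: scalar_mult_left smult_scalar)

text \<open>After division by \<open>t + e\<close> the element \<open>a \<oplus> scalar e\<close>
  lies at distance at most \<open>t / (t + e) < 1\<close> from \<open>\<one>\<close>. The shift by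
  \<open>e\<close> makes the inequality strict, and the root of the scaled element is at least as
  close to \<open>\<one>\<close>, hence invertible.\<close>

lemma pos_add_scalar_sqrt:
  assumes "pos a" "0 < e"
  obtains k where "k \<in> Units A" "star A k = k" "k \<otimes> k = a \<oplus> scalar e"
    "\<And>w. \<lbrakk>w \<in> carrier A; w \<otimes> a = a \<otimes> w\<rbrakk> \<Longrightarrow> w \<otimes> k = k \<otimes> w"
proof -
  obtain T where T: "\<And>t. T \<le> t \<Longrightarrow> \<parallel>scalar t \<ominus> a\<parallel> \<le> t"
    and a: "a \<in> carrier A" "star A a = a"
    using assms by (auto simp: pos_def)
  \<comment> \<open>The maximum keeps \<open>t\<close> positive while staying in the range where the
    bound holds.\<close>
  define t where "t = max T 1"
  define r where "r = sqrt (t + e)"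
  have t: "\<parallel>scalar t \<ominus> a\<parallel> \<le> t" "0 < t" "0 < t + e" using T assms by (auto simp: t_def)
  have r: "0 < r" "r * r = t + e" using t by (auto simp: r_def)
  define b where "b = complex_of_real (1 / (t + e)) \<odot> (a \<oplus> scalar e)"
  have b: "b \<in> carrier A" "star A b = b" using a by (auto simp: b_def star_add star_smult)
  have "complex_of_real (1 / (t + e)) \<odot> scalar (t + e) = \<one>"
    using t by (subst smult_scalar) simp
  then have "\<one> \<ominus> b = complex_of_real (1 / (t + e)) \<odot> (scalar (t + e) \<ominus> (a \<oplus> scalar e))"
    unfolding b_def using a by (subst smult_diff_right) auto
  also have "scalar (t + e) \<ominus> (a \<oplus> scalar e) = scalar t \<ominus> a"
    unfolding scalar_add using a scalar_closed[of "t"]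
        scalar_closed[of "e"] by algebra
  finally have "\<parallel>\<one> \<ominus> b\<parallel> = \<parallel>scalar t \<ominus> a\<parallel> / (t + e)"
    using a t by (simp add: cnorm_smult del: of_real_divide of_real_add)
  also have "\<dots> < 1" using t assms(2) by simp
  finally have b1: "\<parallel>\<one> \<ominus> b\<parallel> < 1" .
  obtain j where j: "j \<in> carrier A" "star A j = j" "j \<otimes> j = b" "\<parallel>\<one> \<ominus> j\<parallel> \<le> \<parallel>\<one> \<ominus> b\<parallel>"
    "\<And>w. \<lbrakk>w \<in> carrier A; w \<otimes> b = b \<otimes> w\<rbrakk> \<Longrightarrow> w \<otimes> j = j \<otimes> w"
    using sqrt_near_one[OF b b1] by metis
  define k where "k = complex_of_real r \<odot> j"
  have "k \<in> Units A"
    unfolding k_def using j b1 r by (intro smult_Units Units_near_one) auto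
  moreover have "star A k = k" using j by (simp add: k_def star_smult)
  moreover have "k \<otimes> k = complex_of_real (t + e) \<odot> b"
    unfolding r(2)[symmetric] using j(1,3) b(1)
    by (simp only: k_def smult_mult_left smult_mult_right of_real_smult_smult smult_closed)
  moreover have "complex_of_real (t + e) \<odot> b = a \<oplus> scalar e"
  proof -
    have "(t + e) * (1 / (t + e)) = 1" using t(3) by simp
    then show ?thesis
      using a by (simp only: b_def of_real_smult_smult a_closed scalar_closed of_real_1 smult_one)
  qed
  moreover have "w \<otimes> k = k \<otimes> w" if w: "w \<in> carrier A" "w \<otimes> a = a \<otimes> w" for w
  proof -
    have "w \<otimes> b = b \<otimes> w"
      using w a by (simp add: b_def smult_mult_left smult_mult_right l_distr r_distr scalar_mult_left scalar_mult_right)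
    then show ?thesis using j(5)[OF w(1)] w j(1) by (simp add: k_def smult_mult_left smult_mult_right)
  qed
  ultimately show ?thesis using that by metis
qed

text \<open>Up to a shift by \<open>e\<close>, \<open>a\<close> is a square
  \<open>k \<otimes> k\<close> with \<open>\<parallel>k\<parallel>^2 < t + 2 * e\<close>, and for
  squares the bound is known.\<close>

lemma cnorm_scalar_minus_pos_le:
  assumes a: "pos a" and t: "\<parallel>a\<parallel> \<le> t"
  shows "\<parallel>scalar t \<ominus> a\<parallel> \<le> t"
proof (rule field_le_epsilon)
  fix d :: real assume "d > 0"
  \<comment> \<open>The estimate loses \<open>3 * e\<close>: the threshold moves to
    \<open>t + 2 * e\<close>, and removing the last \<open>scalar e\<close> costs another
    \<open>e\<close>.\<close>
  define e where "e = d / 3"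
  have e: "e > 0" using \<open>d > 0\<close> by (simp add: e_def)
  have ac: "a \<in> carrier A" using a by (simp add: pos_def)
  obtain k where k: "k \<in> Units A" "star A k = k" "k \<otimes> k = a \<oplus> scalar e"
    using pos_add_scalar_sqrt[OF a e] by metis
  have kc: "k \<in> carrier A" using k by auto
  have "(\<parallel>k\<parallel>)\<^sup>2 \<le> \<parallel>a\<parallel> + e"
    using cnorm_square[OF kc k(2)] k(3) cnorm_triangle[of a "scalar e"] cnorm_scalar_le[of e] ac e by simp
  then have "(\<parallel>k\<parallel>)\<^sup>2 < t + 2 * e" using t e by simp
  then have "\<parallel>scalar (t + 2 * e) \<ominus> (a \<oplus> scalar e)\<parallel> \<le> t + 2 * e"
    using cnorm_scalar_minus_square_le[OF kc k(2)] k(3) by simp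
  moreover have "scalar (t + 2 * e) = scalar t \<oplus> scalar e \<oplus> scalar e"
    using scalar_add[of "t + e" e] scalar_add[of t e] by (simp add: algebra_simps)
  then have "scalar t \<ominus> a = (scalar (t + 2 * e) \<ominus> (a \<oplus> scalar e)) \<ominus> scalar e"
    using ac scalar_closed[of "t"]
        scalar_closed[of "e"] by algebra
  ultimately show "\<parallel>scalar t \<ominus> a\<parallel> \<le> t + d"
    using cnorm_diff_triangle[of "scalar (t + 2 * e) \<ominus> (a \<oplus> scalar e)" "scalar e"]
      cnorm_scalar_le[of e] e ac by (simp add: e_def)
qed

text \<open>By \<open>cnorm_scalar_minus_pos_le\<close> the threshold
  \<open>\<parallel>a\<parallel> + 1\<close> serves all shifts \<open>e < 1\<close> at once, so
  \<open>e\<close> can tend to 0 while \<open>t\<close> is fixed.\<close>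

lemma pos_limit:
  assumes a: "a \<in> carrier A" "star A a = a" and "\<And>e. e > 0 \<Longrightarrow> pos (a \<oplus> scalar e)"
  shows "pos a"
  unfolding pos_def
proof (intro conjI a exI allI impI)
  fix t assume t: "\<parallel>a\<parallel> + 1 \<le> t"
  have "\<parallel>scalar t \<ominus> a\<parallel> \<le> t + e" if e: "0 < e" "e < 1" for e
  proof -
    have "\<parallel>a \<oplus> scalar e\<parallel> \<le> t"
      using cnorm_triangle[of a "scalar e"] cnorm_scalar_le[of e] a e t by simp
    then have "\<parallel>scalar t \<ominus> (a \<oplus> scalar e)\<parallel> \<le> t"
      by (intro cnorm_scalar_minus_pos_le assms e)
    moreover have "scalar t \<ominus> a = (scalar t \<ominus> (a \<oplus> scalar e)) \<oplus> scalar e"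
      using a scalar_closed[of "t"]
        scalar_closed[of "e"] by algebra
    ultimately show ?thesis
      using cnorm_triangle[of "scalar t \<ominus> (a \<oplus> scalar e)" "scalar e"]
        cnorm_scalar_le[of e] e a by simp
  qed
  then have "\<parallel>scalar t \<ominus> a\<parallel> \<le> t + min d (1/2)" if "0 < d" for d
    using that by simp
  then have "\<parallel>scalar t \<ominus> a\<parallel> \<le> t + d" if "0 < d" for d
    using that by (smt (verit))
  then show "\<parallel>scalar t \<ominus> a\<parallel> \<le> t" by (rule field_le_epsilon)
qed

text \<open>After a shift by \<open>e\<close>, both \<open>a\<close> and
  \<open>scalar s \<ominus> a\<close> have square roots, and the squares of these roots add up to
  \<open>scalar (s + 2 * e)\<close>. The roots commute, so the sum dominates each square in
  norm.\<close>

lemma cnorm_le_of_pos_diff_scalar: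
  assumes a: "pos a" and b: "pos (scalar s \<ominus> a)" and s: "0 \<le> s"
  shows "\<parallel>a\<parallel> \<le> s"
proof (rule field_le_epsilon)
  fix d :: real assume "d > 0"
  define e where "e = d / 3"
  have e: "e > 0" using \<open>d > 0\<close> by (simp add: e_def)
  have ac: "a \<in> carrier A" using a by (simp add: pos_def)
  obtain k where k: "k \<in> Units A" "star A k = k" "k \<otimes> k = a \<oplus> scalar e"
    "\<And>w. \<lbrakk>w \<in> carrier A; w \<otimes> a = a \<otimes> w\<rbrakk> \<Longrightarrow> w \<otimes> k = k \<otimes> w"
    using pos_add_scalar_sqrt[OF a e] by metis
  obtain j where j: "j \<in> Units A" "star A j = j" "j \<otimes> j = (scalar s \<ominus> a) \<oplus> scalar e"
    "\<And>w. \<lbrakk>w \<in> carrier A; w \<otimes> (scalar s \<ominus> a) = (scalar s \<ominus> a) \<otimes> w\<rbrakk> \<Longrightarrow> w \<otimes> j = j \<otimes> w"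
    using pos_add_scalar_sqrt[OF b e] by metis
  have kc: "k \<in> carrier A" "j \<in> carrier A" using k j by auto
  have "a \<otimes> (scalar s \<ominus> a) = (scalar s \<ominus> a) \<otimes> a"
    using ac by (simp add: a_minus_def l_distr r_distr l_minus r_minus scalar_mult_left scalar_mult_right)
  \<comment> \<open>Each root commutes with whatever commutes with the element it was built from:
    this gives \<open>a\<close> and \<open>j\<close> first, then \<open>j\<close> and
    \<open>k\<close>.\<close>
  then have "j \<otimes> a = a \<otimes> j" using j(4)[of a, OF ac] by simp
  then have "k \<otimes> j = j \<otimes> k" using k(4)[of j, OF kc(2)] by simp
  then have "\<parallel>k \<otimes> k\<parallel> \<le> \<parallel>k \<otimes> k \<oplus> j \<otimes> j\<parallel>"
    by (intro cnorm_square_le_sum_squares kc k(2) j(2))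
  also have "k \<otimes> k \<oplus> j \<otimes> j = scalar s \<oplus> scalar e \<oplus> scalar e"
    unfolding k j using ac scalar_closed[of "s"]
        scalar_closed[of "e"] by algebra
  also have "\<dots> = scalar (s + 2 * e)"
    using scalar_add[of "s + e" e] scalar_add[of s e] by (simp add: algebra_simps)
  also have "\<parallel>\<dots>\<parallel> \<le> s + 2 * e" using cnorm_scalar_le[of "s + 2 * e"] s e by simp
  finally have "\<parallel>a \<oplus> scalar e\<parallel> \<le> s + 2 * e" using k by simp
  moreover have "a = (a \<oplus> scalar e) \<ominus> scalar e"
    using ac scalar_closed[of "e"] by algebra
  then have "\<parallel>a\<parallel> \<le> \<parallel>a \<oplus> scalar e\<parallel> + \<parallel>scalar e\<parallel>"
    using cnorm_diff_triangle[of "a \<oplus> scalar e" "scalar e"] ac by simp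
  ultimately show "\<parallel>a\<parallel> \<le> s + d" using cnorm_scalar_le[of e] e by (simp add: e_def)
qed

lemma pos_cnorm_minus:
  assumes s: "s \<in> carrier A" "star A s = s"
  shows "pos (scalar (\<parallel>s\<parallel>) \<ominus> s)"
  unfolding pos_def
proof (intro conjI exI allI impI)
  fix t assume t: "\<parallel>s\<parallel> \<le> t"
  have "scalar t \<ominus> (scalar (\<parallel>s\<parallel>) \<ominus> s) = scalar (t - \<parallel>s\<parallel>) \<oplus> s"
    unfolding scalar_diff using s scalar_closed[of "t"]
      scalar_closed[of "\<parallel>s\<parallel>"] by algebra
  then show "\<parallel>scalar t \<ominus> (scalar (\<parallel>s\<parallel>) \<ominus> s)\<parallel> \<le> t"
    using cnorm_triangle[of "scalar (t - \<parallel>s\<parallel>)" s] cnorm_scalar_le[of "t - \<parallel>s\<parallel>"] s t by simp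
qed (use s in \<open>auto simp: star_diff\<close>)

text \<open>The comparison goes through the scalar \<open>\<parallel>s\<parallel>\<close>, from
  which \<open>s\<close>, and hence \<open>a\<close>, differs by a positive element.\<close>

lemma cnorm_mono:
  assumes "pos a" "pos (s \<ominus> a)" "s \<in> carrier A" "star A s = s"
  shows "\<parallel>a\<parallel> \<le> \<parallel>s\<parallel>"
proof (rule cnorm_le_of_pos_diff_scalar[OF assms(1)])
  have "(scalar (\<parallel>s\<parallel>) \<ominus> s) \<oplus> (s \<ominus> a) = scalar (\<parallel>s\<parallel>) \<ominus> a"
    using assms posD by (intro diff_add_diff) auto
  then show "pos (scalar (\<parallel>s\<parallel>) \<ominus> a)"
    using pos_add[OF pos_cnorm_minus[OF assms(3,4)] assms(2)] by simp
qed (use assms in simp)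

text \<open>\<open>h\<close> and \<open>k\<close> are the real and imaginary parts of
  \<open>z\<close>, and the mixed terms cancel between the two products. The factor 2 is written as
  a sum so that \<open>pos_add\<close> and \<open>pos_square\<close> apply directly.\<close>

lemma real_imag_decomposition:
  assumes z: "z \<in> carrier A"
  obtains h k where "h \<in> carrier A" "star A h = h" "k \<in> carrier A" "star A k = k"
    "star A z \<otimes> z \<oplus> z \<otimes> star A z = (h \<otimes> h \<oplus> h \<otimes> h) \<oplus> (k \<otimes> k \<oplus> k \<otimes> k)"
proof -
  define w where "w = star A z"
  define h where "h = (1/2) \<odot> (z \<oplus> w)"
  \<comment> \<open>This is \<open>1 / (2 * \<i>)\<close>.\<close>
  define c where "c = - \<i>/2"
  define k where "k = c \<odot> (z \<ominus> w)"
  have c: "cnj c * (-1) = c" "2 * (c * c) = - (1/2)" by (simp_all add: c_def)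
  have w: "w \<in> carrier A" using z by (simp add: w_def)
  have h: "h \<in> carrier A" "star A h = h"
    using z w by (auto simp: h_def w_def star_smult star_add a_comm)
  have "star A k = cnj c \<odot> (w \<ominus> z)"
    using z w by (simp add: k_def w_def star_smult star_diff)
  also have "w \<ominus> z = (-1) \<odot> (z \<ominus> w)"
    using z w by (simp add: smult_minus_left minus_swap)
  also have "cnj c \<odot> \<dots> = k"
    unfolding smult_smult[OF minus_closed[OF z w]] c k_def ..
  finally have k: "k \<in> carrier A" "star A k = k"
    using z w by (auto simp: k_def)
  have hh: "h \<otimes> h \<oplus> h \<otimes> h = (1/2) \<odot> ((z \<oplus> w) \<otimes> (z \<oplus> w))"
    using z w by (simp add: h_def smult_mult_left smult_mult_right smult_smult add_self)
  have kk: "k \<otimes> k \<oplus> k \<otimes> k = (1/2) \<odot> (\<ominus> ((z \<ominus> w) \<otimes> (z \<ominus> w)))"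
    using z w by (simp add: k_def smult_mult_left smult_mult_right smult_smult add_self c(2)
        smult_minus_left smult_minus_right)
  have "(z \<oplus> w) \<otimes> (z \<oplus> w) \<ominus> (z \<ominus> w) \<otimes> (z \<ominus> w) = (w \<otimes> z \<oplus> z \<otimes> w) \<oplus> (w \<otimes> z \<oplus> z \<otimes> w)"
    using z w by algebra
  then have "(h \<otimes> h \<oplus> h \<otimes> h) \<oplus> (k \<otimes> k \<oplus> k \<otimes> k) = (1/2) \<odot> (2 \<odot> (w \<otimes> z \<oplus> z \<otimes> w))"
    unfolding hh kk using z w by (simp add: smult_r_distr[symmetric] a_minus_def add_self)
  also have "\<dots> = w \<otimes> z \<oplus> z \<otimes> w" using z w by (simp add: smult_smult)
  finally show ?thesis using that[OF h k] by (simp add: w_def)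
qed

lemma four_smult: "x \<in> carrier A \<Longrightarrow> (x \<oplus> x) \<oplus> (x \<oplus> x) = 4 \<odot> x"
  using smult_l_distr[of x 2 2] by (simp add: add_self)

text \<open>With \<open>p = x \<oplus> y\<close> and \<open>m = x \<ominus> y\<close> one has
  \<open>p^2 = m^2 + 4 x y = m^2 + r^2\<close>, so the parallelogram sum
  \<open>2 p^2 + 2 r^2\<close> equals \<open>4 r^2 + 2 m^2\<close>.\<close>

lemma square_sum_identity:
  assumes x: "x \<in> carrier A" and y: "y \<in> carrier A" and r: "r \<in> carrier A"
    and xy: "x \<otimes> y = y \<otimes> x" and rr: "r \<otimes> r = 4 \<odot> (x \<otimes> y)"
  shows "((x \<oplus> y) \<oplus> r) \<otimes> ((x \<oplus> y) \<oplus> r) \<oplus> ((x \<oplus> y) \<ominus> r) \<otimes> ((x \<oplus> y) \<ominus> r) =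
    (r \<oplus> r) \<otimes> (r \<oplus> r) \<oplus> ((x \<ominus> y) \<otimes> (x \<ominus> y) \<oplus> (x \<ominus> y) \<otimes> (x \<ominus> y))"
proof -
  define p where "p = x \<oplus> y"
  define m where "m = x \<ominus> y"
  have p: "p \<in> carrier A" "m \<in> carrier A" using x y by (auto simp: p_def m_def)
  have "p \<otimes> p = m \<otimes> m \<oplus> ((x \<otimes> y \<oplus> y \<otimes> x) \<oplus> (x \<otimes> y \<oplus> y \<otimes> x))"
    unfolding p_def m_def using x y by algebra
  then have pp: "p \<otimes> p = m \<otimes> m \<oplus> r \<otimes> r"
    unfolding xy[symmetric] rr using x y by (simp add: four_smult)
  have "(p \<oplus> r) \<otimes> (p \<oplus> r) \<oplus> (p \<ominus> r) \<otimes> (p \<ominus> r) = (p \<otimes> p \<oplus> p \<otimes> p) \<oplus> (r \<otimes> r \<oplus> r \<otimes> r)"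
    using p r by algebra
  also have "\<dots> = (r \<oplus> r) \<otimes> (r \<oplus> r) \<oplus> (m \<otimes> m \<oplus> m \<otimes> m)"
    unfolding pp using p r by algebra
  finally show ?thesis by (simp add: p_def m_def)
qed

text \<open>The element \<open>z z\<^sup>*\<close> is at least \<open>-e\<close> because \<open>z\<^sup>* z + z z\<^sup>*\<close> is a sum of squares. Commuting a
  power of \<open>\<tau> - z z\<^sup>*\<close> past \<open>z\<close> bounds \<open>(\<tau> \<plusminus> g)\<^sup>2 g\<close> for \<open>g = z\<^sup>* z\<close>, \<open>\<tau> = \<parallel>g\<parallel>\<close>, and the
  sum of the squares of these two elements is \<open>(4 \<tau> g\<^sup>2)\<^sup>2\<close> plus a square.\<close>

lemma cnorm_star_mult_le_of_le_scalar:
  assumes z: "z \<in> carrier A" and e: "0 \<le> e" and pos: "pos (scalar e \<ominus> star A z \<otimes> z)"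
  shows "\<parallel>star A z \<otimes> z\<parallel> \<le> 2 * e"
proof (rule ccontr)
  define g where "g = star A z \<otimes> z"
  define g' where "g' = z \<otimes> star A z"
  define \<tau> where "\<tau> = \<parallel>g\<parallel>"
  define E where "E = scalar e"
  define S where "S = scalar \<tau>"
  define u where "u = S \<oplus> g"
  define v where "v = S \<ominus> g"
  define v' where "v' = S \<ominus> g'"
  have c: "g \<in> carrier A" "g' \<in> carrier A" "E \<in> carrier A" "S \<in> carrier A" "star A z \<in> carrier A"
    and sa: "star A g = g" "star A g' = g'" "star A S = S"
    using z by (auto simp: g_def g'_def star_mult E_def S_def)
  have c': "u \<in> carrier A" "v \<in> carrier A" "v' \<in> carrier A" using c by (auto simp: u_def v_def v'_def)
  assume "\<not> \<parallel>star A z \<otimes> z\<parallel> \<le> 2 * e"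
  then have \<tau>: "2 * e < \<tau>" by (simp add: \<tau>_def g_def)
  then have \<tau>0: "0 < \<tau>" using e by simp
  have zn: "(\<parallel>z\<parallel>)\<^sup>2 = \<tau>" using cstar_identity[OF z] by (simp add: \<tau>_def g_def)
  obtain h k where hk: "h \<in> carrier A" "star A h = h" "k \<in> carrier A" "star A k = k"
    and hk2: "g \<oplus> g' = (h \<otimes> h \<oplus> h \<otimes> h) \<oplus> (k \<otimes> k \<oplus> k \<otimes> k)"
    using real_imag_decomposition[OF z] unfolding g_def g'_def by blast
  have "g' \<oplus> E = (g \<oplus> g') \<oplus> (E \<ominus> g)" using c by algebra
  then have posg': "pos (g' \<oplus> E)"
    unfolding hk2 using pos hk by (auto simp: E_def g_def intro!: pos_add pos_square)
  have SE: "scalar (\<tau> + e) = S \<oplus> E" by (simp add: scalar_add S_def E_def)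
  have "\<parallel>E\<parallel> \<le> e" using cnorm_scalar_le[of e] e by (simp add: E_def)
  have "\<parallel>g'\<parallel> = \<tau>" using cnorm_star'[OF z] zn by (simp add: g'_def)
  then have "\<parallel>g' \<oplus> E\<parallel> \<le> \<tau> + e" using cnorm_triangle[of g' E] c \<open>\<parallel>E\<parallel> \<le> e\<close> by simp
  \<comment> \<open>A scalar that bounds the norm of a positive element also bounds their
    difference; \<open>v'\<close> and, below, \<open>u\<close> are such differences.\<close>
  then have "\<parallel>scalar (\<tau> + e) \<ominus> (g' \<oplus> E)\<parallel> \<le> \<tau> + e" by (rule cnorm_scalar_minus_pos_le[OF posg'])
  moreover have "scalar (\<tau> + e) \<ominus> (g' \<oplus> E) = v'" unfolding SE v'_def using c by algebra
  ultimately have v'n: "\<parallel>v'\<parallel> \<le> \<tau> + e" by simp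
  have "\<parallel>E \<ominus> g\<parallel> \<le> \<tau> + e" using cnorm_diff_triangle[of E g] c \<open>\<parallel>E\<parallel> \<le> e\<close> by (simp add: \<tau>_def)
  then have "\<parallel>scalar (\<tau> + e) \<ominus> (E \<ominus> g)\<parallel> \<le> \<tau> + e"
    using pos by (intro cnorm_scalar_minus_pos_le) (simp_all add: E_def g_def)
  moreover have "scalar (\<tau> + e) \<ominus> (E \<ominus> g) = u" unfolding SE u_def using c by algebra
  ultimately have un: "\<parallel>u\<parallel> \<le> \<tau> + e" by simp
  define U where "U = u \<otimes> u \<otimes> g"
  define V where "V = v \<otimes> v \<otimes> g"
  have "\<parallel>U\<parallel> \<le> \<parallel>u\<parallel> * \<parallel>u\<parallel> * \<tau>"
    unfolding U_def \<tau>_def using c c'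
    by (intro order_trans[OF cnorm_mult] mult_right_mono cnorm_mult) auto
  also have "\<dots> \<le> (\<tau> + e) * (\<tau> + e) * \<tau>"
    using un \<tau>0 e c' by (intro mult_mono) auto
  finally have Un: "\<parallel>U\<parallel> \<le> (\<tau> + e)\<^sup>2 * \<tau>" by (simp add: power2_eq_square)
  have Sz: "S \<otimes> star A z = star A z \<otimes> S" unfolding S_def using z
    by (simp add: scalar_mult_left scalar_mult_right)
  have vz: "v \<otimes> star A z = star A z \<otimes> v'"
    unfolding v_def v'_def g_def g'_def using z c(4) Sz
    by (simp add: a_minus_def l_distr r_distr l_minus r_minus m_assoc)
  have "V = v \<otimes> (v \<otimes> star A z) \<otimes> z" unfolding V_def g_def using c' z by (simp add: m_assoc)
  also have "\<dots> = star A z \<otimes> (v' \<otimes> v') \<otimes> z"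
    using vz c' z by (simp add: m_assoc[symmetric])
  finally have V: "V = star A z \<otimes> (v' \<otimes> v') \<otimes> z" .
  have "\<parallel>V\<parallel> \<le> \<parallel>star A z\<parallel> * (\<parallel>v'\<parallel> * \<parallel>v'\<parallel>) * \<parallel>z\<parallel>"
    unfolding V using c' z
    by (intro order_trans[OF cnorm_mult] mult_right_mono mult_left_mono cnorm_mult) auto
  also have "\<dots> = (\<parallel>v'\<parallel>)\<^sup>2 * (\<parallel>z\<parallel>)\<^sup>2" using z by (simp add: power2_eq_square)
  also have "\<dots> \<le> (\<tau> + e)\<^sup>2 * \<tau>"
    unfolding zn using v'n \<tau>0 c' by (intro mult_right_mono power_mono) auto
  finally have Vn: "\<parallel>V\<parallel> \<le> (\<tau> + e)\<^sup>2 * \<tau>" .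
  define x where "x = complex_of_real (\<tau> * \<tau>) \<odot> g"
  define y where "y = g \<otimes> g \<otimes> g"
  define r where "r = complex_of_real (2 * \<tau>) \<odot> (g \<otimes> g)"
  have xyr: "x \<in> carrier A" "y \<in> carrier A" "r \<in> carrier A"
    and xyr': "star A x = x" "star A y = y" "star A r = r"
    using c sa by (auto simp: x_def y_def r_def star_smult star_mult m_assoc)
  have Sg: "g \<otimes> S = S \<otimes> g" using c by (simp add: S_def scalar_mult_left scalar_mult_right)
  have SSg: "S \<otimes> S \<otimes> g = x"
    using c by (simp add: m_assoc S_def scalar_mult_left smult_mult_left smult_smult x_def)
  have Sgg: "S \<otimes> g \<otimes> g \<oplus> S \<otimes> g \<otimes> g = r"
    using c by (simp add: m_assoc S_def scalar_mult_left smult_mult_left smult_smult add_self r_def)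
  have "u \<otimes> u \<otimes> g = (S \<otimes> S \<otimes> g \<oplus> g \<otimes> g \<otimes> g) \<oplus> (S \<otimes> g \<otimes> g \<oplus> (g \<otimes> S) \<otimes> g)"
    unfolding u_def using c by algebra
  then have U: "U = (x \<oplus> y) \<oplus> r" unfolding Sg SSg Sgg U_def y_def .
  have "v \<otimes> v \<otimes> g = (S \<otimes> S \<otimes> g \<oplus> g \<otimes> g \<otimes> g) \<ominus> (S \<otimes> g \<otimes> g \<oplus> (g \<otimes> S) \<otimes> g)"
    unfolding v_def using c by algebra
  then have V': "V = (x \<oplus> y) \<ominus> r" unfolding Sg SSg Sgg V_def y_def .
  have xy: "x \<otimes> y = y \<otimes> x"
    using c by (simp add: x_def y_def smult_mult_left smult_mult_right m_assoc)
  have rr: "r \<otimes> r = 4 \<odot> (x \<otimes> y)"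
    using c by (simp add: x_def y_def r_def smult_mult_left smult_mult_right m_assoc smult_smult)
  define m where "m = x \<ominus> y"
  have m: "m \<in> carrier A" "star A m = m" using xyr xyr' by (auto simp: m_def star_diff)
  \<comment> \<open>The factor \<open>sqrt 2\<close> turns the doubled square of \<open>m\<close>
    into a single one, as \<open>cnorm_square_le_sum_squares\<close> takes two squares.\<close>
  define j where "j = complex_of_real (sqrt 2) \<odot> m"
  have j: "j \<in> carrier A" "star A j = j" using m by (auto simp: j_def star_smult)
  have "complex_of_real (sqrt 2) * complex_of_real (sqrt 2) = 2"
    by (simp flip: of_real_mult)
  then have jj: "j \<otimes> j = m \<otimes> m \<oplus> m \<otimes> m"
    using m by (simp add: j_def smult_mult_left smult_mult_right smult_smult add_self)
  have UV: "U \<otimes> U \<oplus> V \<otimes> V = (r \<oplus> r) \<otimes> (r \<oplus> r) \<oplus> j \<otimes> j"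
    unfolding jj U V' m_def by (rule square_sum_identity[OF xyr xy rr])
  have rm: "r \<otimes> m = m \<otimes> r"
    unfolding m_def x_def y_def r_def using c
    by (simp add: a_minus_def l_distr r_distr l_minus r_minus smult_mult_left smult_mult_right
        smult_minus_right smult_r_distr m_assoc smult_smult mult_ac)
  have "\<parallel>(r \<oplus> r) \<otimes> (r \<oplus> r)\<parallel> \<le> \<parallel>(r \<oplus> r) \<otimes> (r \<oplus> r) \<oplus> j \<otimes> j\<parallel>"
    by (rule cnorm_square_le_sum_squares)
      (use xyr xyr' j m rm in \<open>auto simp: star_add j_def smult_mult_left smult_mult_right l_distr r_distr smult_r_distr\<close>)
  also have "\<dots> \<le> \<parallel>U\<parallel> * \<parallel>U\<parallel> + \<parallel>V\<parallel> * \<parallel>V\<parallel>"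
    unfolding UV[symmetric] using c c'
    by (intro order_trans[OF cnorm_triangle] add_mono cnorm_mult) (auto simp: U_def V_def)
  also have "\<dots> \<le> ((\<tau> + e)\<^sup>2 * \<tau>) * ((\<tau> + e)\<^sup>2 * \<tau>) + ((\<tau> + e)\<^sup>2 * \<tau>) * ((\<tau> + e)\<^sup>2 * \<tau>)"
    using Un Vn \<tau>0 c c' by (intro add_mono mult_mono) (auto simp: U_def V_def)
  finally have 1: "\<parallel>(r \<oplus> r) \<otimes> (r \<oplus> r)\<parallel> \<le> 2 * (((\<tau> + e)\<^sup>2 * \<tau>) * ((\<tau> + e)\<^sup>2 * \<tau>))" by linarith
  have "\<parallel>r \<oplus> r\<parallel> = 4 * \<tau> * \<tau>\<^sup>2"
    using c sa \<tau>0 by (simp add: r_def add_self smult_smult cnorm_smult cnorm_square norm_mult \<tau>_def)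
  then have "\<parallel>(r \<oplus> r) \<otimes> (r \<oplus> r)\<parallel> = (4 * \<tau> * \<tau>\<^sup>2)\<^sup>2"
    using xyr xyr' by (simp add: cnorm_square star_add)
  then have 2: "(4 * \<tau> * \<tau>\<^sup>2)\<^sup>2 \<le> 2 * (((\<tau> + e)\<^sup>2 * \<tau>) * ((\<tau> + e)\<^sup>2 * \<tau>))" using 1 by simp
  \<comment> \<open>From \<open>e < \<tau> / 2\<close> one gets
    \<open>16 * \<tau>^6 \<le> 2 * (9/4)^2 * \<tau>^6 = 81/8 * \<tau>^6\<close>, impossible for
    \<open>\<tau> > 0\<close>.\<close>
  have "(\<tau> + e)\<^sup>2 \<le> (3/2 * \<tau>)\<^sup>2" using \<tau> e by (intro power_mono) auto
  then have "(\<tau> + e)\<^sup>2 * \<tau> \<le> 9/4 * \<tau>^3"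
    using \<tau>0 by (simp add: power2_eq_square power3_eq_cube mult.assoc)
  from this this have "((\<tau> + e)\<^sup>2 * \<tau>) * ((\<tau> + e)\<^sup>2 * \<tau>) \<le> (9/4 * \<tau>^3) * (9/4 * \<tau>^3)"
    by (rule mult_mono) (use \<tau>0 in auto)
  then have "(4 * \<tau> * \<tau>\<^sup>2)\<^sup>2 \<le> 2 * ((9/4 * \<tau>^3) * (9/4 * \<tau>^3))" using 2 by linarith
  moreover have "(4 * \<tau> * \<tau>\<^sup>2)\<^sup>2 = 16 * (\<tau>^3 * \<tau>^3)" by (simp add: power2_eq_square power3_eq_cube)
  moreover have "0 < \<tau>^3 * \<tau>^3" using \<tau>0 by simp
  ultimately show False by linarith
qed

text \<open>For \<open>a = x\<^sup>* x\<close> and \<open>c = a + t' = k\<^sup>2\<close>, the element \<open>z = x k\<^sup>-\<^sup>1\<close> satisfies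
  \<open>z\<^sup>* z = 1 - t' c\<^sup>-\<^sup>1 \<le> 1\<close>, so the previous bound controls \<open>t' \<parallel>c\<^sup>-\<^sup>1\<parallel>\<close>; hence the shift can be
  decreased by a fixed factor.\<close>

lemma pos_star_mult_shrink:
  assumes x: "x \<in> carrier A" and t: "0 < t" and pos: "pos (star A x \<otimes> x \<oplus> scalar t)"
  shows "pos (star A x \<otimes> x \<oplus> scalar (5 / 6 * t))"
proof -
  define a where "a = star A x \<otimes> x"
  \<comment> \<open>\<open>t' > t\<close> leaves the slack \<open>t / 9\<close> for an invertible
    root. A quarter of \<open>t'\<close> is removed below, and
    \<open>3/4 * 10/9 = 5/6\<close>.\<close>
  define t' where "t' = 10 / 9 * t"
  have a: "a \<in> carrier A" "star A a = a" using x by (auto simp: a_def star_mult)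
  have t': "0 < t'" using t by (simp add: t'_def)
  have "scalar t \<oplus> scalar (t / 9) = scalar t'"
    by (simp add: scalar_add[symmetric] t'_def)
  then have at: "(star A x \<otimes> x \<oplus> scalar t) \<oplus> scalar (t / 9) = a \<oplus> scalar t'"
    using a by (simp add: a_def[symmetric] a_assoc)
  obtain k where k: "k \<in> Units A" "star A k = k" "k \<otimes> k = a \<oplus> scalar t'"
    using pos_add_scalar_sqrt[OF pos, of "t / 9"] t unfolding at by auto
  have kc: "k \<in> carrier A" using k by auto
  define r where "r = inv k"
  have r: "r \<in> carrier A" "k \<otimes> r = \<one>" "r \<otimes> k = \<one>" using k(1) by (auto simp: r_def)
  have rs: "star A r = r" using star_inv[OF k(1)] k(2) by (simp add: r_def)
  define z where "z = x \<otimes> r"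
  have z: "z \<in> carrier A" using x r by (simp add: z_def)
  have "star A z \<otimes> z = r \<otimes> a \<otimes> r"
    using x r by (simp add: z_def star_mult rs a_def m_assoc)
  also have "a = k \<otimes> k \<ominus> scalar t'" unfolding k(3) using a scalar_closed[of t'] by algebra
  also have "r \<otimes> (k \<otimes> k \<ominus> scalar t') \<otimes> r = (r \<otimes> k) \<otimes> (k \<otimes> r) \<ominus> r \<otimes> (scalar t' \<otimes> r)"
    using r(1) kc scalar_closed[of t'] by algebra
  finally have zz: "star A z \<otimes> z = \<one> \<ominus> complex_of_real t' \<odot> (r \<otimes> r)"
    using r by (simp add: scalar_mult_left smult_mult_right)
  define w where "w = complex_of_real (sqrt t') \<odot> r"
  have w: "w \<in> carrier A" "star A w = w" using r rs by (auto simp: w_def star_smult)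
  have ww: "w \<otimes> w = complex_of_real t' \<odot> (r \<otimes> r)"
    using r t' by (simp add: w_def smult_mult_left smult_mult_right of_real_smult_smult)
  have "scalar 1 \<ominus> star A z \<otimes> z = w \<otimes> w"
    unfolding zz ww[symmetric] scalar_one using w by algebra
  then have "\<parallel>star A z \<otimes> z\<parallel> \<le> 2"
    using cnorm_star_mult_le_of_le_scalar[OF z, of 1] pos_square[OF w] by simp
  moreover have "w \<otimes> w = \<one> \<ominus> star A z \<otimes> z" unfolding zz ww[symmetric] using w by algebra
  ultimately have "\<parallel>w \<otimes> w\<parallel> \<le> 3"
    using cnorm_diff_triangle[of \<one> "star A z \<otimes> z"] cnorm_one_le z by simp
  \<comment> \<open>Here \<open>k \<otimes> k \<otimes> d = scalar (t' / 4)\<close>, and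
    \<open>\<parallel>d\<parallel> \<le> 3/4\<close> allows a square root \<open>j\<close> of
    \<open>\<one> \<ominus> d\<close>; then \<open>k \<otimes> j\<close> is a root of the element
    with the smaller shift.\<close>
  define d where "d = (1/4) \<odot> (w \<otimes> w)"
  have d: "d \<in> carrier A" "star A d = d" using w by (auto simp: d_def star_smult star_mult)
  have "\<parallel>d\<parallel> < 1" using \<open>\<parallel>w \<otimes> w\<parallel> \<le> 3\<close> w by (simp add: d_def cnorm_smult)
  moreover have "\<one> \<ominus> (\<one> \<ominus> d) = d" using d by algebra
  moreover have "\<one> \<ominus> d \<in> carrier A" "star A (\<one> \<ominus> d) = \<one> \<ominus> d"
    using d by (auto simp: star_diff)
  ultimately obtain j where j: "j \<in> carrier A" "star A j = j" "j \<otimes> j = \<one> \<ominus> d"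
    "\<And>w. \<lbrakk>w \<in> carrier A; w \<otimes> (\<one> \<ominus> d) = (\<one> \<ominus> d) \<otimes> w\<rbrakk> \<Longrightarrow> w \<otimes> j = j \<otimes> w"
    using sqrt_near_one[of "\<one> \<ominus> d"] by metis
  have krr: "k \<otimes> (r \<otimes> r) = r" "r \<otimes> r \<otimes> k = r"
    using r kc by (simp_all add: m_assoc[symmetric]) (simp add: m_assoc)
  then have "k \<otimes> d = d \<otimes> k"
    unfolding d_def ww using r kc by (simp add: smult_mult_left smult_mult_right)
  then have "k \<otimes> (\<one> \<ominus> d) = (\<one> \<ominus> d) \<otimes> k"
    using kc d by (simp add: a_minus_def l_distr r_distr l_minus r_minus)
  then have kj: "k \<otimes> j = j \<otimes> k" using j(4) kc by blast
  have "(k \<otimes> j) \<otimes> (k \<otimes> j) = k \<otimes> (j \<otimes> k) \<otimes> j"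
    using kc j(1) by (simp add: m_assoc)
  also have "\<dots> = k \<otimes> k \<otimes> (\<one> \<ominus> d)"
    unfolding kj[symmetric] j(3)[symmetric] using kc j(1) by (simp add: m_assoc)
  also have "\<dots> = k \<otimes> k \<ominus> k \<otimes> (k \<otimes> d)"
    using kc d by algebra
  also have "k \<otimes> (k \<otimes> d) = scalar (t' / 4)"
    unfolding d_def ww using kc r krr
    by (simp add: smult_mult_right smult_smult scalar_def)
  also have "k \<otimes> k \<ominus> scalar (t' / 4) = a \<oplus> (scalar t' \<ominus> scalar (t' / 4))"
    unfolding k(3) using a scalar_closed[of t'] scalar_closed[of "t' / 4"] by algebra
  also have "scalar t' \<ominus> scalar (t' / 4) = scalar (5 / 6 * t)"
    unfolding scalar_diff[symmetric] by (simp add: t'_def)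
  finally have "(k \<otimes> j) \<otimes> (k \<otimes> j) = a \<oplus> scalar (5 / 6 * t)" .
  moreover have "star A (k \<otimes> j) = k \<otimes> j" using kc j(1,2) k(2) kj by (simp add: star_mult)
  ultimately show ?thesis using pos_square[of "k \<otimes> j"] kc j(1) by (simp add: a_def)
qed

text \<open>The shift by \<open>\<parallel>a\<parallel> + 1\<close> makes \<open>a\<close> positive
  at the outset; repeated shrinking by the factor \<open>5/6\<close> sends the shift to 0, and
  \<open>pos_limit\<close> removes it.\<close>

theorem pos_star_mult:
  assumes x: "x \<in> carrier A"
  shows "pos (star A x \<otimes> x)"
proof -
  define a where "a = star A x \<otimes> x"
  define t where "t = \<parallel>a\<parallel> + 1"
  have a: "a \<in> carrier A" "star A a = a" using x by (auto simp: a_def star_mult)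
  have t: "0 < t" using cnorm_nonneg[OF a(1)] unfolding t_def by linarith
  have step: "pos (a \<oplus> scalar ((5/6) ^ n * t))" for n
  proof (induction n)
    case 0
    have "pos (scalar (\<parallel>\<ominus> a\<parallel>) \<ominus> (\<ominus> a))"
      using a by (intro pos_cnorm_minus) (auto simp: star_minus)
    then have "pos ((scalar (\<parallel>a\<parallel>) \<ominus> (\<ominus> a)) \<oplus> scalar 1)"
      using a by (intro pos_add pos_scalar) (simp_all add: cnorm_minus)
    moreover have "(scalar (\<parallel>a\<parallel>) \<ominus> (\<ominus> a)) \<oplus> scalar 1 = a \<oplus> scalar t"
      unfolding t_def scalar_add using a(1) scalar_closed[of "\<parallel>a\<parallel>"] scalar_closed[of 1] by algebra
    ultimately show ?case by simp
  next
    case (Suc n)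
    show ?case
      using pos_star_mult_shrink[OF x, of "(5/6) ^ n * t"] Suc t by (simp add: a_def mult.assoc)
  qed
  have "pos a"
  proof (rule pos_limit[OF a])
    fix e :: real assume "0 < e"
    then obtain n where n: "(5/6) ^ n < e / t"
      using real_arch_pow_inv[of "e / t" "5/6"] t by auto
    then have "(5/6) ^ n * t \<le> e" using t by (simp add: field_simps)
    then have "pos ((a \<oplus> scalar ((5/6) ^ n * t)) \<oplus> scalar (e - (5/6) ^ n * t))"
      by (intro pos_add step pos_scalar) simp
    also have "(a \<oplus> scalar ((5/6) ^ n * t)) \<oplus> scalar (e - (5/6) ^ n * t) = a \<oplus> scalar e"
      unfolding scalar_diff using a scalar_closed[of "(5/6) ^ n * t"] scalar_closed[of e] by algebra
    finally show "pos (a \<oplus> scalar e)" .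
  qed
  then show ?thesis by (simp add: a_def)
qed

section \<open>Matrices over a C*-algebra\<close>

lemma star_finsum:
  "\<lbrakk>finite I; f \<in> I \<rightarrow> carrier A\<rbrakk> \<Longrightarrow> star A (\<Oplus>i\<in>I. f i) = (\<Oplus>i\<in>I. star A (f i))"
  by (induction I rule: finite_induct) (simp_all add: Pi_def star_add)

lemma smult_finsum:
  "\<lbrakk>finite I; f \<in> I \<rightarrow> carrier A\<rbrakk> \<Longrightarrow> c \<odot> (\<Oplus>i\<in>I. f i) = (\<Oplus>i\<in>I. c \<odot> f i)"
  by (induction I rule: finite_induct) (simp_all add: Pi_def smult_r_distr)

lemma cnorm_finsum_le:
  assumes "finite I" "f \<in> I \<rightarrow> carrier A"
  shows "\<parallel>\<Oplus>i\<in>I. f i\<parallel> \<le> (\<Sum>i\<in>I. \<parallel>f i\<parallel>)"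
  using assms
proof (induction I rule: finite_induct)
  case (insert i I)
  then have "\<parallel>f i \<oplus> (\<Oplus>i\<in>I. f i)\<parallel> \<le> \<parallel>f i\<parallel> + \<parallel>\<Oplus>i\<in>I. f i\<parallel>"
    by (intro cnorm_triangle) (auto simp: Pi_def)
  then show ?case using insert by (simp add: Pi_def)
qed simp

lemma pos_zero: "pos \<zero>"
  using pos_square[of \<zero>] by simp

lemma pos_finsum:
  "\<lbrakk>finite I; \<And>i. i \<in> I \<Longrightarrow> pos (f i)\<rbrakk> \<Longrightarrow> pos (\<Oplus>i\<in>I. f i)"
  by (induction I rule: finite_induct) (simp_all add: Pi_def posD pos_zero pos_add)

lemma finsum_swap:
  assumes "finite I" "finite J" "\<And>i j. \<lbrakk>i \<in> I; j \<in> J\<rbrakk> \<Longrightarrow> f i j \<in> carrier A"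
  shows "(\<Oplus>i\<in>I. \<Oplus>j\<in>J. f i j) = (\<Oplus>j\<in>J. \<Oplus>i\<in>I. f i j)"
  using assms(1,3)
proof (induction I rule: finite_induct)
  case (insert i I)
  have "(\<Oplus>i\<in>insert i I. \<Oplus>j\<in>J. f i j) = (\<Oplus>j\<in>J. f i j) \<oplus> (\<Oplus>j\<in>J. \<Oplus>i\<in>I. f i j)"
    using insert by (simp add: Pi_def)
  also have "\<dots> = (\<Oplus>j\<in>J. f i j \<oplus> (\<Oplus>i\<in>I. f i j))"
    using insert by (intro finsum_addf[symmetric]) (auto simp: Pi_def)
  also have "\<dots> = (\<Oplus>j\<in>J. \<Oplus>i\<in>insert i I. f i j)"
    using insert by (intro finsum_cong') (auto simp: Pi_def)
  finally show ?case .
qed simp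

lemma finsum_delta:
  assumes "finite I" "j \<in> I" "\<And>i. i \<in> I \<Longrightarrow> f i \<in> carrier A" "\<And>i. \<lbrakk>i \<in> I; i \<noteq> j\<rbrakk> \<Longrightarrow> f i = \<zero>"
  shows "(\<Oplus>i\<in>I. f i) = f j"
proof -
  have "(\<Oplus>i\<in>I. f i) = (\<Oplus>i\<in>I. if j = i then f i else \<zero>)"
    using assms by (intro finsum_cong') auto
  also have "\<dots> = f j" using assms by (intro finsum_singleton) auto
  finally show ?thesis .
qed

lemma finsum_remove:
  assumes "finite I" "j \<in> I" "\<And>i. i \<in> I \<Longrightarrow> f i \<in> carrier A"
  shows "(\<Oplus>i\<in>I. f i) = f j \<oplus> (\<Oplus>i\<in>I - {j}. f i)"
  using finsum_insert[of "I - {j}" j f] assms by (simp add: insert_absorb Pi_def)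

section \<open>The \<open>A\<close>-valued inner product on columns\<close>

definition ip :: "nat \<Rightarrow> (nat \<Rightarrow> 'a) \<Rightarrow> (nat \<Rightarrow> 'a) \<Rightarrow> 'a" where
  "ip r x y = (\<Oplus>i\<in>{..<r}. star A (x i) \<otimes> y i)"

text \<open>Unlike \<open>col_space\<close>, this allows arbitrary values beyond the index range, so
  that columns given by lambda terms need no restriction.\<close>

abbreviation cols :: "nat \<Rightarrow> (nat \<Rightarrow> 'a) set" where "cols r \<equiv> {..<r} \<rightarrow> carrier A"

lemma ip_closed [simp, intro]: "\<lbrakk>x \<in> cols r; y \<in> cols r\<rbrakk> \<Longrightarrow> ip r x y \<in> carrier A"
  unfolding ip_def by (intro finsum_closed) (auto simp: Pi_def)

lemma ip_cong:
  assumes "x' \<in> cols r" "y' \<in> cols r" "\<And>i. i < r \<Longrightarrow> x i = x' i" "\<And>i. i < r \<Longrightarrow> y i = y' i"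
  shows "ip r x y = ip r x' y'"
  unfolding ip_def using assms by (intro finsum_cong') (auto simp: Pi_def)

lemma star_ip: "\<lbrakk>x \<in> cols r; y \<in> cols r\<rbrakk> \<Longrightarrow> star A (ip r x y) = ip r y x"
  unfolding ip_def by (subst star_finsum) (auto simp: Pi_def star_mult intro!: finsum_cong')

lemma ip_add_right:
  assumes "x \<in> cols r" "y \<in> cols r" "z \<in> cols r"
  shows "ip r x (\<lambda>i. y i \<oplus> z i) = ip r x y \<oplus> ip r x z"
proof -
  have "ip r x (\<lambda>i. y i \<oplus> z i) = (\<Oplus>i\<in>{..<r}. star A (x i) \<otimes> y i \<oplus> star A (x i) \<otimes> z i)"
    unfolding ip_def using assms by (intro finsum_cong') (auto simp: Pi_def r_distr)
  then show ?thesis unfolding ip_def using assms by (subst (asm) finsum_addf) (auto simp: Pi_def)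
qed

lemma ip_mult_right:
  assumes "x \<in> cols r" "y \<in> cols r" "a \<in> carrier A"
  shows "ip r x (\<lambda>i. y i \<otimes> a) = ip r x y \<otimes> a"
  unfolding ip_def using assms
  by (subst finsum_ldistr) (auto simp: Pi_def m_assoc intro!: finsum_cong')

lemma ip_smult_right:
  assumes "x \<in> cols r" "y \<in> cols r"
  shows "ip r x (\<lambda>i. c \<odot> y i) = c \<odot> ip r x y"
  unfolding ip_def using assms
  by (subst smult_finsum) (auto simp: Pi_def smult_mult_right intro!: finsum_cong')

lemma ip_minus_right:
  assumes "x \<in> cols r" "y \<in> cols r" "z \<in> cols r"
  shows "ip r x (\<lambda>i. y i \<ominus> z i) = ip r x y \<ominus> ip r x z"
proof -
  have "ip r x (\<lambda>i. y i \<ominus> z i) = ip r x (\<lambda>i. y i \<oplus> (-1) \<odot> z i)"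
    using assms by (intro ip_cong) (auto simp: Pi_def a_minus_def smult_minus_left)
  also have "\<dots> = ip r x y \<ominus> ip r x z"
    using assms by (subst ip_add_right) (auto simp: Pi_def ip_smult_right a_minus_def smult_minus_left)
  finally show ?thesis .
qed

lemma ip_minus_left:
  assumes "x \<in> cols r" "y \<in> cols r" "z \<in> cols r"
  shows "ip r (\<lambda>i. y i \<ominus> z i) x = ip r y x \<ominus> ip r z x"
proof -
  have "ip r (\<lambda>i. y i \<ominus> z i) x = star A (ip r x (\<lambda>i. y i \<ominus> z i))"
    using assms by (intro star_ip[symmetric]) (auto simp: Pi_def)
  then show ?thesis using assms by (simp add: ip_minus_right star_diff star_ip)
qed

lemma ip_add_left:
  assumes "x \<in> cols r" "y \<in> cols r" "z \<in> cols r"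
  shows "ip r (\<lambda>i. y i \<oplus> z i) x = ip r y x \<oplus> ip r z x"
proof -
  have "ip r (\<lambda>i. y i \<oplus> z i) x = star A (ip r x (\<lambda>i. y i \<oplus> z i))"
    using assms by (intro star_ip[symmetric]) (auto simp: Pi_def)
  then show ?thesis using assms by (simp add: ip_add_right star_add star_ip)
qed

lemma ip_mult_left:
  assumes "x \<in> cols r" "y \<in> cols r" "a \<in> carrier A"
  shows "ip r (\<lambda>i. y i \<otimes> a) x = star A a \<otimes> ip r y x"
proof -
  have "ip r (\<lambda>i. y i \<otimes> a) x = star A (ip r x (\<lambda>i. y i \<otimes> a))"
    using assms by (intro star_ip[symmetric]) (auto simp: Pi_def)
  then show ?thesis using assms by (simp add: ip_mult_right star_mult star_ip)
qed

lemma ip_smult_left: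
  assumes "x \<in> cols r" "y \<in> cols r"
  shows "ip r (\<lambda>i. c \<odot> y i) x = cnj c \<odot> ip r y x"
proof -
  have "ip r (\<lambda>i. c \<odot> y i) x = star A (ip r x (\<lambda>i. c \<odot> y i))"
    using assms by (intro star_ip[symmetric]) (auto simp: Pi_def)
  then show ?thesis using assms by (simp add: ip_smult_right star_smult star_ip)
qed

lemma pos_ip: "x \<in> cols r \<Longrightarrow> pos (ip r x x)"
  unfolding ip_def by (intro pos_finsum pos_star_mult) auto

text \<open>\<open>star (x j) \<otimes> x j\<close> is one of the positive summands of
  \<open>ip r x x\<close>, and the norm is monotone on positive elements.\<close>

lemma cnorm_entry_le:
  assumes x: "x \<in> cols r" and j: "j < r"
  shows "(\<parallel>x j\<parallel>)\<^sup>2 \<le> \<parallel>ip r x x\<parallel>"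
proof -
  have xj: "x j \<in> carrier A" using x j by auto
  define R where "R = (\<Oplus>i\<in>{..<r} - {j}. star A (x i) \<otimes> x i)"
  have R: "pos R" unfolding R_def using x by (intro pos_finsum pos_star_mult) auto
  have ip: "ip r x x = star A (x j) \<otimes> x j \<oplus> R"
    unfolding ip_def R_def using x j by (intro finsum_remove) auto
  have "ip r x x \<ominus> star A (x j) \<otimes> x j = R"
    unfolding ip using xj posD(1)[OF R] star_closed[OF xj] by algebra
  then have "\<parallel>star A (x j) \<otimes> x j\<parallel> \<le> \<parallel>ip r x x\<parallel>"
    using R x xj by (intro cnorm_mono pos_star_mult) (auto simp: star_ip)
  then show ?thesis using cstar_identity[OF xj] by simp
qed

text \<open>Expand \<open>\<langle>u, u\<rangle> \<ge> 0\<close> for \<open>u = t x - y p\<close>, where \<open>p = \<langle>y, x\<rangle>\<close> and \<open>t > \<parallel>\<langle>y, y\<rangle>\<parallel>\<close>.\<close>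

lemma cnorm_ip_le_aux:
  assumes x: "x \<in> cols r" and y: "y \<in> cols r" and t: "\<parallel>ip r y y\<parallel> < t"
  shows "(\<parallel>ip r x y\<parallel>)\<^sup>2 \<le> t * \<parallel>ip r x x\<parallel>"
proof -
  define p where "p = ip r y x"
  define XX where "XX = ip r x x"
  define YY where "YY = ip r y y"
  have t0: "0 < t" using t cnorm_nonneg[OF ip_closed[OF y y]] by linarith
  have c: "p \<in> carrier A" "XX \<in> carrier A" "YY \<in> carrier A" "star A p = ip r x y"
    "star A XX = XX" "star A YY = YY" "star A p \<in> carrier A"
    using x y by (auto simp: p_def XX_def YY_def star_ip)
  define T where "T = scalar t"
  have T: "T \<in> carrier A" "star A T = T" by (auto simp: T_def)
  have TR: "T \<otimes> q = q \<otimes> T" if "q \<in> carrier A" for q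
    using that by (simp add: T_def scalar_mult_left scalar_mult_right)
  define u where "u = (\<lambda>i. x i \<otimes> T \<ominus> y i \<otimes> p)"
  have xT: "(\<lambda>i. x i \<otimes> T) \<in> cols r" and yp: "(\<lambda>i. y i \<otimes> p) \<in> cols r" using x y c T by auto
  have u: "u \<in> cols r" using x y c T by (auto simp: u_def Pi_def)
  have "ip r u u = (T \<otimes> (XX \<otimes> T) \<ominus> star A p \<otimes> (p \<otimes> T)) \<ominus> (T \<otimes> (star A p \<otimes> p) \<ominus> star A p \<otimes> (YY \<otimes> p))"
    unfolding u_def ip_minus_right[OF u[unfolded u_def] xT yp] ip_minus_left[OF xT xT yp]
      ip_minus_left[OF yp xT yp]
    using x y xT yp c T by (simp add: ip_mult_right ip_mult_left p_def XX_def YY_def star_ip m_assoc)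
  moreover have "T \<otimes> (XX \<otimes> T) = T \<otimes> (T \<otimes> XX)" using c by (simp add: TR[of XX])
  moreover have "star A p \<otimes> (p \<otimes> T) = T \<otimes> (star A p \<otimes> p)"
    using c T TR[of "star A p \<otimes> p"] by (simp add: m_assoc)
  ultimately have uu: "ip r u u =
      (T \<otimes> (T \<otimes> XX) \<ominus> T \<otimes> (star A p \<otimes> p)) \<ominus> (T \<otimes> (star A p \<otimes> p) \<ominus> star A p \<otimes> (YY \<otimes> p))"
    by simp
  have "scalar (\<parallel>YY\<parallel>) \<oplus> scalar (t - \<parallel>YY\<parallel>) = T"
    unfolding scalar_add[symmetric] by (simp add: T_def)
  then have "(scalar (\<parallel>YY\<parallel>) \<ominus> YY) \<oplus> scalar (t - \<parallel>YY\<parallel>) = T \<ominus> YY"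
    using c(3) scalar_closed[of "\<parallel>YY\<parallel>"] scalar_closed[of "t - \<parallel>YY\<parallel>"] T
    by (simp add: a_minus_def a_ac)
  \<comment> \<open>\<open>T \<ominus> YY\<close> is positive with room to spare, hence a square.
    Adding the positive element \<open>star (k \<otimes> p) \<otimes> (k \<otimes> p)\<close>
    removes \<open>YY\<close> from the expansion and leaves
    \<open>t^2 XX - t (star p) p\<close>.\<close>
  then obtain k where k: "k \<in> Units A" "star A k = k" "k \<otimes> k = T \<ominus> YY"
    using pos_add_scalar_sqrt[OF pos_cnorm_minus[OF c(3,6)], of "t - \<parallel>YY\<parallel>"] t by (auto simp: YY_def)
  have kc: "k \<in> carrier A" using k by auto
  have "star A (k \<otimes> p) \<otimes> (k \<otimes> p) = star A p \<otimes> (k \<otimes> k) \<otimes> p"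
    using kc c(1,7) k(2) by (simp add: star_mult m_assoc)
  also have "\<dots> = (star A p \<otimes> T) \<otimes> p \<ominus> star A p \<otimes> (YY \<otimes> p)"
    unfolding k(3) using c(1-3,7) T(1) by algebra
  also have "star A p \<otimes> T = T \<otimes> star A p" using c by (simp add: TR)
  finally have kp: "star A (k \<otimes> p) \<otimes> (k \<otimes> p) = T \<otimes> (star A p \<otimes> p) \<ominus> star A p \<otimes> (YY \<otimes> p)"
    using c T by (simp add: m_assoc)
  have "pos (ip r u u \<oplus> star A (k \<otimes> p) \<otimes> (k \<otimes> p))"
    using u kc c by (intro pos_add pos_ip pos_star_mult) auto
  also have "ip r u u \<oplus> star A (k \<otimes> p) \<otimes> (k \<otimes> p) = T \<otimes> (T \<otimes> XX) \<ominus> T \<otimes> (star A p \<otimes> p)"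
    unfolding uu kp using c(1-3,7) T(1) by algebra
  finally have P: "pos (T \<otimes> (T \<otimes> XX) \<ominus> T \<otimes> (star A p \<otimes> p))" .
  define q where "q = complex_of_real (sqrt t) \<odot> p"
  have q: "q \<in> carrier A" using c by (simp add: q_def)
  have "star A q \<otimes> q = T \<otimes> (star A p \<otimes> p)"
    using c t0 by (simp add: q_def star_smult smult_mult_left smult_mult_right of_real_smult_smult
        T_def scalar_mult_left)
  then have "pos (T \<otimes> (star A p \<otimes> p))" using pos_star_mult[OF q] by simp
  then have "\<parallel>T \<otimes> (star A p \<otimes> p)\<parallel> \<le> \<parallel>T \<otimes> (T \<otimes> XX)\<parallel>"
    using P c T TR[of "T \<otimes> XX"] TR[of XX] by (intro cnorm_mono) (auto simp: star_mult m_assoc)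
  then have "t * (\<parallel>p\<parallel>)\<^sup>2 \<le> t * (t * \<parallel>XX\<parallel>)"
    using c(1,2,7) t0 by (simp add: T_def scalar_mult_left cnorm_smult cstar_identity)
  then have "(\<parallel>p\<parallel>)\<^sup>2 \<le> t * \<parallel>XX\<parallel>" using t0 by simp
  moreover have "\<parallel>ip r x y\<parallel> = \<parallel>p\<parallel>" using c cnorm_star[of p] by simp
  ultimately show ?thesis by (simp add: XX_def)
qed

lemma cnorm_ip_le:
  assumes x: "x \<in> cols r" and y: "y \<in> cols r"
  shows "\<parallel>ip r x y\<parallel> \<le> sqrt (\<parallel>ip r x x\<parallel>) * sqrt (\<parallel>ip r y y\<parallel>)"
proof -
  have n: "0 \<le> \<parallel>ip r x x\<parallel>" using x by simp
  have "(\<parallel>ip r x y\<parallel>)\<^sup>2 \<le> \<parallel>ip r y y\<parallel> * \<parallel>ip r x x\<parallel> + e" if "0 < e" for e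
  proof -
    \<comment> \<open>Adding 1 avoids division by zero and still gives
      \<open>d * \<parallel>ip r x x\<parallel> \<le> e\<close>.\<close>
    define d where "d = e / (\<parallel>ip r x x\<parallel> + 1)"
    have d: "0 < d" using that n by (simp add: d_def)
    have "(\<parallel>ip r x y\<parallel>)\<^sup>2 \<le> (\<parallel>ip r y y\<parallel> + d) * \<parallel>ip r x x\<parallel>"
      using d by (intro cnorm_ip_le_aux x y) simp
    also have "\<dots> = \<parallel>ip r y y\<parallel> * \<parallel>ip r x x\<parallel> + d * \<parallel>ip r x x\<parallel>"
      by (simp add: distrib_right)
    also have "d * \<parallel>ip r x x\<parallel> \<le> e"
      using n that by (simp add: d_def field_simps)
    finally show ?thesis by simp
  qed
  then have "(\<parallel>ip r x y\<parallel>)\<^sup>2 \<le> \<parallel>ip r y y\<parallel> * \<parallel>ip r x x\<parallel>" by (rule field_le_epsilon)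
  then have "\<parallel>ip r x y\<parallel> \<le> sqrt (\<parallel>ip r y y\<parallel> * \<parallel>ip r x x\<parallel>)"
    by (rule real_le_rsqrt)
  then show ?thesis by (simp add: real_sqrt_mult mult.commute)
qed

lemma col_norm_eq: "col_norm r A x = sqrt (\<parallel>ip r x x\<parallel>)"
  by (simp add: col_norm_def ip_def)

lemma col_norm_nonneg [simp]: "x \<in> cols r \<Longrightarrow> 0 \<le> col_norm r A x"
  by (simp add: col_norm_eq)

lemma col_norm_power2: "x \<in> cols r \<Longrightarrow> (col_norm r A x)\<^sup>2 = \<parallel>ip r x x\<parallel>"
  by (simp add: col_norm_eq)

lemma cnorm_ip_le_col_norm:
  "\<lbrakk>x \<in> cols r; y \<in> cols r\<rbrakk> \<Longrightarrow> \<parallel>ip r x y\<parallel> \<le> col_norm r A x * col_norm r A y"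
  unfolding col_norm_eq by (rule cnorm_ip_le)

lemma col_norm_cong:
  assumes "x' \<in> cols r" "\<And>i. i < r \<Longrightarrow> x i = x' i"
  shows "col_norm r A x = col_norm r A x'"
  unfolding col_norm_eq using ip_cong[OF assms(1,1)] assms(2) by metis

lemma cnorm_entry_le_col_norm: "\<lbrakk>x \<in> cols r; j < r\<rbrakk> \<Longrightarrow> \<parallel>x j\<parallel> \<le> col_norm r A x"
  unfolding col_norm_eq by (rule real_le_rsqrt) (rule cnorm_entry_le)

lemma col_norm_smult:
  assumes "x \<in> cols r"
  shows "col_norm r A (\<lambda>i. c \<odot> x i) = cmod c * col_norm r A x"
proof -
  have "(\<lambda>i. c \<odot> x i) \<in> cols r" using assms by auto
  then have "ip r (\<lambda>i. c \<odot> x i) (\<lambda>i. c \<odot> x i) = c \<odot> (cnj c \<odot> ip r x x)"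
    using assms by (simp add: ip_smult_right ip_smult_left)
  then have "\<parallel>ip r (\<lambda>i. c \<odot> x i) (\<lambda>i. c \<odot> x i)\<parallel> = (cmod c)\<^sup>2 * \<parallel>ip r x x\<parallel>"
    using assms by (simp add: cnorm_smult power2_eq_square)
  then show ?thesis by (simp add: col_norm_eq real_sqrt_mult)
qed

lemma col_norm_triangle:
  assumes x: "x \<in> cols r" and y: "y \<in> cols r"
  shows "col_norm r A (\<lambda>i. x i \<oplus> y i) \<le> col_norm r A x + col_norm r A y"
proof (rule power2_le_imp_le)
  have xy: "(\<lambda>i. x i \<oplus> y i) \<in> cols r" using x y by (auto simp: Pi_def)
  have "(col_norm r A (\<lambda>i. x i \<oplus> y i))\<^sup>2 = \<parallel>(ip r x x \<oplus> ip r y x) \<oplus> (ip r x y \<oplus> ip r y y)\<parallel>"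
    unfolding col_norm_power2[OF xy] using x y xy by (simp add: ip_add_right ip_add_left)
  also have "\<dots> \<le> (\<parallel>ip r x x\<parallel> + \<parallel>ip r y x\<parallel>) + (\<parallel>ip r x y\<parallel> + \<parallel>ip r y y\<parallel>)"
    using x y by (intro order_trans[OF cnorm_triangle] add_mono cnorm_triangle) auto
  also have "\<dots> \<le> (col_norm r A x + col_norm r A y)\<^sup>2"
    using cnorm_ip_le_col_norm[OF x y] cnorm_ip_le_col_norm[OF y x]
    unfolding col_norm_power2[OF x, symmetric] col_norm_power2[OF y, symmetric] power2_sum
      mult.commute[of "col_norm r A y" "col_norm r A x"] by linarith
  finally show "(col_norm r A (\<lambda>i. x i \<oplus> y i))\<^sup>2 \<le> (col_norm r A x + col_norm r A y)\<^sup>2" .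
qed (use x y in simp)

text \<open>The Euclidean norm of the entry norms lies in between; the crude bound suffices for
  boundedness of matrices and for completeness.\<close>

lemma col_norm_le_sum:
  assumes x: "x \<in> cols r"
  shows "col_norm r A x \<le> (\<Sum>i<r. \<parallel>x i\<parallel>)"
proof -
  have "\<parallel>ip r x x\<parallel> \<le> (\<Sum>i<r. \<parallel>star A (x i) \<otimes> x i\<parallel>)"
    unfolding ip_def using x by (intro cnorm_finsum_le) auto
  also have "\<dots> = (\<Sum>i<r. (\<parallel>x i\<parallel>)\<^sup>2)"
    using x by (intro sum.cong) (auto simp: Pi_def cstar_identity)
  finally have "col_norm r A x \<le> L2_set (\<lambda>i. \<parallel>x i\<parallel>) {..<r}"
    by (simp add: col_norm_eq L2_set_def)
  also have "\<dots> \<le> (\<Sum>i<r. \<parallel>x i\<parallel>)"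
    using x by (intro L2_set_le_sum) (auto simp: Pi_def)
  finally show ?thesis .
qed

section \<open>The *-algebra of matrices\<close>

abbreviation Mat :: "nat \<Rightarrow> (nat \<times> nat \<Rightarrow> 'a) cstar" where "Mat r \<equiv> mat_algebra r A"

lemma carrier_mat: "carrier (Mat r) = {..<r} \<times> {..<r} \<rightarrow>\<^sub>E carrier A"
  by (simp add: mat_algebra_def)

lemma mat_entry [simp, intro]: "\<lbrakk>T \<in> carrier (Mat r); i < r; j < r\<rbrakk> \<Longrightarrow> T (i, j) \<in> carrier A"
  by (auto simp: carrier_mat)

lemma mat_eqI:
  assumes "S \<in> carrier (Mat r)" "T \<in> carrier (Mat r)"
    "\<And>i j. \<lbrakk>i < r; j < r\<rbrakk> \<Longrightarrow> S (i, j) = T (i, j)"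
  shows "S = T"
  by (rule PiE_ext[of _ "{..<r} \<times> {..<r}" "\<lambda>_. carrier A"]) (use assms in \<open>auto simp: carrier_mat\<close>)

lemma
  shows mat_mult_entry: "\<lbrakk>i < r; j < r\<rbrakk> \<Longrightarrow>
      (S \<otimes>\<^bsub>Mat r\<^esub> T) (i, j) = (\<Oplus>h\<in>{..<r}. S (i, h) \<otimes> T (h, j))"
    and mat_one_entry: "\<lbrakk>i < r; j < r\<rbrakk> \<Longrightarrow> \<one>\<^bsub>Mat r\<^esub> (i, j) = (if i = j then \<one> else \<zero>)"
    and mat_zero_entry: "\<lbrakk>i < r; j < r\<rbrakk> \<Longrightarrow> \<zero>\<^bsub>Mat r\<^esub> (i, j) = \<zero>"
    and mat_add_entry: "\<lbrakk>i < r; j < r\<rbrakk> \<Longrightarrow> (S \<oplus>\<^bsub>Mat r\<^esub> T) (i, j) = S (i, j) \<oplus> T (i, j)"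
    and mat_smult_entry: "\<lbrakk>i < r; j < r\<rbrakk> \<Longrightarrow> (c \<odot>\<^bsub>Mat r\<^esub> T) (i, j) = c \<odot> T (i, j)"
    and mat_star_entry: "\<lbrakk>i < r; j < r\<rbrakk> \<Longrightarrow> star (Mat r) T (i, j) = star A (T (j, i))"
    and cnorm_mat: "cnorm (Mat r) = mat_norm r A"
  by (simp_all add: mat_algebra_def)

lemmas mat_entries = mat_mult_entry mat_one_entry mat_zero_entry mat_add_entry mat_smult_entry
  mat_star_entry

lemma mat_mult_closed [simp, intro]:
  "\<lbrakk>S \<in> carrier (Mat r); T \<in> carrier (Mat r)\<rbrakk> \<Longrightarrow> S \<otimes>\<^bsub>Mat r\<^esub> T \<in> carrier (Mat r)"
  unfolding mat_algebra_def by (auto simp: PiE_iff Pi_def intro!: finsum_closed)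

lemma
  shows mat_one_closed [simp, intro]: "\<one>\<^bsub>Mat r\<^esub> \<in> carrier (Mat r)"
    and mat_zero_closed [simp, intro]: "\<zero>\<^bsub>Mat r\<^esub> \<in> carrier (Mat r)"
    and mat_add_closed [simp, intro]: "\<lbrakk>S \<in> carrier (Mat r); T \<in> carrier (Mat r)\<rbrakk> \<Longrightarrow>
      S \<oplus>\<^bsub>Mat r\<^esub> T \<in> carrier (Mat r)"
    and mat_smult_closed [simp, intro]: "T \<in> carrier (Mat r) \<Longrightarrow> c \<odot>\<^bsub>Mat r\<^esub> T \<in> carrier (Mat r)"
    and mat_star_closed [simp, intro]: "T \<in> carrier (Mat r) \<Longrightarrow> star (Mat r) T \<in> carrier (Mat r)"
  unfolding mat_algebra_def by (auto simp: PiE_iff)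

lemma mat_mult_assoc:
  assumes R: "R \<in> carrier (Mat r)" and S: "S \<in> carrier (Mat r)" and T: "T \<in> carrier (Mat r)"
  shows "R \<otimes>\<^bsub>Mat r\<^esub> S \<otimes>\<^bsub>Mat r\<^esub> T = R \<otimes>\<^bsub>Mat r\<^esub> (S \<otimes>\<^bsub>Mat r\<^esub> T)"
proof (rule mat_eqI)
  fix i j assume ij: "i < r" "j < r"
  have "(R \<otimes>\<^bsub>Mat r\<^esub> S \<otimes>\<^bsub>Mat r\<^esub> T) (i, j) =
      (\<Oplus>h\<in>{..<r}. \<Oplus>g\<in>{..<r}. R (i, g) \<otimes> (S (g, h) \<otimes> T (h, j)))"
    using ij R S T
    by (auto simp: mat_mult_entry finsum_ldistr Pi_def m_assoc intro!: finsum_cong')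
  also have "\<dots> = (\<Oplus>g\<in>{..<r}. \<Oplus>h\<in>{..<r}. R (i, g) \<otimes> (S (g, h) \<otimes> T (h, j)))"
    using ij R S T by (intro finsum_swap) auto
  also have "\<dots> = (R \<otimes>\<^bsub>Mat r\<^esub> (S \<otimes>\<^bsub>Mat r\<^esub> T)) (i, j)"
    using ij R S T
    by (auto simp: mat_mult_entry finsum_rdistr Pi_def intro!: finsum_cong')
  finally show "(R \<otimes>\<^bsub>Mat r\<^esub> S \<otimes>\<^bsub>Mat r\<^esub> T) (i, j) = (R \<otimes>\<^bsub>Mat r\<^esub> (S \<otimes>\<^bsub>Mat r\<^esub> T)) (i, j)" .
qed (use assms in auto)

lemma finsum_add_cong:
  assumes "finite I" "f \<in> I \<rightarrow> carrier A" "g \<in> I \<rightarrow> carrier A" "\<And>i. i \<in> I \<Longrightarrow> h i = f i \<oplus> g i"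
  shows "(\<Oplus>i\<in>I. h i) = (\<Oplus>i\<in>I. f i) \<oplus> (\<Oplus>i\<in>I. g i)"
proof -
  have "(\<Oplus>i\<in>I. h i) = (\<Oplus>i\<in>I. f i \<oplus> g i)" using assms by (intro finsum_cong') (auto simp: Pi_def)
  then show ?thesis using assms by (simp add: finsum_addf)
qed

lemma ring_mat: "ring (Mat r)"
proof (rule ringI)
  show "abelian_group (Mat r)"
  proof (rule abelian_groupI)
    fix S assume S: "S \<in> carrier (Mat r)"
    show "\<exists>T\<in>carrier (Mat r). T \<oplus>\<^bsub>Mat r\<^esub> S = \<zero>\<^bsub>Mat r\<^esub>"
    proof (rule bexI[of _ "(-1) \<odot>\<^bsub>Mat r\<^esub> S"])
      show "(-1) \<odot>\<^bsub>Mat r\<^esub> S \<oplus>\<^bsub>Mat r\<^esub> S = \<zero>\<^bsub>Mat r\<^esub>"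
        by (rule mat_eqI) (use S in \<open>auto simp: mat_entries smult_minus_left l_neg\<close>)
    qed (use S in auto)
  qed (auto intro!: mat_eqI simp: mat_entries a_ac)
  show "monoid (Mat r)"
  proof (rule monoidI)
    fix T assume T: "T \<in> carrier (Mat r)"
    show "\<one>\<^bsub>Mat r\<^esub> \<otimes>\<^bsub>Mat r\<^esub> T = T"
    proof (rule mat_eqI)
      fix i j assume ij: "i < r" "j < r"
      have "(\<Oplus>h\<in>{..<r}. (if i = h then \<one> else \<zero>) \<otimes> T (h, j)) =
          (if i = i then \<one> else \<zero>) \<otimes> T (i, j)"
        using ij T by (intro finsum_delta) auto
      then show "(\<one>\<^bsub>Mat r\<^esub> \<otimes>\<^bsub>Mat r\<^esub> T) (i, j) = T (i, j)"
        using ij T by (auto simp: mat_entries cong: finsum_cong)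
    qed (use T in auto)
    show "T \<otimes>\<^bsub>Mat r\<^esub> \<one>\<^bsub>Mat r\<^esub> = T"
    proof (rule mat_eqI)
      fix i j assume ij: "i < r" "j < r"
      have "(\<Oplus>h\<in>{..<r}. T (i, h) \<otimes> (if h = j then \<one> else \<zero>)) =
          T (i, j) \<otimes> (if j = j then \<one> else \<zero>)"
        using ij T by (intro finsum_delta) auto
      then show "(T \<otimes>\<^bsub>Mat r\<^esub> \<one>\<^bsub>Mat r\<^esub>) (i, j) = T (i, j)"
        using ij T by (auto simp: mat_entries cong: finsum_cong)
    qed (use T in auto)
  qed (auto simp: mat_mult_assoc)
  fix R S T assume c: "R \<in> carrier (Mat r)" "S \<in> carrier (Mat r)" "T \<in> carrier (Mat r)"
  show "(R \<oplus>\<^bsub>Mat r\<^esub> S) \<otimes>\<^bsub>Mat r\<^esub> T = R \<otimes>\<^bsub>Mat r\<^esub> T \<oplus>\<^bsub>Mat r\<^esub> S \<otimes>\<^bsub>Mat r\<^esub> T"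
  proof (rule mat_eqI)
    fix i j assume ij: "i < r" "j < r"
    show "((R \<oplus>\<^bsub>Mat r\<^esub> S) \<otimes>\<^bsub>Mat r\<^esub> T) (i, j) = (R \<otimes>\<^bsub>Mat r\<^esub> T \<oplus>\<^bsub>Mat r\<^esub> S \<otimes>\<^bsub>Mat r\<^esub> T) (i, j)"
      using ij c unfolding mat_add_entry[OF ij] mat_mult_entry[OF ij]
      by (intro finsum_add_cong) (auto simp: Pi_def mat_add_entry l_distr)
  qed (use c in auto)
  show "T \<otimes>\<^bsub>Mat r\<^esub> (R \<oplus>\<^bsub>Mat r\<^esub> S) = T \<otimes>\<^bsub>Mat r\<^esub> R \<oplus>\<^bsub>Mat r\<^esub> T \<otimes>\<^bsub>Mat r\<^esub> S"
  proof (rule mat_eqI)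
    fix i j assume ij: "i < r" "j < r"
    show "(T \<otimes>\<^bsub>Mat r\<^esub> (R \<oplus>\<^bsub>Mat r\<^esub> S)) (i, j) = (T \<otimes>\<^bsub>Mat r\<^esub> R \<oplus>\<^bsub>Mat r\<^esub> T \<otimes>\<^bsub>Mat r\<^esub> S) (i, j)"
      using ij c unfolding mat_add_entry[OF ij] mat_mult_entry[OF ij]
      by (intro finsum_add_cong) (auto simp: Pi_def mat_add_entry r_distr)
  qed (use c in auto)
qed

lemma module_mat: "module (ring_of_type_algebra :: complex ring) (Mat r)"
proof (rule moduleI)
  show "cring (ring_of_type_algebra :: complex ring)" by (rule cring_from_type_algebra)
  show "abelian_group (Mat r)" by (rule ring.is_abelian_group[OF ring_mat])
qed (auto simp: ring_of_type_algebra_def mat_entries smult_l_distr smult_r_distr smult_smult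
      intro!: mat_eqI)

section \<open>Action on columns and the operator norm\<close>

lemma mat_col_entry: "i < r \<Longrightarrow> mat_col r A T x i = (\<Oplus>j\<in>{..<r}. T (i, j) \<otimes> x j)"
  by (simp add: mat_col_def)

lemma mat_col_closed [simp, intro]:
  "\<lbrakk>T \<in> carrier (Mat r); x \<in> cols r\<rbrakk> \<Longrightarrow> mat_col r A T x \<in> cols r"
  by (auto simp: mat_col_entry Pi_def intro!: finsum_closed)

lemma mat_col_cong: "\<lbrakk>T \<in> carrier (Mat r); x \<in> cols r; \<And>i. i < r \<Longrightarrow> y i = x i\<rbrakk> \<Longrightarrow>
    mat_col r A T y = mat_col r A T x"
  by (auto simp: mat_col_def fun_eq_iff Pi_def intro!: finsum_cong')

text \<open>The star of a matrix is its adjoint for \<open>ip\<close>; the C*-identity of the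
  operator norm rests on this.\<close>

lemma ip_mat_col:
  assumes T: "T \<in> carrier (Mat r)" and x: "x \<in> cols r" and y: "y \<in> cols r"
  shows "ip r x (mat_col r A T y) = ip r (mat_col r A (star (Mat r) T) x) y"
proof -
  have "ip r x (mat_col r A T y) = (\<Oplus>i\<in>{..<r}. \<Oplus>j\<in>{..<r}. star A (x i) \<otimes> (T (i, j) \<otimes> y j))"
    unfolding ip_def using T x y
    by (auto simp: mat_col_entry finsum_rdistr Pi_def intro!: finsum_cong')
  also have "\<dots> = (\<Oplus>j\<in>{..<r}. \<Oplus>i\<in>{..<r}. star A (x i) \<otimes> (T (i, j) \<otimes> y j))"
    using T x y by (intro finsum_swap) (auto simp: Pi_def)
  also have "\<dots> = ip r (mat_col r A (star (Mat r) T) x) y"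
    unfolding ip_def using T x y
    by (auto simp: mat_col_entry star_finsum finsum_ldistr mat_star_entry star_mult m_assoc Pi_def
        intro!: finsum_cong')
  finally show ?thesis .
qed

lemma mat_col_mult:
  assumes S: "S \<in> carrier (Mat r)" and T: "T \<in> carrier (Mat r)" and x: "x \<in> cols r" and i: "i < r"
  shows "mat_col r A (S \<otimes>\<^bsub>Mat r\<^esub> T) x i = mat_col r A S (mat_col r A T x) i"
proof -
  have "mat_col r A (S \<otimes>\<^bsub>Mat r\<^esub> T) x i =
      (\<Oplus>h\<in>{..<r}. \<Oplus>g\<in>{..<r}. S (i, g) \<otimes> (T (g, h) \<otimes> x h))"
    using i S T x
    by (auto simp: mat_col_entry mat_mult_entry finsum_ldistr Pi_def m_assoc intro!: finsum_cong')
  also have "\<dots> = (\<Oplus>g\<in>{..<r}. \<Oplus>h\<in>{..<r}. S (i, g) \<otimes> (T (g, h) \<otimes> x h))"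
    using i S T x by (intro finsum_swap) (auto simp: Pi_def)
  also have "\<dots> = mat_col r A S (mat_col r A T x) i"
    using i S T x by (auto simp: mat_col_entry finsum_rdistr Pi_def intro!: finsum_cong')
  finally show ?thesis .
qed

text \<open>It shows that the supremum defining \<open>mat_norm\<close> is taken over a bounded set,
  and it bounds that norm by the entries.\<close>

lemma col_norm_mat_col_le_sum:
  assumes T: "T \<in> carrier (Mat r)" and x: "x \<in> cols r"
  shows "col_norm r A (mat_col r A T x) \<le> (\<Sum>i<r. \<Sum>j<r. \<parallel>T (i, j)\<parallel>) * col_norm r A x"
proof -
  have "\<parallel>mat_col r A T x i\<parallel> \<le> (\<Sum>j<r. \<parallel>T (i, j)\<parallel> * col_norm r A x)" if i: "i < r" for i
  proof -
    have "\<parallel>mat_col r A T x i\<parallel> \<le> (\<Sum>j<r. \<parallel>T (i, j) \<otimes> x j\<parallel>)"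
      unfolding mat_col_entry[OF i] using i T x by (intro cnorm_finsum_le) (auto simp: Pi_def)
    also have "\<dots> \<le> (\<Sum>j<r. \<parallel>T (i, j)\<parallel> * col_norm r A x)"
    proof (rule sum_mono)
      fix j assume "j \<in> {..<r}"
      then have j: "j < r" "x j \<in> carrier A" "T (i, j) \<in> carrier A" using x T i by auto
      then show "\<parallel>T (i, j) \<otimes> x j\<parallel> \<le> \<parallel>T (i, j)\<parallel> * col_norm r A x"
        using cnorm_mult[OF j(3,2)] mult_left_mono[OF cnorm_entry_le_col_norm[OF x j(1)] cnorm_nonneg[OF j(3)]]
        by linarith
    qed
    finally show ?thesis .
  qed
  then have "(\<Sum>i<r. \<parallel>mat_col r A T x i\<parallel>) \<le> (\<Sum>i<r. \<Sum>j<r. \<parallel>T (i, j)\<parallel> * col_norm r A x)"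
    by (intro sum_mono) auto
  then show ?thesis
    using col_norm_le_sum[OF mat_col_closed[OF T x]] by (simp add: sum_distrib_right)
qed

lemma col_norm_zero: "col_norm r A (\<lambda>_\<in>{..<r}. \<zero>) = 0"
proof -
  have "ip r (\<lambda>_\<in>{..<r}. \<zero>) (\<lambda>_\<in>{..<r}. \<zero>) = (\<Oplus>i\<in>{..<r}. \<zero>)"
    unfolding ip_def by (intro finsum_cong') auto
  then show ?thesis by (simp add: col_norm_eq)
qed

lemma col_space_cols: "x \<in> col_space r A \<Longrightarrow> x \<in> cols r"
  by (auto simp: col_space_def PiE_iff)

lemma mat_norm_bdd:
  assumes "T \<in> carrier (Mat r)"
  shows "bdd_above {col_norm r A (mat_col r A T x) |x. x \<in> col_space r A \<and> col_norm r A x \<le> 1}"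
proof (rule bdd_aboveI)
  fix t assume "t \<in> {col_norm r A (mat_col r A T x) |x. x \<in> col_space r A \<and> col_norm r A x \<le> 1}"
  then obtain x where x: "t = col_norm r A (mat_col r A T x)" "x \<in> cols r" "col_norm r A x \<le> 1"
    using col_space_cols by blast
  have "0 \<le> (\<Sum>i<r. \<Sum>j<r. \<parallel>T (i, j)\<parallel>)" using assms by (auto intro!: sum_nonneg)
  then have "(\<Sum>i<r. \<Sum>j<r. \<parallel>T (i, j)\<parallel>) * col_norm r A x \<le> (\<Sum>i<r. \<Sum>j<r. \<parallel>T (i, j)\<parallel>) * 1"
    using x(3) by (intro mult_left_mono)
  then show "t \<le> (\<Sum>i<r. \<Sum>j<r. \<parallel>T (i, j)\<parallel>)"
    using col_norm_mat_col_le_sum[OF assms x(2)] x(1) by simp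
qed

lemma mat_norm_leI:
  assumes T: "T \<in> carrier (Mat r)"
    and le: "\<And>x. \<lbrakk>x \<in> cols r; col_norm r A x \<le> 1\<rbrakk> \<Longrightarrow> col_norm r A (mat_col r A T x) \<le> M"
  shows "mat_norm r A T \<le> M"
  unfolding mat_norm_def
proof (rule cSup_least)
  have "(\<lambda>_\<in>{..<r}. \<zero>) \<in> col_space r A" by (auto simp: col_space_def)
  then show "{col_norm r A (mat_col r A T x) |x. x \<in> col_space r A \<and> col_norm r A x \<le> 1} \<noteq> {}"
    using col_norm_zero[of r] by fastforce
qed (use le col_space_cols in blast)

lemma col_norm_mat_col_le_unit:
  assumes T: "T \<in> carrier (Mat r)" and x: "x \<in> cols r" "col_norm r A x \<le> 1"
  shows "col_norm r A (mat_col r A T x) \<le> mat_norm r A T"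
proof -
  \<comment> \<open>\<open>mat_norm\<close> ranges over extensional columns; restricting
    \<open>x\<close> changes neither its norm nor its image.\<close>
  define x' where "x' = restrict x {..<r}"
  have x': "x' \<in> col_space r A" using x by (auto simp: x'_def col_space_def)
  have "col_norm r A x' = col_norm r A x"
    using x by (intro col_norm_cong) (auto simp: x'_def)
  moreover have "mat_col r A T x' = mat_col r A T x"
    using T x by (intro mat_col_cong) (auto simp: x'_def)
  ultimately show ?thesis
    unfolding mat_norm_def using x' x
    by (intro cSup_upper mat_norm_bdd[OF T]) (auto intro!: exI[of _ x'])
qed

lemma mat_norm_nonneg:
  assumes T: "T \<in> carrier (Mat r)"
  shows "0 \<le> mat_norm r A T"
proof -
  have z: "(\<lambda>_\<in>{..<r}. \<zero>) \<in> cols r" by auto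
  then have "0 \<le> col_norm r A (mat_col r A T (\<lambda>_\<in>{..<r}. \<zero>))"
    by (intro col_norm_nonneg mat_col_closed T)
  also have "\<dots> \<le> mat_norm r A T"
    using col_norm_zero[of r] by (intro col_norm_mat_col_le_unit[OF T z]) simp
  finally show ?thesis .
qed

lemma mat_col_smult:
  assumes "T \<in> carrier (Mat r)" "x \<in> cols r" "i < r"
  shows "mat_col r A T (\<lambda>i. c \<odot> x i) i = c \<odot> mat_col r A T x i"
  using assms by (auto simp: mat_col_entry smult_finsum Pi_def smult_mult_right intro!: finsum_cong')

lemma col_norm_mat_col_le:
  assumes T: "T \<in> carrier (Mat r)" and x: "x \<in> cols r"
  shows "col_norm r A (mat_col r A T x) \<le> mat_norm r A T * col_norm r A x"
proof (cases "col_norm r A x = 0")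
  case True
  \<comment> \<open>A column of norm 0 cannot be normalised; the entrywise bound shows directly that
    its image has norm 0.\<close>
  then show ?thesis using col_norm_mat_col_le_sum[OF T x] by simp
next
  case False
  then have n: "0 < col_norm r A x" using col_norm_nonneg[OF x] by linarith
  define c where "c = complex_of_real (1 / col_norm r A x)"
  have cn: "cmod c = 1 / col_norm r A x" using n by (simp add: c_def norm_divide)
  have cx: "(\<lambda>i. c \<odot> x i) \<in> cols r" using x by auto
  have "col_norm r A (mat_col r A T (\<lambda>i. c \<odot> x i)) = col_norm r A (\<lambda>i. c \<odot> mat_col r A T x i)"
    using T x mat_col_closed[OF T x] by (intro col_norm_cong) (auto simp: mat_col_smult Pi_def)
  also have "\<dots> = col_norm r A (mat_col r A T x) / col_norm r A x"
    using T x by (simp add: col_norm_smult cn)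
  finally have "col_norm r A (mat_col r A T x) / col_norm r A x \<le> mat_norm r A T"
    using col_norm_mat_col_le_unit[OF T cx] n x by (simp add: col_norm_smult cn)
  then show ?thesis using n by (simp add: field_simps)
qed

lemma mat_norm_le_sum:
  assumes T: "T \<in> carrier (Mat r)"
  shows "mat_norm r A T \<le> (\<Sum>i<r. \<Sum>j<r. \<parallel>T (i, j)\<parallel>)"
proof (rule mat_norm_leI[OF T])
  fix x assume x: "x \<in> cols r" "col_norm r A x \<le> 1"
  have "0 \<le> (\<Sum>i<r. \<Sum>j<r. \<parallel>T (i, j)\<parallel>)" using T by (auto intro!: sum_nonneg)
  then have "(\<Sum>i<r. \<Sum>j<r. \<parallel>T (i, j)\<parallel>) * col_norm r A x \<le> (\<Sum>i<r. \<Sum>j<r. \<parallel>T (i, j)\<parallel>) * 1"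
    using x(2) by (intro mult_left_mono)
  then show "col_norm r A (mat_col r A T x) \<le> (\<Sum>i<r. \<Sum>j<r. \<parallel>T (i, j)\<parallel>)"
    using col_norm_mat_col_le_sum[OF T x(1)] by simp
qed

text \<open>Evaluate at the standard basis column with \<open>\<one>\<close> in position
  \<open>j\<close>, whose norm is at most 1.\<close>

lemma cnorm_entry_le_mat_norm:
  assumes T: "T \<in> carrier (Mat r)" and ij: "i < r" "j < r"
  shows "\<parallel>T (i, j)\<parallel> \<le> mat_norm r A T"
proof -
  define e where "e = (\<lambda>h. if h = j then \<one> else \<zero>)"
  have e: "e \<in> cols r" by (auto simp: e_def)
  have "ip r e e = star A (e j) \<otimes> e j"
    unfolding ip_def using ij by (intro finsum_delta) (auto simp: e_def)
  then have "col_norm r A e \<le> 1" using cnorm_one_le by (simp add: col_norm_eq e_def)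
  then have "col_norm r A (mat_col r A T e) \<le> mat_norm r A T"
    by (rule col_norm_mat_col_le_unit[OF T e])
  moreover have "mat_col r A T e i = T (i, j) \<otimes> e j"
    unfolding mat_col_entry[OF ij(1)] using ij T by (intro finsum_delta) (auto simp: e_def)
  then have "mat_col r A T e i = T (i, j)" using ij T by (simp add: e_def)
  ultimately show ?thesis
    using cnorm_entry_le_col_norm[OF mat_col_closed[OF T e] ij(1)] by simp
qed

lemma mat_norm_mult:
  assumes S: "S \<in> carrier (Mat r)" and T: "T \<in> carrier (Mat r)"
  shows "mat_norm r A (S \<otimes>\<^bsub>Mat r\<^esub> T) \<le> mat_norm r A S * mat_norm r A T"
proof (rule mat_norm_leI)
  fix x assume x: "x \<in> cols r" "col_norm r A x \<le> 1"
  have Tx: "mat_col r A T x \<in> cols r" using T x by auto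
  have "col_norm r A (mat_col r A (S \<otimes>\<^bsub>Mat r\<^esub> T) x) = col_norm r A (mat_col r A S (mat_col r A T x))"
    using S T x Tx by (intro col_norm_cong mat_col_mult) auto
  also have "\<dots> \<le> mat_norm r A S * col_norm r A (mat_col r A T x)"
    by (rule col_norm_mat_col_le[OF S Tx])
  also have "\<dots> \<le> mat_norm r A S * mat_norm r A T"
    using x T S by (intro mult_left_mono col_norm_mat_col_le_unit mat_norm_nonneg)
  finally show "col_norm r A (mat_col r A (S \<otimes>\<^bsub>Mat r\<^esub> T) x) \<le> mat_norm r A S * mat_norm r A T" .
qed (use assms in auto)

lemma mat_norm_triangle:
  assumes S: "S \<in> carrier (Mat r)" and T: "T \<in> carrier (Mat r)"
  shows "mat_norm r A (S \<oplus>\<^bsub>Mat r\<^esub> T) \<le> mat_norm r A S + mat_norm r A T"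
proof (rule mat_norm_leI)
  fix x assume x: "x \<in> cols r" "col_norm r A x \<le> 1"
  have c: "mat_col r A S x \<in> cols r" "mat_col r A T x \<in> cols r" using S T x by auto
  have "mat_col r A (S \<oplus>\<^bsub>Mat r\<^esub> T) x i = mat_col r A S x i \<oplus> mat_col r A T x i" if "i < r" for i
    unfolding mat_col_entry[OF that] using that S T x
    by (intro finsum_add_cong) (auto simp: Pi_def mat_add_entry l_distr)
  then have "col_norm r A (mat_col r A (S \<oplus>\<^bsub>Mat r\<^esub> T) x) =
      col_norm r A (\<lambda>i. mat_col r A S x i \<oplus> mat_col r A T x i)"
    using c by (intro col_norm_cong) (auto simp: Pi_def)
  also have "\<dots> \<le> col_norm r A (mat_col r A S x) + col_norm r A (mat_col r A T x)"
    by (rule col_norm_triangle[OF c])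
  also have "\<dots> \<le> mat_norm r A S + mat_norm r A T"
    by (intro add_mono col_norm_mat_col_le_unit S T x)
  finally show "col_norm r A (mat_col r A (S \<oplus>\<^bsub>Mat r\<^esub> T) x) \<le> mat_norm r A S + mat_norm r A T" .
qed (use assms in auto)

lemma mat_norm_smult_le:
  assumes T: "T \<in> carrier (Mat r)"
  shows "mat_norm r A (c \<odot>\<^bsub>Mat r\<^esub> T) \<le> cmod c * mat_norm r A T"
proof (rule mat_norm_leI)
  fix x assume x: "x \<in> cols r" "col_norm r A x \<le> 1"
  have c: "mat_col r A T x \<in> cols r" using T x by auto
  have "mat_col r A (c \<odot>\<^bsub>Mat r\<^esub> T) x i = c \<odot> mat_col r A T x i" if "i < r" for i
    using that T x
    by (auto simp: mat_col_entry smult_finsum mat_smult_entry Pi_def smult_mult_left intro!: finsum_cong')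
  then have "col_norm r A (mat_col r A (c \<odot>\<^bsub>Mat r\<^esub> T) x) = col_norm r A (\<lambda>i. c \<odot> mat_col r A T x i)"
    using c by (intro col_norm_cong) (auto simp: Pi_def)
  also have "\<dots> \<le> cmod c * mat_norm r A T"
    unfolding col_norm_smult[OF c] using x T by (intro mult_left_mono col_norm_mat_col_le_unit) auto
  finally show "col_norm r A (mat_col r A (c \<odot>\<^bsub>Mat r\<^esub> T) x) \<le> cmod c * mat_norm r A T" .
qed (use assms in auto)

lemma mat_star_star: "T \<in> carrier (Mat r) \<Longrightarrow> star (Mat r) (star (Mat r) T) = T"
  by (auto intro!: mat_eqI simp: mat_star_entry)

text \<open>Cauchy-Schwarz, applied to \<open>ip (T x) (T x) = ip ((star T) T x) x\<close> for
  columns of norm at most 1. This is the half of the C*-identity that submultiplicativity does not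
  give.\<close>

lemma mat_norm_power2_le:
  assumes T: "T \<in> carrier (Mat r)"
  shows "(mat_norm r A T)\<^sup>2 \<le> mat_norm r A (star (Mat r) T \<otimes>\<^bsub>Mat r\<^esub> T)"
proof -
  define S where "S = star (Mat r) T"
  define M where "M = mat_norm r A (S \<otimes>\<^bsub>Mat r\<^esub> T)"
  have S: "S \<in> carrier (Mat r)" using T by (simp add: S_def)
  have M: "0 \<le> M" unfolding M_def using S T by (intro mat_norm_nonneg) auto
  have "mat_norm r A T \<le> sqrt M"
  proof (rule mat_norm_leI[OF T])
    fix x assume x: "x \<in> cols r" "col_norm r A x \<le> 1"
    have Tx: "mat_col r A T x \<in> cols r" using T x by auto
    have STx: "mat_col r A (S \<otimes>\<^bsub>Mat r\<^esub> T) x \<in> cols r" using S T x by auto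
    have "ip r (mat_col r A T x) (mat_col r A T x) = ip r (mat_col r A S (mat_col r A T x)) x"
      unfolding S_def by (rule ip_mat_col[OF T Tx x(1)])
    also have "\<dots> = ip r (mat_col r A (S \<otimes>\<^bsub>Mat r\<^esub> T) x) x"
      using S T Tx x STx by (intro ip_cong) (auto simp: mat_col_mult)
    finally have "(col_norm r A (mat_col r A T x))\<^sup>2 \<le> col_norm r A (mat_col r A (S \<otimes>\<^bsub>Mat r\<^esub> T) x) * col_norm r A x"
      using cnorm_ip_le_col_norm[OF STx x(1)] by (simp add: col_norm_power2[OF Tx])
    also have "\<dots> \<le> M * 1"
      unfolding M_def using x S T STx mat_norm_nonneg[of "S \<otimes>\<^bsub>Mat r\<^esub> T" r]
      by (intro mult_mono col_norm_mat_col_le_unit) auto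
    finally show "col_norm r A (mat_col r A T x) \<le> sqrt M" by (simp add: real_le_rsqrt)
  qed
  then have "(mat_norm r A T)\<^sup>2 \<le> (sqrt M)\<^sup>2"
    using mat_norm_nonneg[OF T] by (intro power_mono)
  then show ?thesis using M by (simp add: M_def S_def)
qed

lemma mat_norm_star_le:
  assumes T: "T \<in> carrier (Mat r)"
  shows "mat_norm r A T \<le> mat_norm r A (star (Mat r) T)"
proof (cases "mat_norm r A T = 0")
  case False
  then have "0 < mat_norm r A T" using mat_norm_nonneg[OF T] by simp
  moreover have "mat_norm r A T * mat_norm r A T \<le> mat_norm r A (star (Mat r) T) * mat_norm r A T"
    using mat_norm_power2_le[OF T] mat_norm_mult[OF mat_star_closed[OF T] T]
    by (simp add: power2_eq_square)
  ultimately show ?thesis by simp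
qed (use T mat_norm_nonneg[of "star (Mat r) T" r] in simp)

lemma mat_cstar_identity:
  assumes T: "T \<in> carrier (Mat r)"
  shows "mat_norm r A (star (Mat r) T \<otimes>\<^bsub>Mat r\<^esub> T) = (mat_norm r A T)\<^sup>2"
proof -
  have "mat_norm r A (star (Mat r) T) = mat_norm r A T"
    using mat_norm_star_le[OF T] mat_norm_star_le[OF mat_star_closed[OF T]] mat_star_star[OF T] by simp
  then show ?thesis
    using mat_norm_power2_le[OF T] mat_norm_mult[OF mat_star_closed[OF T] T]
    by (simp add: power2_eq_square)
qed

lemma mat_norm_smult:
  assumes T: "T \<in> carrier (Mat r)"
  shows "mat_norm r A (c \<odot>\<^bsub>Mat r\<^esub> T) = cmod c * mat_norm r A T"
proof (cases "c = 0")
  case True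
  then show ?thesis
    using mat_norm_smult_le[OF T, of c] mat_norm_nonneg[OF mat_smult_closed[OF T, of c]] by simp
next
  case False
  \<comment> \<open>The reverse inequality is the proved one, applied to
    \<open>inverse c\<close>.\<close>
  have "inverse c \<odot>\<^bsub>Mat r\<^esub> (c \<odot>\<^bsub>Mat r\<^esub> T) = T"
    using T False by (auto intro!: mat_eqI simp: mat_smult_entry smult_smult)
  then have "mat_norm r A T \<le> cmod (inverse c) * mat_norm r A (c \<odot>\<^bsub>Mat r\<^esub> T)"
    using mat_norm_smult_le[OF mat_smult_closed[OF T], of "inverse c" c] by simp
  then have "cmod c * mat_norm r A T \<le> mat_norm r A (c \<odot>\<^bsub>Mat r\<^esub> T)"
    using False unfolding norm_inverse by (simp add: field_simps)
  then show ?thesis using mat_norm_smult_le[OF T, of c] by simp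
qed

lemma mat_norm_eq_0_iff:
  assumes T: "T \<in> carrier (Mat r)"
  shows "mat_norm r A T = 0 \<longleftrightarrow> T = \<zero>\<^bsub>Mat r\<^esub>"
proof
  assume 0: "mat_norm r A T = 0"
  show "T = \<zero>\<^bsub>Mat r\<^esub>"
  proof (rule mat_eqI[OF T])
    fix i j assume ij: "i < r" "j < r"
    then have "\<parallel>T (i, j)\<parallel> = 0"
      using cnorm_entry_le_mat_norm[OF T ij] 0 cnorm_nonneg[OF mat_entry[OF T ij]] by linarith
    then show "T (i, j) = \<zero>\<^bsub>Mat r\<^esub> (i, j)" using ij T by (simp add: cnorm_eq_0_iff mat_entries)
  qed auto
next
  assume "T = \<zero>\<^bsub>Mat r\<^esub>"
  then have "(\<Sum>i<r. \<Sum>j<r. \<parallel>T (i, j)\<parallel>) = 0" by (auto intro!: sum.neutral simp: mat_entries)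
  then show "mat_norm r A T = 0" using mat_norm_le_sum[OF T] mat_norm_nonneg[OF T] by simp
qed

lemma mat_uminus: "T \<in> carrier (Mat r) \<Longrightarrow> \<ominus>\<^bsub>Mat r\<^esub> T = (-1) \<odot>\<^bsub>Mat r\<^esub> T"
  by (rule abelian_group.minus_equality[OF ring.is_abelian_group[OF ring_mat]])
    (auto intro!: mat_eqI simp: mat_entries smult_minus_left l_neg)

lemma mat_minus_entry:
  "\<lbrakk>S \<in> carrier (Mat r); T \<in> carrier (Mat r); i < r; j < r\<rbrakk> \<Longrightarrow>
    (S \<ominus>\<^bsub>Mat r\<^esub> T) (i, j) = S (i, j) \<ominus> T (i, j)"
  by (simp add: a_minus_def mat_uminus mat_entries smult_minus_left)

lemma mat_minus_closed [simp, intro]: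
  "\<lbrakk>S \<in> carrier (Mat r); T \<in> carrier (Mat r)\<rbrakk> \<Longrightarrow> S \<ominus>\<^bsub>Mat r\<^esub> T \<in> carrier (Mat r)"
  by (simp add: a_minus_def mat_uminus)

text \<open>Proved on its own because completeness refers to this metric and has to be shown before
  \<open>Mat r\<close> is known to be a C*-algebra.\<close>

lemma Metric_space_mat: "Metric_space (carrier (Mat r)) (cdist (Mat r))"
proof
  show "0 \<le> cdist (Mat r) S T" for S T
    by (simp add: cdist_def cnorm_mat mat_norm_nonneg)
  show "cdist (Mat r) S T = cdist (Mat r) T S" for S T
  proof -
    have "mat_norm r A (S \<ominus>\<^bsub>Mat r\<^esub> T) = mat_norm r A (T \<ominus>\<^bsub>Mat r\<^esub> S)"
      if c: "S \<in> carrier (Mat r)" "T \<in> carrier (Mat r)"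
    proof -
      have "(-1) \<odot>\<^bsub>Mat r\<^esub> (S \<ominus>\<^bsub>Mat r\<^esub> T) = T \<ominus>\<^bsub>Mat r\<^esub> S"
        using c by (auto intro!: mat_eqI simp: mat_smult_entry mat_minus_entry smult_minus_left minus_swap)
      then show ?thesis using mat_norm_smult[OF mat_minus_closed[OF c], of "-1"] by simp
    qed
    then show ?thesis by (auto simp: cdist_def cnorm_mat)
  qed
  show "cdist (Mat r) S T = 0 \<longleftrightarrow> S = T" if c: "S \<in> carrier (Mat r)" "T \<in> carrier (Mat r)" for S T
  proof -
    interpret M: ring "Mat r" by (rule ring_mat)
    have "S \<ominus>\<^bsub>Mat r\<^esub> T = \<zero>\<^bsub>Mat r\<^esub> \<longleftrightarrow> S = T" using c by (simp add: M.r_right_minus_eq)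
    then show ?thesis using c by (simp add: cdist_def cnorm_mat mat_norm_eq_0_iff)
  qed
  show "cdist (Mat r) R T \<le> cdist (Mat r) R S + cdist (Mat r) S T"
    if c: "R \<in> carrier (Mat r)" "S \<in> carrier (Mat r)" "T \<in> carrier (Mat r)" for R S T
  proof -
    have "R \<ominus>\<^bsub>Mat r\<^esub> T = (R \<ominus>\<^bsub>Mat r\<^esub> S) \<oplus>\<^bsub>Mat r\<^esub> (S \<ominus>\<^bsub>Mat r\<^esub> T)"
      using c by (auto intro!: mat_eqI simp: mat_add_entry mat_minus_entry diff_add_diff)
    then show ?thesis using c by (simp add: cdist_def cnorm_mat mat_norm_triangle)
  qed
qed

text \<open>The operator norm dominates every entry and is dominated by the sum of the entry norms,
  so Cauchy sequences converge entrywise and entrywise limits are norm limits.\<close>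

lemma mcomplete_mat: "Metric_space.mcomplete (carrier (Mat r)) (cdist (Mat r))"
proof -
  interpret M: Metric_space "carrier (Mat r)" "cdist (Mat r)" by (rule Metric_space_mat)
  show ?thesis
    unfolding M.mcomplete_def
  proof (intro allI impI)
    fix s assume s: "M.MCauchy s"
    then have sc: "s n \<in> carrier (Mat r)" for n by (auto simp: M.MCauchy_def)
    have "\<exists>l. tends (\<lambda>n. s n (i, j)) l" if ij: "i < r" "j < r" for i j
    proof -
      have c: "s n (i, j) \<in> carrier A" for n using sc ij by auto
      have le: "cdist A (s n (i, j)) (s m (i, j)) \<le> cdist (Mat r) (s n) (s m)" for n m
        using cnorm_entry_le_mat_norm[of "s n \<ominus>\<^bsub>Mat r\<^esub> s m" r i j] sc ij c
        by (simp add: cdist_def cnorm_mat mat_minus_entry)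
      have "metric.MCauchy (\<lambda>n. s n (i, j))"
        using s c le unfolding M.MCauchy_def metric.MCauchy_def
        by (meson image_subsetI le_less_trans)
      then obtain l where "limitin metric.mtopology (\<lambda>n. s n (i, j)) l sequentially"
        using complete unfolding metric.mcomplete_def by blast
      then have "tends (\<lambda>n. s n (i, j)) l" by (subst tends_iff_limitin) (use c in auto)
      then show ?thesis ..
    qed
    then obtain L where L: "\<And>i j. \<lbrakk>i < r; j < r\<rbrakk> \<Longrightarrow> tends (\<lambda>n. s n (i, j)) (L i j)" by metis
    define l where "l = (\<lambda>(i, j)\<in>{..<r} \<times> {..<r}. L i j)"
    have l: "l \<in> carrier (Mat r)" using L by (auto simp: l_def carrier_mat tends_def)
    define f where "f n = (\<Sum>i<r. \<Sum>j<r. \<parallel>s n (i, j) \<ominus> L i j\<parallel>)" for n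
    have "f \<longlonglongrightarrow> (\<Sum>i<r. \<Sum>j<r. 0)"
      unfolding f_def using L by (intro tendsto_sum) (auto simp: tends_def)
    then have f0: "f \<longlonglongrightarrow> 0" by simp
    have le: "cdist (Mat r) (s n) l \<le> f n" for n
    proof -
      have "(\<Sum>i<r. \<Sum>j<r. \<parallel>(s n \<ominus>\<^bsub>Mat r\<^esub> l) (i, j)\<parallel>) = f n"
        using sc l by (auto simp: f_def mat_minus_entry l_def intro!: sum.cong)
      then show ?thesis
        using mat_norm_le_sum[of "s n \<ominus>\<^bsub>Mat r\<^esub> l" r] sc l by (simp add: cdist_def cnorm_mat)
    qed
    have "(\<lambda>n. cdist (Mat r) (s n) l) \<longlonglongrightarrow> 0"
      by (rule tendsto_sandwich[OF _ _ tendsto_const f0]) (use le in auto)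
    then show "\<exists>l. limitin M.mtopology s l sequentially"
      unfolding M.limit_metric_sequentially lim_sequentially dist_real_def
      using l sc by auto
  qed
qed

theorem unital_cstar_algebra_mat: "unital_cstar_algebra (Mat r)"
proof (intro unital_cstar_algebra.intro unital_cstar_algebra_axioms.intro)
  show "ring (Mat r)" by (rule ring_mat)
  show "module (ring_of_type_algebra :: complex ring) (Mat r)" by (rule module_mat)
  show "Metric_space.mcomplete (carrier (Mat r)) (cdist (Mat r))" by (rule mcomplete_mat)
next
  fix S T c assume c: "S \<in> carrier (Mat r)" "T \<in> carrier (Mat r)"
  show "c \<odot>\<^bsub>Mat r\<^esub> S \<otimes>\<^bsub>Mat r\<^esub> T = c \<odot>\<^bsub>Mat r\<^esub> (S \<otimes>\<^bsub>Mat r\<^esub> T)"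
    using c by (auto intro!: mat_eqI finsum_cong' simp: mat_mult_entry mat_smult_entry smult_finsum
        Pi_def smult_mult_left)
  show "S \<otimes>\<^bsub>Mat r\<^esub> (c \<odot>\<^bsub>Mat r\<^esub> T) = c \<odot>\<^bsub>Mat r\<^esub> (S \<otimes>\<^bsub>Mat r\<^esub> T)"
    using c by (auto intro!: mat_eqI finsum_cong' simp: mat_mult_entry mat_smult_entry smult_finsum
        Pi_def smult_mult_right)
  show "star (Mat r) (S \<oplus>\<^bsub>Mat r\<^esub> T) = star (Mat r) S \<oplus>\<^bsub>Mat r\<^esub> star (Mat r) T"
    using c by (auto intro!: mat_eqI simp: mat_entries star_add)
  show "star (Mat r) (S \<otimes>\<^bsub>Mat r\<^esub> T) = star (Mat r) T \<otimes>\<^bsub>Mat r\<^esub> star (Mat r) S"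
    using c by (auto intro!: mat_eqI finsum_cong' simp: mat_mult_entry mat_star_entry star_finsum
        Pi_def star_mult)
  show "cnorm (Mat r) (S \<oplus>\<^bsub>Mat r\<^esub> T) \<le> cnorm (Mat r) S + cnorm (Mat r) T"
    using c by (simp add: cnorm_mat mat_norm_triangle)
  show "cnorm (Mat r) (S \<otimes>\<^bsub>Mat r\<^esub> T) \<le> cnorm (Mat r) S * cnorm (Mat r) T"
    using c by (simp add: cnorm_mat mat_norm_mult)
qed (auto simp: cnorm_mat mat_norm_nonneg mat_norm_eq_0_iff mat_norm_smult mat_cstar_identity
      mat_star_star mat_entries star_smult intro!: mat_eqI)

section \<open>Perturbed projections\<close>

lemma cstar_projectionD:
  assumes "cstar_projection A p"
  shows "p \<in> carrier A" "star A p = p" "p \<otimes> p = p"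
  using assms by (auto simp: cstar_projection_def self_adjoint_def)

lemma cnorm_projection_le:
  assumes "cstar_projection A p"
  shows "\<parallel>p\<parallel> \<le> 1"
proof -
  note p = cstar_projectionD[OF assms]
  have "\<parallel>p\<parallel> = (\<parallel>p\<parallel>)\<^sup>2" using cnorm_square[OF p(1,2)] p(3) by simp
  then have "\<parallel>p\<parallel> = 0 \<or> \<parallel>p\<parallel> = 1" by (auto simp: power2_eq_square)
  then show ?thesis by auto
qed

lemma unitarily_equivalent_sym:
  assumes "unitarily_equivalent A p q" "p \<in> carrier A"
  shows "unitarily_equivalent A q p"
proof -
  obtain u where u: "u \<in> carrier A" "star A u \<otimes> u = \<one>" "u \<otimes> star A u = \<one>" "q = u \<otimes> p \<otimes> star A u"
    using assms by (auto simp: unitarily_equivalent_def cstar_unitary_def)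
  have "star A u \<otimes> q \<otimes> u = (star A u \<otimes> u) \<otimes> p \<otimes> (star A u \<otimes> u)"
    unfolding u(4) using u(1) assms(2) star_closed[OF u(1)] by algebra
  then have "p = star A u \<otimes> q \<otimes> star A (star A u)" using u assms by simp
  then show ?thesis
    using u unfolding unitarily_equivalent_def cstar_unitary_def by (metis star_star star_closed)
qed

lemma unitarily_equivalent_trans:
  assumes "unitarily_equivalent A p q" "unitarily_equivalent A q r" "p \<in> carrier A"
  shows "unitarily_equivalent A p r"
proof -
  obtain u where u: "u \<in> carrier A" "star A u \<otimes> u = \<one>" "u \<otimes> star A u = \<one>" "q = u \<otimes> p \<otimes> star A u"
    using assms by (auto simp: unitarily_equivalent_def cstar_unitary_def)
  obtain v where v: "v \<in> carrier A" "star A v \<otimes> v = \<one>" "v \<otimes> star A v = \<one>" "r = v \<otimes> q \<otimes> star A v"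
    using assms by (auto simp: unitarily_equivalent_def cstar_unitary_def)
  note c = u(1) v(1) star_closed[OF u(1)] star_closed[OF v(1)]
  have "star A (v \<otimes> u) \<otimes> (v \<otimes> u) = star A u \<otimes> (star A v \<otimes> v) \<otimes> u"
    unfolding star_mult[OF v(1) u(1)] using c by algebra
  moreover have "(v \<otimes> u) \<otimes> star A (v \<otimes> u) = v \<otimes> (u \<otimes> star A u) \<otimes> star A v"
    unfolding star_mult[OF v(1) u(1)] using c by algebra
  moreover have "r = (v \<otimes> u) \<otimes> p \<otimes> star A (v \<otimes> u)"
    unfolding v(4) u(4) star_mult[OF v(1) u(1)] using c assms(3) by algebra
  ultimately show ?thesis
    using u v unfolding unitarily_equivalent_def cstar_unitary_def
    by (intro exI[of _ "v \<otimes> u"]) auto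
qed

text \<open>The terms containing \<open>q \<otimes> (\<one> \<ominus> q)\<close> vanish. The
  right-hand side is symmetric in \<open>p\<close> and \<open>q\<close>, so the intertwiner
  \<open>q p + (1 - q) (1 - p)\<close> of two projections is normal.\<close>

lemma projection_pair_identity:
  assumes p: "p \<in> carrier A" "p \<otimes> p = p" and q: "q \<in> carrier A" "q \<otimes> q = q"
  shows "(p \<otimes> q \<oplus> (\<one> \<ominus> p) \<otimes> (\<one> \<ominus> q)) \<otimes> (q \<otimes> p \<oplus> (\<one> \<ominus> q) \<otimes> (\<one> \<ominus> p)) =
    \<one> \<ominus> (p \<ominus> q) \<otimes> (p \<ominus> q)"
proof -
  define p' where "p' = \<one> \<ominus> p"
  define q' where "q' = \<one> \<ominus> q"
  have c: "p' \<in> carrier A" "q' \<in> carrier A" using p q by (auto simp: p'_def q'_def)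
  have "q \<otimes> q' = q \<ominus> q \<otimes> q" "q' \<otimes> q = q \<ominus> q \<otimes> q"
    "q' \<otimes> q' = q' \<oplus> (q \<otimes> q \<ominus> q)"
    unfolding q'_def using q(1) by algebra+
  then have qq': "q \<otimes> q' = \<zero>" "q' \<otimes> q = \<zero>" "q' \<otimes> q' = q'" using q c by simp_all
  have "(p \<otimes> q \<oplus> p' \<otimes> q') \<otimes> (q \<otimes> p \<oplus> q' \<otimes> p') =
      p \<otimes> (q \<otimes> q) \<otimes> p \<oplus> p' \<otimes> (q' \<otimes> q') \<otimes> p' \<oplus> (p \<otimes> (q \<otimes> q') \<otimes> p' \<oplus> p' \<otimes> (q' \<otimes> q) \<otimes> p)"
    using p(1) q(1) c by algebra
  also have "\<dots> = p \<otimes> q \<otimes> p \<oplus> p' \<otimes> q' \<otimes> p'" unfolding qq' q(2) using p q c by simp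
  also have "\<dots> = (\<one> \<ominus> (p \<oplus> (q \<ominus> (p \<otimes> q \<oplus> q \<otimes> p)))) \<oplus> (p \<otimes> p \<ominus> p)"
    unfolding p'_def q'_def using p(1) q(1) by algebra
  also have "\<dots> = \<one> \<ominus> (p \<oplus> (q \<ominus> (p \<otimes> q \<oplus> q \<otimes> p)))" using p q by simp
  also have "(p \<oplus> (q \<ominus> (p \<otimes> q \<oplus> q \<otimes> p))) = (p \<ominus> q) \<otimes> (p \<ominus> q)"
  proof -
    have "(p \<ominus> q) \<otimes> (p \<ominus> q) = p \<otimes> p \<oplus> (q \<otimes> q \<ominus> (p \<otimes> q \<oplus> q \<otimes> p))"
      using p(1) q(1) by algebra
    then show ?thesis using p q by simp
  qed
  finally show ?thesis by (simp add: p'_def q'_def)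
qed

text \<open>The unitary is the polar part of \<open>q p + (1 - q)(1 - p)\<close>, which intertwines \<open>p\<close> and \<open>q\<close>.\<close>

lemma unitarily_equivalent_near:
  assumes p: "cstar_projection A p" and q: "cstar_projection A q" and pq: "\<parallel>p \<ominus> q\<parallel> < 1"
  shows "unitarily_equivalent A p q"
proof -
  note p = cstar_projectionD[OF p] and q = cstar_projectionD[OF q]
  define D where "D = (p \<ominus> q) \<otimes> (p \<ominus> q)"
  define a where "a = \<one> \<ominus> D"
  define w where "w = q \<otimes> p \<oplus> (\<one> \<ominus> q) \<otimes> (\<one> \<ominus> p)"
  define w' where "w' = p \<otimes> q \<oplus> (\<one> \<ominus> p) \<otimes> (\<one> \<ominus> q)"
  have c: "D \<in> carrier A" "a \<in> carrier A" "w \<in> carrier A" "w' \<in> carrier A" "star A D = D" "star A a = a"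
    and ws: "star A w = w'"
    using p q by (auto simp: D_def a_def w_def w'_def star_diff star_mult star_add)
  have w'w: "w' \<otimes> w = a"
    unfolding w_def w'_def a_def D_def by (rule projection_pair_identity) (use p q in auto)
  have "w \<otimes> w' = \<one> \<ominus> (q \<ominus> p) \<otimes> (q \<ominus> p)"
    unfolding w_def w'_def by (rule projection_pair_identity) (use p q in auto)
  also have "(q \<ominus> p) \<otimes> (q \<ominus> p) = D" unfolding D_def using p(1) q(1) by algebra
  finally have ww': "w \<otimes> w' = a" by (simp add: a_def)
  have "\<parallel>D\<parallel> = (\<parallel>p \<ominus> q\<parallel>)\<^sup>2" unfolding D_def using p q by (intro cnorm_square) (auto simp: star_diff)
  also have "\<dots> < 1" using pq p q by (simp add: abs_square_less_1)
  finally have "\<parallel>D\<parallel> < 1" .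
  moreover have "\<one> \<ominus> a = D" unfolding a_def using c(1) by algebra
  ultimately have a1: "\<parallel>\<one> \<ominus> a\<parallel> < 1" by simp
  obtain k where k: "k \<in> carrier A" "star A k = k" "k \<otimes> k = a" "\<parallel>\<one> \<ominus> k\<parallel> \<le> \<parallel>\<one> \<ominus> a\<parallel>"
    "\<And>w. \<lbrakk>w \<in> carrier A; w \<otimes> a = a \<otimes> w\<rbrakk> \<Longrightarrow> w \<otimes> k = k \<otimes> w"
    using sqrt_near_one[OF c(2,6) a1] by metis
  have kU: "k \<in> Units A" using k(1,4) a1 by (intro Units_near_one) auto
  define r where "r = inv k"
  have r: "r \<in> carrier A" "k \<otimes> r = \<one>" "r \<otimes> k = \<one>" "star A r = r"
    using kU star_inv[OF kU] k(2) by (auto simp: r_def)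
  \<comment> \<open>Both products reduce to
    \<open>p \<ominus> p \<otimes> q \<otimes> p\<close>.\<close>
  have "p \<otimes> D = p \<otimes> p \<otimes> p \<ominus> p \<otimes> p \<otimes> q \<oplus> (p \<otimes> (q \<otimes> q) \<ominus> p \<otimes> q \<otimes> p)"
    "D \<otimes> p = p \<otimes> p \<otimes> p \<ominus> q \<otimes> (p \<otimes> p) \<oplus> ((q \<otimes> q) \<otimes> p \<ominus> p \<otimes> q \<otimes> p)"
    unfolding D_def using p(1) q(1) by algebra+
  then have pD: "p \<otimes> D = p \<ominus> p \<otimes> q \<oplus> (p \<otimes> q \<ominus> p \<otimes> q \<otimes> p)"
    "D \<otimes> p = p \<ominus> q \<otimes> p \<oplus> (q \<otimes> p \<ominus> p \<otimes> q \<otimes> p)"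
    by (simp_all add: p q)
  have "p \<otimes> D = D \<otimes> p" unfolding pD using p(1) q(1) by algebra
  then have pa: "p \<otimes> a = a \<otimes> p" using p c by (simp add: a_def a_minus_def l_distr r_distr l_minus r_minus)
  have wa: "w \<otimes> a = a \<otimes> w" using c by (simp add: w'w[symmetric] m_assoc[symmetric] ww')
  have pr: "p \<otimes> r = r \<otimes> p" and wr: "w \<otimes> r = r \<otimes> w"
    unfolding r_def using k(5)[OF p(1) pa] k(5)[OF c(3) wa] p(1) c(3) kU by (auto intro: inv_commute)
  \<comment> \<open>Both sides equal \<open>q \<otimes> p\<close>.\<close>
  have wp: "w \<otimes> p = q \<otimes> w"
  proof -
    have "w \<otimes> p = q \<otimes> (p \<otimes> p) \<oplus> ((\<one> \<ominus> q) \<otimes> (p \<ominus> p \<otimes> p))"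
      "q \<otimes> w = (q \<otimes> q) \<otimes> p \<oplus> ((q \<ominus> q \<otimes> q) \<otimes> (\<one> \<ominus> p))"
      unfolding w_def using p(1) q(1) by algebra+
    then show ?thesis using p q by simp
  qed
  define u where "u = w \<otimes> r"
  have u: "u \<in> carrier A" "star A u = r \<otimes> w'" using c r by (auto simp: u_def star_mult ws)
  have "star A u \<otimes> u = r \<otimes> (w' \<otimes> w) \<otimes> r"
    unfolding u using c r by (simp add: u_def m_assoc)
  also have "\<dots> = (r \<otimes> k) \<otimes> (k \<otimes> r)" unfolding w'w k(3)[symmetric] using k(1) r(1) by algebra
  finally have uu: "star A u \<otimes> u = \<one>" using r by simp
  have rr: "r \<otimes> r \<otimes> a = \<one>"
  proof -
    have "r \<otimes> r \<otimes> a = r \<otimes> (r \<otimes> k) \<otimes> k" unfolding k(3)[symmetric] using k(1) r(1) by algebra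
    then show ?thesis using k(1) r by simp
  qed
  have "w \<otimes> (r \<otimes> r) = (r \<otimes> r) \<otimes> w" using wr c r by (metis m_assoc)
  then have wrr: "w \<otimes> (r \<otimes> r) \<otimes> w' = \<one>"
    using rr ww' c r by (simp add: m_assoc)
  have "u \<otimes> star A u = w \<otimes> (r \<otimes> r) \<otimes> w'" unfolding u(2) unfolding u_def using c(3,4) r(1) by algebra
  then have uu': "u \<otimes> star A u = \<one>" using wrr by simp
  have "u \<otimes> p \<otimes> star A u = w \<otimes> (r \<otimes> p) \<otimes> (r \<otimes> w')" unfolding u(2) unfolding u_def using c(3,4) r(1) p(1) by algebra
  also have "\<dots> = (w \<otimes> p) \<otimes> (r \<otimes> r) \<otimes> w'"
    unfolding pr[symmetric] using c(3,4) r(1) p(1) by algebra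
  also have "\<dots> = q \<otimes> (w \<otimes> (r \<otimes> r) \<otimes> w')"
    unfolding wp using c(3,4) r(1) q(1) by algebra
  also have "\<dots> = q" using wrr q by simp
  finally show ?thesis
    unfolding unitarily_equivalent_def cstar_unitary_def using u(1) uu uu' by metis
qed

text \<open>For \<open>v = x + Z e\<close> the relations \<open>e x = 0\<close> and
  \<open>x e = x\<close> give \<open>(star v) v = (star x) x + e (Z Z) e = e\<close>, so
  \<open>p = v (star v)\<close> is a projection. For the distance,
  \<open>p - e = d (star v) + e (star d)\<close> with \<open>d = v - e\<close>, where
  \<open>v\<close> and \<open>e\<close> have norm at most 1.\<close>

lemma perturbed_projection:
  assumes e: "cstar_projection A e"
    and x: "x \<in> carrier A" "e \<otimes> x = \<zero>" "x \<otimes> e = x"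
    and Z: "Z \<in> carrier A" "star A Z = Z" "Z \<otimes> Z = \<one> \<ominus> star A x \<otimes> x" "e \<otimes> Z = Z \<otimes> e"
  defines "p \<equiv> (x \<oplus> Z \<otimes> e) \<otimes> (star A x \<oplus> Z \<otimes> e)"
  shows "cstar_projection A p" and "\<parallel>p \<ominus> e\<parallel> \<le> 2 * (\<parallel>x\<parallel> + \<parallel>\<one> \<ominus> Z\<parallel>)"
proof -
  note e' = cstar_projectionD[OF e]
  define x' where "x' = star A x"
  define v where "v = x \<oplus> Z \<otimes> e"
  define v' where "v' = x' \<oplus> Z \<otimes> e"
  have c: "x' \<in> carrier A" "v \<in> carrier A" "v' \<in> carrier A" using x Z e' by (auto simp: x'_def v_def v'_def)
  have v': "star A v = v'" using x Z e' by (simp add: v_def v'_def x'_def star_add star_mult)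
  have x': "x' \<otimes> e = \<zero>" "e \<otimes> x' = x'"
    using star_mult[OF e'(1) x(1)] star_mult[OF x(1) e'(1)] x e' by (auto simp: x'_def)
  have ee: "e \<otimes> (\<one> \<ominus> x' \<otimes> x) \<otimes> e = e \<ominus> x' \<otimes> x"
  proof -
    have "e \<otimes> (\<one> \<ominus> x' \<otimes> x) \<otimes> e = e \<otimes> e \<ominus> (e \<otimes> x') \<otimes> (x \<otimes> e)"
      using e'(1) x(1) c(1) by algebra
    then show ?thesis using x x' e' by simp
  qed
  have "v' \<otimes> v = x' \<otimes> x \<oplus> (x' \<otimes> (Z \<otimes> e) \<oplus> (Z \<otimes> e) \<otimes> x) \<oplus> (Z \<otimes> e) \<otimes> (Z \<otimes> e)"
    unfolding v_def v'_def using x(1) Z(1) e'(1) c by algebra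
  also have "x' \<otimes> (Z \<otimes> e) = (x' \<otimes> e) \<otimes> Z" using Z(1,4) c e'(1) by (simp add: m_assoc)
  also have "(Z \<otimes> e) \<otimes> x = Z \<otimes> (e \<otimes> x)" using Z(1) x(1) e'(1) by (simp add: m_assoc)
  also have "(Z \<otimes> e) \<otimes> (Z \<otimes> e) = (e \<otimes> Z) \<otimes> (Z \<otimes> e)" using Z(4) by simp
  also have "\<dots> = e \<otimes> (Z \<otimes> Z) \<otimes> e" using Z(1) e'(1) by (simp add: m_assoc)
  also have "\<dots> = e \<ominus> x' \<otimes> x" unfolding Z(3) x'_def[symmetric] by (rule ee)
  also have "x' \<otimes> x \<oplus> ((x' \<otimes> e) \<otimes> Z \<oplus> Z \<otimes> (e \<otimes> x)) \<oplus> (e \<ominus> x' \<otimes> x) = e"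
    unfolding x' x(2) using Z(1) x(1) c(1) e'(1) by algebra
  finally have v'v: "v' \<otimes> v = e" .
  have ve: "v \<otimes> e = v"
  proof -
    have "v \<otimes> e = x \<otimes> e \<oplus> Z \<otimes> (e \<otimes> e)" unfolding v_def using x(1) Z(1) e'(1) by algebra
    then show ?thesis using x e' by (simp add: v_def)
  qed
  have p: "p = v \<otimes> v'" by (simp add: p_def v_def v'_def x'_def)
  have "p \<otimes> p = v \<otimes> (v' \<otimes> v) \<otimes> v'" unfolding p using c by (simp add: m_assoc)
  then have "p \<otimes> p = p" unfolding v'v ve p .
  moreover have "star A p = p" unfolding p using c by (simp add: star_mult v' flip: v')
  ultimately show "cstar_projection A p"
    using c by (simp add: cstar_projection_def self_adjoint_def p)
  have "(\<parallel>v\<parallel>)\<^sup>2 \<le> 1" using cstar_identity[OF c(2)] v' v'v cnorm_projection_le[OF e] by simp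
  then have v1: "\<parallel>v'\<parallel> \<le> 1" using c cnorm_star[of v] v' by (simp add: abs_square_le_1)
  define d where "d = v \<ominus> e"
  have d: "d \<in> carrier A" using c e' by (simp add: d_def)
  have d': "star A d = v' \<ominus> e" using c e' v' by (simp add: d_def star_diff)
  have "d = x \<ominus> (\<one> \<ominus> Z) \<otimes> e" unfolding d_def v_def using x(1) Z(1) e'(1) by algebra
  then have "\<parallel>d\<parallel> \<le> \<parallel>x\<parallel> + \<parallel>(\<one> \<ominus> Z) \<otimes> e\<parallel>" using x Z e' by (simp add: cnorm_diff_triangle)
  also have "\<parallel>(\<one> \<ominus> Z) \<otimes> e\<parallel> \<le> \<parallel>\<one> \<ominus> Z\<parallel> * \<parallel>e\<parallel>" using Z e' by (intro cnorm_mult) auto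
  also have "\<dots> \<le> \<parallel>\<one> \<ominus> Z\<parallel> * 1" using cnorm_projection_le[OF e] Z by (intro mult_left_mono) auto
  finally have dn: "\<parallel>d\<parallel> \<le> \<parallel>x\<parallel> + \<parallel>\<one> \<ominus> Z\<parallel>" by simp
  have "p \<ominus> e = (d \<otimes> v' \<oplus> e \<otimes> star A d) \<oplus> (e \<otimes> e \<ominus> e)"
    unfolding p d' unfolding d_def using c e'(1) by algebra
  then have "p \<ominus> e = d \<otimes> v' \<oplus> e \<otimes> star A d" using c d e' by simp
  then have "\<parallel>p \<ominus> e\<parallel> \<le> \<parallel>d \<otimes> v'\<parallel> + \<parallel>e \<otimes> star A d\<parallel>" using c d e' by (simp add: cnorm_triangle)
  also have "\<parallel>d \<otimes> v'\<parallel> \<le> \<parallel>d\<parallel> * \<parallel>v'\<parallel>" using c d by (intro cnorm_mult) auto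
  also have "\<parallel>e \<otimes> star A d\<parallel> \<le> \<parallel>e\<parallel> * \<parallel>d\<parallel>" using cnorm_mult[of e "star A d"] d e' by simp
  also have "\<parallel>d\<parallel> * \<parallel>v'\<parallel> + \<parallel>e\<parallel> * \<parallel>d\<parallel> \<le> \<parallel>d\<parallel> * 1 + 1 * \<parallel>d\<parallel>"
    using v1 cnorm_projection_le[OF e] d by (intro add_mono mult_left_mono mult_right_mono) auto
  finally show "\<parallel>p \<ominus> e\<parallel> \<le> 2 * (\<parallel>x\<parallel> + \<parallel>\<one> \<ominus> Z\<parallel>)" using dn by simp
qed

text \<open>From \<open>q p = (q - e) p + e (p - f) + e f\<close>, where the last term vanishes and
  projections have norm at most 1.\<close>

lemma cnorm_mult_near_orthogonal:
  assumes p: "cstar_projection A p" and q: "q \<in> carrier A" and e: "cstar_projection A e"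
    and f: "cstar_projection A f" and ef: "e \<otimes> f = \<zero>"
    and pe: "\<parallel>p \<ominus> f\<parallel> \<le> d" and qe: "\<parallel>q \<ominus> e\<parallel> \<le> d"
  shows "\<parallel>q \<otimes> p\<parallel> \<le> 2 * d"
proof -
  note c = cstar_projectionD(1)[OF p] cstar_projectionD(1)[OF e] cstar_projectionD(1)[OF f]
  have "q \<otimes> p = ((q \<ominus> e) \<otimes> p \<oplus> e \<otimes> (p \<ominus> f)) \<oplus> e \<otimes> f" using c q by algebra
  then have "q \<otimes> p = (q \<ominus> e) \<otimes> p \<oplus> e \<otimes> (p \<ominus> f)" unfolding ef using c q by simp
  then have "\<parallel>q \<otimes> p\<parallel> \<le> \<parallel>(q \<ominus> e) \<otimes> p\<parallel> + \<parallel>e \<otimes> (p \<ominus> f)\<parallel>" using c q by (simp add: cnorm_triangle)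
  also have "\<dots> \<le> \<parallel>q \<ominus> e\<parallel> * \<parallel>p\<parallel> + \<parallel>e\<parallel> * \<parallel>p \<ominus> f\<parallel>"
    using c q by (intro add_mono cnorm_mult) auto
  also have "\<dots> \<le> \<parallel>q \<ominus> e\<parallel> * 1 + 1 * \<parallel>p \<ominus> f\<parallel>"
    using c q cnorm_projection_le[OF p] cnorm_projection_le[OF e]
    by (intro add_mono mult_left_mono mult_right_mono) auto
  finally show ?thesis using pe qe by simp
qed

section \<open>Block matrices\<close>

lemma mat_norm_le_entries:
  assumes T: "T \<in> carrier (Mat r)" and le: "\<And>i j. \<lbrakk>i < r; j < r\<rbrakk> \<Longrightarrow> \<parallel>T (i, j)\<parallel> \<le> b"
  shows "mat_norm r A T \<le> real r * real r * b"
proof -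
  have "(\<Sum>i<r. \<Sum>j<r. \<parallel>T (i, j)\<parallel>) \<le> (\<Sum>i<r. \<Sum>j<r. b)"
    using le by (intro sum_mono) auto
  then show ?thesis using mat_norm_le_sum[OF T] by simp
qed

lemma finsum_delta_if:
  assumes "finite I" "j \<in> I" "\<And>i. i \<in> I \<Longrightarrow> f i \<in> carrier A"
  shows "(\<Oplus>i\<in>I. if i = j then f i else \<zero>) = f j"
  by (subst finsum_delta[OF assms(1,2)]) (use assms in auto)

section \<open>Matrix units with a coefficient from \<open>A\<close>\<close>

definition mu :: "nat \<Rightarrow> nat \<Rightarrow> nat \<Rightarrow> 'a \<Rightarrow> nat \<times> nat \<Rightarrow> 'a" where
  "mu r p q a = (\<lambda>(i, j)\<in>{..<r} \<times> {..<r}. if i = p \<and> j = q then a else \<zero>)"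

lemma mu_closed [simp, intro]: "a \<in> carrier A \<Longrightarrow> mu r p q a \<in> carrier (Mat r)"
  by (auto simp: mu_def carrier_mat)

lemma mu_entry: "\<lbrakk>i < r; j < r\<rbrakk> \<Longrightarrow> mu r p q a (i, j) = (if i = p \<and> j = q then a else \<zero>)"
  by (simp add: mu_def)

lemma mu_mult_entry:
  assumes T: "T \<in> carrier (Mat r)" and a: "a \<in> carrier A" and ij: "i < r" "j < r" and q: "q < r"
  shows "(mu r p q a \<otimes>\<^bsub>Mat r\<^esub> T) (i, j) = (if i = p then a \<otimes> T (q, j) else \<zero>)"
proof -
  have "(mu r p q a \<otimes>\<^bsub>Mat r\<^esub> T) (i, j) = (\<Oplus>h\<in>{..<r}. if h = q then (if i = p then a \<otimes> T (h, j) else \<zero>) else \<zero>)"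
    using T a ij by (auto simp: mat_mult_entry mu_entry intro!: finsum_cong')
  also have "\<dots> = (if i = p then a \<otimes> T (q, j) else \<zero>)"
    using T a ij q by (subst finsum_delta_if) auto
  finally show ?thesis .
qed

lemma mult_mu_entry:
  assumes T: "T \<in> carrier (Mat r)" and a: "a \<in> carrier A" and ij: "i < r" "j < r" and p: "p < r"
  shows "(T \<otimes>\<^bsub>Mat r\<^esub> mu r p q a) (i, j) = (if j = q then T (i, p) \<otimes> a else \<zero>)"
proof -
  have "(T \<otimes>\<^bsub>Mat r\<^esub> mu r p q a) (i, j) = (\<Oplus>h\<in>{..<r}. if h = p then (if j = q then T (i, h) \<otimes> a else \<zero>) else \<zero>)"
    using T a ij by (auto simp: mat_mult_entry mu_entry intro!: finsum_cong')
  also have "\<dots> = (if j = q then T (i, p) \<otimes> a else \<zero>)"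
    using T a ij p by (subst finsum_delta_if) auto
  finally show ?thesis .
qed

lemma mu_mult:
  assumes "a \<in> carrier A" "b \<in> carrier A" "q < r" "p < r" "t < r"
  shows "mu r p q a \<otimes>\<^bsub>Mat r\<^esub> mu r q t b = mu r p t (a \<otimes> b)"
  by (rule mat_eqI) (use assms in \<open>auto simp: mu_mult_entry mu_entry\<close>)

lemma star_mu: "a \<in> carrier A \<Longrightarrow> star (Mat r) (mu r p q a) = mu r q p (star A a)"
  by (rule mat_eqI) (auto simp: mu_entry mat_star_entry)

lemma mu_add: "\<lbrakk>a \<in> carrier A; b \<in> carrier A\<rbrakk> \<Longrightarrow> mu r p q a \<oplus>\<^bsub>Mat r\<^esub> mu r p q b = mu r p q (a \<oplus> b)"
  by (rule mat_eqI) (auto simp: mu_entry mat_add_entry)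

lemma mu_minus: "\<lbrakk>a \<in> carrier A; b \<in> carrier A\<rbrakk> \<Longrightarrow> mu r p q a \<ominus>\<^bsub>Mat r\<^esub> mu r p q b = mu r p q (a \<ominus> b)"
  by (rule mat_eqI) (auto simp: mu_entry mat_minus_entry)

lemma mu_smult: "a \<in> carrier A \<Longrightarrow> c \<odot>\<^bsub>Mat r\<^esub> mu r p q a = mu r p q (c \<odot> a)"
  by (rule mat_eqI) (auto simp: mu_entry mat_smult_entry)

lemma mu_zero: "mu r p q \<zero> = \<zero>\<^bsub>Mat r\<^esub>"
  by (rule mat_eqI) (auto simp: mu_entry mat_zero_entry)

lemma mu_compress:
  assumes "T \<in> carrier (Mat r)" "p < r" "q < r"
  shows "mu r p p \<one> \<otimes>\<^bsub>Mat r\<^esub> T \<otimes>\<^bsub>Mat r\<^esub> mu r q q \<one> = mu r p q (T (p, q))"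
  by (rule mat_eqI) (use assms in \<open>auto simp: mult_mu_entry mu_mult_entry mu_entry\<close>)

lemma mat_norm_mu_le:
  assumes a: "a \<in> carrier A"
  shows "mat_norm r A (mu r p q a) \<le> \<parallel>a\<parallel>"
proof -
  have "(\<Sum>j<r. \<parallel>mu r p q a (i, j)\<parallel>) \<le> (if i = p then \<parallel>a\<parallel> else 0)" if "i < r" for i
  proof -
    have "(\<Sum>j<r. \<parallel>mu r p q a (i, j)\<parallel>) = (\<Sum>j<r. if j = q then (if i = p then \<parallel>a\<parallel> else 0) else 0)"
      using that by (intro sum.cong) (auto simp: mu_entry)
    also have "\<dots> \<le> (if i = p then \<parallel>a\<parallel> else 0)" using a by (simp add: sum.delta)
    finally show ?thesis .
  qed
  then have "(\<Sum>i<r. \<Sum>j<r. \<parallel>mu r p q a (i, j)\<parallel>) \<le> (\<Sum>i<r. if i = p then \<parallel>a\<parallel> else 0)"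
    by (intro sum_mono) auto
  also have "\<dots> \<le> \<parallel>a\<parallel>" using a by (simp add: sum.delta)
  finally show ?thesis using mat_norm_le_sum[OF mu_closed[OF a]] by (meson order_trans)
qed

lemma mat_finsum_entry:
  assumes "finite I" "\<And>x. x \<in> I \<Longrightarrow> f x \<in> carrier (Mat r)" "i < r" "j < r"
  shows "finsum (Mat r) f I \<in> carrier (Mat r) \<and> finsum (Mat r) f I (i, j) = (\<Oplus>x\<in>I. f x (i, j))"
  using assms(1,2)
proof (induction I rule: finite_induct)
  case empty
  interpret M: ring "Mat r" by (rule ring_mat)
  show ?case using assms by (simp add: mat_zero_entry)
next
  case (insert x I)
  interpret M: ring "Mat r" by (rule ring_mat)
  have "(\<lambda>x. f x (i, j)) \<in> I \<rightarrow> carrier A" "f x (i, j) \<in> carrier A"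
    using insert.prems assms(3,4) by auto
  then show ?case using insert assms(3,4) by (simp add: Pi_def mat_add_entry)
qed

lemma mat_eq_finsum_mu:
  assumes T: "T \<in> carrier (Mat r)"
  shows "T = (\<Oplus>\<^bsub>Mat r\<^esub>x\<in>{..<r} \<times> {..<r}. mu r (fst x) (snd x) (T x))"
proof (rule mat_eqI)
  interpret M: ring "Mat r" by (rule ring_mat)
  show "(\<Oplus>\<^bsub>Mat r\<^esub>x\<in>{..<r} \<times> {..<r}. mu r (fst x) (snd x) (T x)) \<in> carrier (Mat r)"
    using T by (intro M.finsum_closed) (auto simp: Pi_def)
  fix i j assume ij: "i < r" "j < r"
  have "(\<Oplus>\<^bsub>Mat r\<^esub>x\<in>{..<r} \<times> {..<r}. mu r (fst x) (snd x) (T x)) (i, j) =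
      (\<Oplus>x\<in>{..<r} \<times> {..<r}. mu r (fst x) (snd x) (T x) (i, j))"
    using T ij mat_finsum_entry[of "{..<r} \<times> {..<r}" "\<lambda>x. mu r (fst x) (snd x) (T x)" r i j] by auto
  also have "\<dots> = (\<Oplus>x\<in>{..<r} \<times> {..<r}. if x = (i, j) then T x else \<zero>)"
    using T ij by (intro finsum_cong') (auto simp: mu_entry)
  also have "\<dots> = T (i, j)" using T ij by (intro finsum_delta_if) auto
  finally show "T (i, j) = (\<Oplus>\<^bsub>Mat r\<^esub>x\<in>{..<r} \<times> {..<r}. mu r (fst x) (snd x) (T x)) (i, j)" ..
qed (rule T)

end

section \<open>Division of the indices into \<open>k\<close> blocks of length
  \<open>l\<close>\<close>

locale block_matrices = unital_cstar_algebra A for A :: "'a cstar" (structure) +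
  fixes k l :: nat
  assumes l_pos: "0 < l"
begin

abbreviation E :: "(nat \<times> nat \<Rightarrow> 'a) cstar" where "E \<equiv> mat_algebra (k * l) A"

abbreviation mmult (infixl "\<boxtimes>" 70) where "S \<boxtimes> T \<equiv> S \<otimes>\<^bsub>E\<^esub> T"
abbreviation madd (infixl "\<boxplus>" 65) where "S \<boxplus> T \<equiv> S \<oplus>\<^bsub>E\<^esub> T"
abbreviation mminus (infixl "\<boxminus>" 65) where "S \<boxminus> T \<equiv> S \<ominus>\<^bsub>E\<^esub> T"
abbreviation U :: "nat \<Rightarrow> nat \<Rightarrow> 'a \<Rightarrow> nat \<times> nat \<Rightarrow> 'a" where "U \<equiv> mu (k * l)"

sublocale M: unital_cstar_algebra E
  by (rule unital_cstar_algebra_mat)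

lemma index_less: "\<lbrakk>d < k; m < l\<rbrakk> \<Longrightarrow> d * l + m < k * l"
proof -
  assume "d < k" "m < l"
  then have "d * l + m < Suc d * l" "Suc d * l \<le> k * l"
    by (simp, intro mult_right_mono) auto
  then show ?thesis by linarith
qed

lemma div_less_k: "i < k * l \<Longrightarrow> i div l < k"
  by (simp add: less_mult_imp_div_less)

lemma mod_less_l [simp]: "i mod l < l"
  using l_pos by simp

lemma index_div [simp]: "m < l \<Longrightarrow> (d * l + m) div l = d"
  and index_mod [simp]: "m < l \<Longrightarrow> (d * l + m) mod l = m"
  by (auto simp: div_mult_self3)

text \<open>It reduces the sums in products with block units to a single nonzero term.\<close>

lemma eq_index_iff: "m < l \<Longrightarrow> i = d * l + m \<longleftrightarrow> i div l = d \<and> i mod l = m"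
  using l_pos by (auto simp: div_mult_mod_eq)

text \<open>A diagonal matrix placed in block \<open>(c, d)\<close>. Since \<open>f\<close> is real,
  the star only exchanges the two block indices. The constant \<open>f = 1\<close> gives the matrix
  units of the block structure.\<close>

definition sh :: "nat \<Rightarrow> nat \<Rightarrow> (nat \<Rightarrow> real) \<Rightarrow> nat \<times> nat \<Rightarrow> 'a" where
  "sh c d f = (\<lambda>(i, j)\<in>{..<k * l} \<times> {..<k * l}.
     if i div l = c \<and> j div l = d \<and> i mod l = j mod l then scalar (f (i mod l)) else \<zero>)"

lemma sh_closed [simp, intro]: "sh c d f \<in> carrier E"
  by (auto simp: sh_def carrier_mat)

lemma sh_entry: "\<lbrakk>i < k * l; j < k * l\<rbrakk> \<Longrightarrow> sh c d f (i, j) =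
    (if i div l = c \<and> j div l = d \<and> i mod l = j mod l then scalar (f (i mod l)) else \<zero>)"
  by (simp add: sh_def)

lemma sh_mult_entry:
  assumes T: "T \<in> carrier E" and d: "d < k" and ij: "i < k * l" "j < k * l"
  shows "(sh c d f \<boxtimes> T) (i, j) =
    (if i div l = c then scalar (f (i mod l)) \<otimes> T (d * l + i mod l, j) else \<zero>)"
proof -
  have h: "d * l + i mod l < k * l" using d by (intro index_less) auto
  have "(sh c d f \<boxtimes> T) (i, j) = (\<Oplus>h\<in>{..<k * l}. if h = d * l + i mod l
      then (if i div l = c then scalar (f (i mod l)) \<otimes> T (h, j) else \<zero>) else \<zero>)"
    using T ij by (auto simp: mat_mult_entry sh_entry eq_index_iff intro!: finsum_cong')
  also have "\<dots> = (if i div l = c then scalar (f (i mod l)) \<otimes> T (d * l + i mod l, j) else \<zero>)"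
    using T ij h by (subst finsum_delta_if) auto
  finally show ?thesis .
qed

lemma mult_sh_entry:
  assumes T: "T \<in> carrier E" and c: "c < k" and ij: "i < k * l" "j < k * l"
  shows "(T \<boxtimes> sh c d f) (i, j) =
    (if j div l = d then T (i, c * l + j mod l) \<otimes> scalar (f (j mod l)) else \<zero>)"
proof -
  have h: "c * l + j mod l < k * l" using c by (intro index_less) auto
  have "(T \<boxtimes> sh c d f) (i, j) = (\<Oplus>h\<in>{..<k * l}. if h = c * l + j mod l
      then (if j div l = d then T (i, h) \<otimes> scalar (f (j mod l)) else \<zero>) else \<zero>)"
    using T ij by (auto simp: mat_mult_entry sh_entry eq_index_iff intro!: finsum_cong')
  also have "\<dots> = (if j div l = d then T (i, c * l + j mod l) \<otimes> scalar (f (j mod l)) else \<zero>)"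
    using T ij h by (subst finsum_delta_if) auto
  finally show ?thesis .
qed

lemma scalar_mult_scalar: "scalar s \<otimes> scalar t = scalar (s * t)"
  by (simp add: scalar_mult_left smult_scalar)

lemma scalar_zero [simp]: "scalar 0 = \<zero>"
  by (simp add: scalar_def)

lemma sh_mult:
  assumes "d < k"
  shows "sh c d f \<boxtimes> sh d e g = sh c e (\<lambda>i. f i * g i)"
  by (rule mat_eqI)
    (use assms index_less[OF assms] in \<open>auto simp: sh_mult_entry sh_entry scalar_mult_scalar\<close>)

lemma sh_mult_zero:
  assumes "d < k" "d \<noteq> d'"
  shows "sh c d f \<boxtimes> sh d' e g = \<zero>\<^bsub>E\<^esub>"
  by (rule mat_eqI)
    (use assms index_less[OF assms(1)] in \<open>auto simp: sh_mult_entry sh_entry mat_zero_entry\<close>)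

lemma star_sh [simp]: "star E (sh c d f) = sh d c f"
  by (rule mat_eqI) (auto simp: sh_entry mat_star_entry)

lemma sh_add: "sh c d f \<boxplus> sh c d g = sh c d (\<lambda>i. f i + g i)"
  by (rule mat_eqI) (auto simp: sh_entry mat_add_entry scalar_add)

lemma sh_minus: "sh c d f \<boxminus> sh c d g = sh c d (\<lambda>i. f i - g i)"
  by (rule mat_eqI) (auto simp: sh_entry mat_minus_entry scalar_diff)

lemma sh_smult: "complex_of_real t \<odot>\<^bsub>E\<^esub> sh c d f = sh c d (\<lambda>i. t * f i)"
  by (rule mat_eqI) (auto simp: sh_entry mat_smult_entry smult_scalar)

lemma sh_cong: "(\<And>i. i < l \<Longrightarrow> f i = g i) \<Longrightarrow> sh c d f = sh c d g"
  by (rule mat_eqI) (auto simp: sh_entry)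

abbreviation V :: "nat \<Rightarrow> nat \<Rightarrow> nat \<times> nat \<Rightarrow> 'a" where "V c d \<equiv> sh c d (\<lambda>_. 1)"

lemma V_mult: "d < k \<Longrightarrow> V c d \<boxtimes> V d e = V c e"
  by (simp add: sh_mult)

abbreviation P :: "nat \<Rightarrow> nat \<times> nat \<Rightarrow> 'a" where "P b \<equiv> V b b"

lemma P_projection: "b < k \<Longrightarrow> cstar_projection E (P b)"
  by (simp add: cstar_projection_def self_adjoint_def V_mult)

lemma P_orthogonal: "\<lbrakk>b < k; b \<noteq> c\<rbrakk> \<Longrightarrow> P b \<boxtimes> P c = \<zero>\<^bsub>E\<^esub>"
  by (simp add: sh_mult_zero)

lemma sum_P: "(\<Oplus>\<^bsub>E\<^esub>b\<in>{..<k}. P b) = \<one>\<^bsub>E\<^esub>"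
proof (rule mat_eqI)
  show "(\<Oplus>\<^bsub>E\<^esub>b\<in>{..<k}. P b) \<in> carrier E" by (intro M.finsum_closed) auto
  fix i j assume ij: "i < k * l" "j < k * l"
  have "(\<Oplus>\<^bsub>E\<^esub>b\<in>{..<k}. P b) (i, j) = (\<Oplus>b\<in>{..<k}. P b (i, j))"
    using mat_finsum_entry[of "{..<k}" P "k * l" i j] ij by auto
  also have "\<dots> = (\<Oplus>b\<in>{..<k}. if b = i div l then (if i = j then \<one> else \<zero>) else \<zero>)"
    using ij by (intro finsum_cong') (auto simp: sh_entry, metis div_mult_mod_eq)
  also have "\<dots> = (if i = j then \<one> else \<zero>)"
    using ij div_less_k by (intro finsum_delta_if) auto
  finally show "(\<Oplus>\<^bsub>E\<^esub>b\<in>{..<k}. P b) (i, j) = \<one>\<^bsub>E\<^esub> (i, j)" using ij by (simp add: mat_one_entry)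
qed auto

text \<open>The self-adjoint unitary \<open>W\<close> exchanges blocks 0 and \<open>b\<close> and
  fixes the others. For \<open>b = 0\<close> the two blocks coincide and the identity is used
  instead.\<close>

lemma P_unitarily_equivalent:
  assumes b: "b < k"
  shows "unitarily_equivalent E (P 0) (P b)"
proof (cases "b = 0")
  case True
  then show ?thesis
    unfolding unitarily_equivalent_def cstar_unitary_def by (auto intro!: exI[of _ "\<one>\<^bsub>E\<^esub>"])
next
  case False
  have k: "0 < k" using b by simp
  define F where "F = V b 0 \<boxplus> V 0 b"
  define Q where "Q = P 0 \<boxplus> P b"
  define W where "W = F \<boxplus> (\<one>\<^bsub>E\<^esub> \<boxminus> Q)"
  have c: "F \<in> carrier E" "Q \<in> carrier E" "W \<in> carrier E" by (auto simp: F_def Q_def W_def)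
  have sa: "star E W = W"
    by (simp add: W_def F_def Q_def M.star_add M.star_diff M.a_comm)
  have FF: "F \<boxtimes> F = Q"
    unfolding F_def Q_def using b False k
    by (simp add: M.l_distr M.r_distr sh_mult sh_mult_zero M.a_comm)
  have FQ: "F \<boxtimes> Q = F" "Q \<boxtimes> F = F" "Q \<boxtimes> Q = Q"
    unfolding F_def Q_def using b False k
    by (simp_all add: M.l_distr M.r_distr sh_mult sh_mult_zero M.a_comm)
  define N where "N = \<one>\<^bsub>E\<^esub> \<boxminus> Q"
  have N: "N \<in> carrier E" using c by (simp add: N_def)
  have FN: "F \<boxtimes> N = \<zero>\<^bsub>E\<^esub>" "N \<boxtimes> F = \<zero>\<^bsub>E\<^esub>" "N \<boxtimes> N = N"
    unfolding N_def using c
    by (simp_all add: a_minus_def M.r_distr M.l_distr M.r_minus M.l_minus FQ M.r_neg M.l_neg)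
  have WN: "W = F \<boxplus> N" by (simp add: W_def N_def)
  have "W \<boxtimes> W = Q \<boxplus> N"
    unfolding WN using c N by (simp add: M.l_distr M.r_distr FF FN)
  also have "\<dots> = \<one>\<^bsub>E\<^esub>"
    using c M.a_lcomm[of Q "\<one>\<^bsub>E\<^esub>" "\<ominus>\<^bsub>E\<^esub> Q"] by (simp add: N_def a_minus_def M.r_neg)
  finally have WW: "W \<boxtimes> W = \<one>\<^bsub>E\<^esub>" .
  have FP: "F \<boxtimes> P 0 = V b 0" "Q \<boxtimes> P 0 = P 0" "V b 0 \<boxtimes> F = P b" "V b 0 \<boxtimes> Q = V b 0"
    unfolding F_def Q_def using b False k
    by (simp_all add: M.l_distr M.r_distr sh_mult sh_mult_zero)
  have NP: "N \<boxtimes> P 0 = \<zero>\<^bsub>E\<^esub>" "V b 0 \<boxtimes> N = \<zero>\<^bsub>E\<^esub>"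
    unfolding N_def using c
    by (simp_all add: a_minus_def M.r_distr M.l_distr M.r_minus M.l_minus FP M.r_neg)
  have "W \<boxtimes> P 0 = V b 0" unfolding WN using c N by (simp add: M.l_distr FP NP)
  then have "W \<boxtimes> P 0 \<boxtimes> W = P b" using c N by (simp add: WN M.r_distr FP NP)
  then have "P b = W \<boxtimes> P 0 \<boxtimes> W" ..
  then show ?thesis
    unfolding unitarily_equivalent_def cstar_unitary_def using c sa WW by (intro exI[of _ W]) auto
qed

end

lemma le_four_times:
  fixes a x y n :: real
  shows "\<lbrakk>a \<le> 2 * (x + y); x \<le> n; y \<le> n\<rbrakk> \<Longrightarrow> a \<le> 4 * n"
  by simp

section \<open>Projections near the block units\<close>

context block_matrices
begin

abbreviation mnrm :: "(nat \<times> nat \<Rightarrow> 'a) \<Rightarrow> real" where "mnrm T \<equiv> cnorm E T"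

text \<open>The \<open>P b\<close> add up to \<open>\<one>\<close>, so the sum of the
  \<open>p b\<close> is within \<open>k * d < 1\<close> of it. Equivalences pass through
  \<open>P 0\<close>: each \<open>p b\<close> is near \<open>P b\<close>, and \<open>P b\<close> is
  exchanged with \<open>P 0\<close> by a unitary.\<close>

lemma near_block_projections:
  assumes p: "\<And>b. b < k \<Longrightarrow> cstar_projection E (p b)"
    and near: "\<And>b. b < k \<Longrightarrow> mnrm (p b \<boxminus> P b) \<le> d" and d: "0 \<le> d" "real k * d < 1"
  shows "(\<Oplus>\<^bsub>E\<^esub>b\<in>{..<k}. p b) \<in> Units E"
    and "\<lbrakk>b < k; c < k\<rbrakk> \<Longrightarrow> unitarily_equivalent E (p b) (p c)"
    and "\<lbrakk>b < k; c < k; b \<noteq> c\<rbrakk> \<Longrightarrow> mnrm (p b \<boxtimes> p c) \<le> 2 * d"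
proof -
  have pc: "p b \<in> carrier E" if "b < k" for b using M.cstar_projectionD(1)[OF p[OF that]] .
  have "(\<Oplus>\<^bsub>E\<^esub>b\<in>{..<k}. P b) = (\<Oplus>\<^bsub>E\<^esub>b\<in>{..<k}. p b) \<boxplus> (\<Oplus>\<^bsub>E\<^esub>b\<in>{..<k}. P b \<boxminus> p b)"
  proof (rule M.finsum_add_cong)
    fix b assume "b \<in> {..<k}"
    then have "p b \<in> carrier E" using pc by simp
    then show "P b = p b \<boxplus> (P b \<boxminus> p b)"
      by (simp add: a_minus_def M.a_lcomm[of "p b" "P b"] M.r_neg)
  qed (use pc in auto)
  then have one: "\<one>\<^bsub>E\<^esub> = (\<Oplus>\<^bsub>E\<^esub>b\<in>{..<k}. p b) \<boxplus> (\<Oplus>\<^bsub>E\<^esub>b\<in>{..<k}. P b \<boxminus> p b)"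
    by (simp add: sum_P)
  define S where "S = (\<Oplus>\<^bsub>E\<^esub>b\<in>{..<k}. p b)"
  define R where "R = (\<Oplus>\<^bsub>E\<^esub>b\<in>{..<k}. P b \<boxminus> p b)"
  have c: "S \<in> carrier E" "R \<in> carrier E"
    unfolding S_def R_def using pc by (auto intro!: M.finsum_closed)
  have "\<one>\<^bsub>E\<^esub> \<boxminus> S = R"
    unfolding one S_def[symmetric] R_def[symmetric] using c
    by (simp add: a_minus_def M.a_comm[of S R] M.a_assoc M.r_neg)
  moreover have "mnrm R \<le> (\<Sum>b<k. mnrm (P b \<boxminus> p b))"
    unfolding R_def using pc by (intro M.cnorm_finsum_le) auto
  moreover have "(\<Sum>b<k. mnrm (P b \<boxminus> p b)) \<le> (\<Sum>b<k. d)"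
    using near pc by (intro sum_mono) (simp add: M.cnorm_diff_commute)
  ultimately have "mnrm (\<one>\<^bsub>E\<^esub> \<boxminus> S) < 1" using d by simp
  then show "(\<Oplus>\<^bsub>E\<^esub>b\<in>{..<k}. p b) \<in> Units E"
    using c M.Units_near_one by (simp add: S_def)
  have eqP: "unitarily_equivalent E (p b) (P b)" if "b < k" for b
  proof -
    \<comment> \<open>\<open>b < k\<close> forces \<open>k \<ge> 1\<close>, so
      \<open>k * d < 1\<close> bounds \<open>d\<close> itself.\<close>
    have "1 * d \<le> real k * d" using that d by (intro mult_right_mono) auto
    then have "d < 1" using d by simp
    then show ?thesis
      using that near[OF that] by (intro M.unitarily_equivalent_near p P_projection) auto
  qed
  have eq0: "unitarily_equivalent E (p b) (P 0)" if "b < k" for b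
    using M.unitarily_equivalent_trans[OF eqP[OF that] M.unitarily_equivalent_sym[OF P_unitarily_equivalent[OF that]]]
      pc[OF that] by simp
  show "unitarily_equivalent E (p b) (p c)" if "b < k" "c < k"
    using M.unitarily_equivalent_trans[OF eq0[OF that(1)] M.unitarily_equivalent_sym[OF eq0[OF that(2)]]]
      pc that by simp
  show "mnrm (p b \<boxtimes> p c) \<le> 2 * d" if "b < k" "c < k" "b \<noteq> c"
    using that near pc p
    by (intro M.cnorm_mult_near_orthogonal[where e = "P b" and f = "P c"] P_projection P_orthogonal) auto
qed

lemma mnrm_sh_le:
  assumes "\<And>i. i < l \<Longrightarrow> \<bar>f i\<bar> \<le> t" "0 \<le> t"
  shows "mnrm (sh c d f) \<le> real (k * l) * real (k * l) * t"
  unfolding cnorm_mat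
proof (rule mat_norm_le_entries)
  fix i j assume ij: "i < k * l" "j < k * l"
  show "cnorm A (sh c d f (i, j)) \<le> t"
    using assms(2) order_trans[OF cnorm_scalar_le assms(1)[of "i mod l"]] ij by (auto simp: sh_entry)
qed auto

lemma sh_uminus: "\<ominus>\<^bsub>E\<^esub> sh c d f = sh c d (\<lambda>i. - f i)"
proof -
  have "\<ominus>\<^bsub>E\<^esub> sh c d f = complex_of_real (-1) \<odot>\<^bsub>E\<^esub> sh c d f"
    by (simp add: M.smult_minus_left)
  then show ?thesis unfolding sh_smult by simp
qed

definition cosine :: "(nat \<Rightarrow> real) \<Rightarrow> nat \<Rightarrow> real" where "cosine s i = sqrt (1 - (s i)\<^sup>2)"

text \<open>For \<open>b \<noteq> 0\<close> this is, in coordinate \<open>i\<close>, the projection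
  onto a line in the plane of blocks 0 and \<open>b\<close>: the \<open>b\<close> axis turned
  towards the 0 axis by an angle with sine \<open>s i\<close>.\<close>

definition rotated :: "(nat \<Rightarrow> real) \<Rightarrow> nat \<Rightarrow> nat \<times> nat \<Rightarrow> 'a" where
  "rotated s b = (sh 0 b s \<boxplus> sh b b (cosine s)) \<boxtimes> (sh b 0 s \<boxplus> sh b b (cosine s))"

lemma rotated_projection:
  assumes b: "b < k" "b \<noteq> 0" and s: "\<And>i. \<bar>s i\<bar> \<le> t" and t: "0 \<le> t" "t \<le> 1"
  shows "cstar_projection E (rotated s b)"
    and "mnrm (rotated s b \<boxminus> P b) \<le> 4 * (real (k * l) * real (k * l) * t)"
proof -
  have k: "0 < k" using b by simp
  have s1: "(s i)\<^sup>2 \<le> \<bar>s i\<bar>" "(s i)\<^sup>2 \<le> 1" for i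
  proof -
    have *: "\<bar>s i\<bar> \<le> 1" using s[of i] t by linarith
    show "(s i)\<^sup>2 \<le> 1" using * by (simp add: abs_square_le_1)
    have "\<bar>s i\<bar> * \<bar>s i\<bar> \<le> \<bar>s i\<bar> * 1" using * by (intro mult_left_mono) auto
    then show "(s i)\<^sup>2 \<le> \<bar>s i\<bar>" by (simp add: power2_eq_square)
  qed
  have cos2: "cosine s i * cosine s i = 1 - (s i)\<^sup>2" for i
    using s1(2)[of i] by (simp add: cosine_def)
  \<comment> \<open>\<open>1 - s^2 \<le> cosine s\<close> because the square root does not decrease
    numbers in the unit interval, and \<open>s^2 \<le> \<bar>s\<bar> \<le> t\<close>.\<close>
  have cos1: "\<bar>1 - cosine s i\<bar> \<le> t" for i
  proof -
    have "(1 - (s i)\<^sup>2)\<^sup>2 \<le> 1 - (s i)\<^sup>2"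
      using s1(2)[of i] mult_left_le[of "1 - (s i)\<^sup>2" "1 - (s i)\<^sup>2"] by (simp add: power2_eq_square)
    then have "1 - (s i)\<^sup>2 \<le> cosine s i" unfolding cosine_def by (rule real_le_rsqrt)
    moreover have "cosine s i \<le> 1" by (simp add: cosine_def)
    ultimately show ?thesis using s1(1)[of i] s[of i] by linarith
  qed
  \<comment> \<open>Here the square root of \<open>1 - (star x) x\<close> is explicit:
    \<open>Z\<close> has cosines on block \<open>b\<close> and 1 elsewhere.\<close>
  define N where "N = sh b b (\<lambda>i. cosine s i - 1)"
  define Z where "Z = \<one>\<^bsub>E\<^esub> \<boxplus> N"
  have N: "N \<in> carrier E" by (simp add: N_def)
  have c: "Z \<in> carrier E" "star E Z = Z" by (auto simp: Z_def N_def M.star_add)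
  have x: "sh 0 b s \<in> carrier E" "P b \<boxtimes> sh 0 b s = \<zero>\<^bsub>E\<^esub>" "sh 0 b s \<boxtimes> P b = sh 0 b s"
    using b by (auto simp: sh_mult sh_mult_zero)
  have "Z \<boxtimes> Z = \<one>\<^bsub>E\<^esub> \<boxplus> (N \<boxplus> (N \<boxplus> N \<boxtimes> N))"
    unfolding Z_def using N by (simp add: M.l_distr M.r_distr M.a_assoc)
  also have "N \<boxplus> (N \<boxplus> N \<boxtimes> N) = sh b b (\<lambda>i. - (s i * s i))"
    unfolding N_def sh_mult[OF b(1)] sh_add
    using cos2 by (intro sh_cong) (simp add: algebra_simps power2_eq_square)
  also have "\<one>\<^bsub>E\<^esub> \<boxplus> \<dots> = \<one>\<^bsub>E\<^esub> \<boxminus> star E (sh 0 b s) \<boxtimes> sh 0 b s"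
    using k by (simp add: a_minus_def sh_mult sh_uminus)
  finally have ZZ: "Z \<boxtimes> Z = \<one>\<^bsub>E\<^esub> \<boxminus> star E (sh 0 b s) \<boxtimes> sh 0 b s" .
  have ZP: "Z \<boxtimes> P b = sh b b (cosine s)" "P b \<boxtimes> Z = sh b b (cosine s)"
    unfolding Z_def N_def using b by (simp_all add: M.l_distr M.r_distr sh_mult sh_add)
  have rot: "rotated s b = (sh 0 b s \<boxplus> Z \<boxtimes> P b) \<boxtimes> (star E (sh 0 b s) \<boxplus> Z \<boxtimes> P b)"
    by (simp add: rotated_def ZP)
  have PZ: "P b \<boxtimes> Z = Z \<boxtimes> P b" by (simp add: ZP)
  show "cstar_projection E (rotated s b)"
    unfolding rot by (rule M.perturbed_projection[OF P_projection[OF b(1)] x c ZZ PZ])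
  have "\<one>\<^bsub>E\<^esub> \<boxminus> Z = \<ominus>\<^bsub>E\<^esub> N"
    unfolding Z_def using N by (simp add: a_minus_def M.minus_add M.r_neg2)
  also have "\<dots> = sh b b (\<lambda>i. 1 - cosine s i)" by (simp add: N_def sh_uminus)
  finally have "mnrm (\<one>\<^bsub>E\<^esub> \<boxminus> Z) \<le> real (k * l) * real (k * l) * t"
    using cos1 t by (simp only:) (intro mnrm_sh_le, auto)
  moreover have "mnrm (sh 0 b s) \<le> real (k * l) * real (k * l) * t"
    using s t by (intro mnrm_sh_le) auto
  moreover have "mnrm (rotated s b \<boxminus> P b) \<le> 2 * (mnrm (sh 0 b s) + mnrm (\<one>\<^bsub>E\<^esub> \<boxminus> Z))"
    unfolding rot by (rule M.perturbed_projection[OF P_projection[OF b(1)] x c ZZ PZ])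
  ultimately show "mnrm (rotated s b \<boxminus> P b) \<le> 4 * (real (k * l) * real (k * l) * t)"
    using le_four_times by blast
qed

definition block12 :: "(nat \<Rightarrow> nat \<Rightarrow> 'a) \<Rightarrow> nat \<times> nat \<Rightarrow> 'a" where
  "block12 Y = (\<lambda>(i, j)\<in>{..<k * l} \<times> {..<k * l}.
     if i div l = 1 \<and> j div l = 2 then Y (i mod l) (j mod l) else \<zero>)"

text \<open>Row block 0 holds a bare identity and row block 1 holds \<open>Y\<close>, both in column
  block 2; in \<open>x (star x)\<close> the block \<open>(0, 1)\<close> is therefore
  \<open>t * t\<close> times the star of \<open>Y\<close>.\<close>

definition data_block :: "real \<Rightarrow> (nat \<Rightarrow> nat \<Rightarrow> 'a) \<Rightarrow> nat \<times> nat \<Rightarrow> 'a" where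
  "data_block t Y = complex_of_real t \<odot>\<^bsub>E\<^esub> (V 0 2 \<boxplus> block12 Y)"

lemma data_block_entry:
  assumes "i < k * l" "j < k * l"
  shows "data_block t Y (i, j) = complex_of_real t \<odot>
    ((if i div l = 0 \<and> j div l = 2 \<and> i mod l = j mod l then \<one> else \<zero>) \<oplus>
     (if i div l = 1 \<and> j div l = 2 then Y (i mod l) (j mod l) else \<zero>))"
  using assms by (simp add: data_block_def mat_smult_entry mat_add_entry sh_entry block12_def)

lemma block12_entry: "\<lbrakk>i < k * l; j < k * l\<rbrakk> \<Longrightarrow> block12 Y (i, j) =
    (if i div l = 1 \<and> j div l = 2 then Y (i mod l) (j mod l) else \<zero>)"
  by (simp add: block12_def)

lemma
  assumes k: "3 \<le> k" and Y: "\<And>i j. \<lbrakk>i < l; j < l\<rbrakk> \<Longrightarrow> Y i j \<in> carrier A"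
  shows data_block_closed: "data_block t Y \<in> carrier E"
    and P2_data_block: "P 2 \<boxtimes> data_block t Y = \<zero>\<^bsub>E\<^esub>"
    and data_block_P2: "data_block t Y \<boxtimes> P 2 = data_block t Y"
    and P01_data_block: "(P 0 \<boxplus> P 1) \<boxtimes> data_block t Y = data_block t Y"
    and P0_data_block: "P 0 \<boxtimes> data_block t Y = complex_of_real t \<odot>\<^bsub>E\<^esub> V 0 2"
    and data_block_star_entry: "\<lbrakk>i < l; j < l\<rbrakk> \<Longrightarrow>
      (data_block t Y \<boxtimes> star E (data_block t Y)) (i, l + j) = complex_of_real (t * t) \<odot> star A (Y j i)"
proof -
  have B: "block12 Y \<in> carrier E" using Y by (auto simp: block12_def carrier_mat)
  show X: "data_block t Y \<in> carrier E" using B by (simp add: data_block_def)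
  have PB: "P 0 \<boxtimes> block12 Y = \<zero>\<^bsub>E\<^esub>" "P 1 \<boxtimes> block12 Y = block12 Y" "P 2 \<boxtimes> block12 Y = \<zero>\<^bsub>E\<^esub>"
    "block12 Y \<boxtimes> P 2 = block12 Y"
  proof -
    have lt: "i mod l < k * l" "l + i mod l < k * l" "2 * l + i mod l < k * l" for i
      using k index_less[of 0 "i mod l"] index_less[of 1 "i mod l"] index_less[of 2 "i mod l"] by auto
    have 0: "P 0 \<boxtimes> block12 Y \<in> carrier E" "P 1 \<boxtimes> block12 Y \<in> carrier E"
      "P 2 \<boxtimes> block12 Y \<in> carrier E" "block12 Y \<boxtimes> P 2 \<in> carrier E"
      using B by auto
    show "P 0 \<boxtimes> block12 Y = \<zero>\<^bsub>E\<^esub>"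
      by (rule mat_eqI[OF 0(1)]) (use k B lt in \<open>auto simp: sh_mult_entry block12_entry mat_zero_entry\<close>)
    show "P 1 \<boxtimes> block12 Y = block12 Y"
      by (rule mat_eqI[OF 0(2) B]) (use k B Y lt l_pos in \<open>auto simp: sh_mult_entry block12_entry\<close>)
    show "P 2 \<boxtimes> block12 Y = \<zero>\<^bsub>E\<^esub>"
      by (rule mat_eqI[OF 0(3)]) (use k B lt in \<open>auto simp: sh_mult_entry block12_entry mat_zero_entry\<close>)
    show "block12 Y \<boxtimes> P 2 = block12 Y"
      by (rule mat_eqI[OF 0(4) B]) (use k B Y lt in \<open>auto simp: mult_sh_entry block12_entry\<close>)
  qed
  have PV: "P 0 \<boxtimes> V 0 2 = V 0 2" "P 1 \<boxtimes> V 0 2 = \<zero>\<^bsub>E\<^esub>" "P 2 \<boxtimes> V 0 2 = \<zero>\<^bsub>E\<^esub>" "V 0 2 \<boxtimes> P 2 = V 0 2"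
    using k by (auto simp: sh_mult sh_mult_zero)
  show "P 2 \<boxtimes> data_block t Y = \<zero>\<^bsub>E\<^esub>" "data_block t Y \<boxtimes> P 2 = data_block t Y"
    "(P 0 \<boxplus> P 1) \<boxtimes> data_block t Y = data_block t Y"
    "P 0 \<boxtimes> data_block t Y = complex_of_real t \<odot>\<^bsub>E\<^esub> V 0 2"
    unfolding data_block_def using B
    by (simp_all add: M.smult_mult_left M.smult_mult_right M.r_distr M.l_distr PB PV M.a_assoc
        del: One_nat_def)
  assume ij: "i < l" "j < l"
  \<comment> \<open>The factors \<open>0\<close> and \<open>1\<close> give the indices the shape for
    which the block index lemmas are stated.\<close>
  define i' where "i' = 0 * l + i"
  define j' where "j' = 1 * l + j"
  have i': "i' < k * l" "i' div l = 0" "i' mod l = i"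
    unfolding i'_def using ij k by (auto intro: index_less[of 0 i, simplified])
  have j': "j' < k * l" "j' div l = 1" "j' mod l = j"
    unfolding j'_def using ij k index_mod[of j 1] index_div[of j 1] by (auto intro: index_less[of 1 j, simplified])
  have h: "2 * l + i < k * l" using ij k by (intro index_less) auto
  \<comment> \<open>Row \<open>i\<close> of block 0 has its only nonzero entry in column
    \<open>2 * l + i\<close>.\<close>
  have "(data_block t Y \<boxtimes> star E (data_block t Y)) (i', j') =
      (\<Oplus>h\<in>{..<k * l}. if h = 2 * l + i
        then data_block t Y (i', h) \<otimes> star A (data_block t Y (j', h)) else \<zero>)"
    using X ij i' j' Y
    by (auto simp: mat_mult_entry mat_star_entry data_block_entry eq_index_iff intro!: finsum_cong')
  also have "\<dots> = data_block t Y (i', 2 * l + i) \<otimes> star A (data_block t Y (j', 2 * l + i))"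
    using X h i' j' by (intro finsum_delta_if) auto
  also have "\<dots> = complex_of_real (t * t) \<odot> star A (Y j i)"
    using h ij i' j' Y[of j i]
    by (simp add: data_block_entry star_smult smult_mult_left smult_mult_right smult_smult)
  finally show "(data_block t Y \<boxtimes> star E (data_block t Y)) (i, l + j) = complex_of_real (t * t) \<odot> star A (Y j i)"
    by (simp add: i'_def j'_def)
qed

text \<open>The norm of \<open>x\<close> is at most some \<open>n < 1\<close>, so
  \<open>1 - (star x) x\<close> is near the unit and has an invertible square root \<open>Z\<close>.
  It commutes with \<open>P 2\<close> because \<open>(star x) x\<close> lies in the corner of
  \<open>P 2\<close>.\<close>

lemma data_projection:
  assumes k: "3 \<le> k" and Y: "\<And>i j. \<lbrakk>i < l; j < l\<rbrakk> \<Longrightarrow> Y i j \<in> carrier A \<and> cnorm A (Y i j) \<le> C"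
    and C: "1 \<le> C" and t: "0 \<le> t" "real (k * l) * real (k * l) * (t * C) < 1"
  obtains Z p where "Z \<in> Units E" "P 2 \<boxtimes> Z = Z \<boxtimes> P 2"
    "p = (data_block t Y \<boxplus> Z \<boxtimes> P 2) \<boxtimes> (star E (data_block t Y) \<boxplus> Z \<boxtimes> P 2)"
    "cstar_projection E p" "mnrm (p \<boxminus> P 2) \<le> 4 * (real (k * l) * real (k * l) * (t * C))"
proof -
  define x where "x = data_block t Y"
  define n where "n = real (k * l) * real (k * l) * (t * C)"
  have Y': "\<And>i j. \<lbrakk>i < l; j < l\<rbrakk> \<Longrightarrow> Y i j \<in> carrier A" using Y by blast
  have x: "x \<in> carrier E" "P 2 \<boxtimes> x = \<zero>\<^bsub>E\<^esub>" "x \<boxtimes> P 2 = x"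
    unfolding x_def using data_block_closed[OF k Y'] P2_data_block[OF k Y'] data_block_P2[OF k Y'] by auto
  have xn: "mnrm x \<le> n"
    unfolding cnorm_mat n_def
  proof (rule mat_norm_le_entries[OF x(1)])
    fix i j assume ij: "i < k * l" "j < k * l"
    have "cnorm A (x (i, j)) = t * cnorm A (if i div l = 0 \<and> j div l = 2 \<and> i mod l = j mod l then \<one>
        else if i div l = 1 \<and> j div l = 2 then Y (i mod l) (j mod l) else \<zero>)"
      unfolding x_def using ij t Y' by (simp add: data_block_entry cnorm_smult)
    \<comment> \<open>\<open>1 \<le> C\<close> covers the identity entries in block
      \<open>(0, 2)\<close>.\<close>
    also have "\<dots> \<le> t * C"
      using Y C t order_trans[OF cnorm_one_le C] by (intro mult_left_mono) auto
    finally show "cnorm A (x (i, j)) \<le> t * C" .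
  qed
  define D where "D = star E x \<boxtimes> x"
  have D: "D \<in> carrier E" "star E D = D" using x by (auto simp: D_def M.star_mult)
  have x0: "0 \<le> mnrm x" using x by simp
  have "mnrm D = mnrm x * mnrm x" using M.cstar_identity[OF x(1)] by (simp add: D_def power2_eq_square)
  \<comment> \<open>As \<open>mnrm x \<le> 1\<close>, its square is again bounded by
    \<open>n\<close>, so one bound serves both \<open>x\<close> and
    \<open>\<one> \<ominus> Z\<close>.\<close>
  also have "\<dots> \<le> mnrm x * 1" using xn t x0 by (intro mult_left_mono) (auto simp: n_def)
  finally have Dn: "mnrm D \<le> n" using xn by simp
  define a where "a = \<one>\<^bsub>E\<^esub> \<boxminus> D"
  have a: "a \<in> carrier E" "star E a = a" using D by (auto simp: a_def M.star_diff)
  have "\<one>\<^bsub>E\<^esub> \<boxminus> a = D"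
    using D by (simp add: a_def a_minus_def M.minus_add M.r_neg2)
  then have an: "mnrm (\<one>\<^bsub>E\<^esub> \<boxminus> a) \<le> n" "mnrm (\<one>\<^bsub>E\<^esub> \<boxminus> a) < 1" using Dn t by (auto simp: n_def)
  obtain Z where Z: "Z \<in> carrier E" "star E Z = Z" "Z \<boxtimes> Z = a" "mnrm (\<one>\<^bsub>E\<^esub> \<boxminus> Z) \<le> mnrm (\<one>\<^bsub>E\<^esub> \<boxminus> a)"
    "\<And>w. \<lbrakk>w \<in> carrier E; w \<boxtimes> a = a \<boxtimes> w\<rbrakk> \<Longrightarrow> w \<boxtimes> Z = Z \<boxtimes> w"
    using M.sqrt_near_one[OF a an(2)] by metis
  have "D \<boxtimes> P 2 = D" using x by (simp add: D_def M.m_assoc)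
  moreover have "P 2 \<boxtimes> D = D"
    using M.star_mult[OF D(1), of "P 2"] calculation D by simp
  ultimately have "P 2 \<boxtimes> a = a \<boxtimes> P 2"
    using D by (simp add: a_def a_minus_def M.l_distr M.r_distr M.l_minus M.r_minus)
  then have PZ: "P 2 \<boxtimes> Z = Z \<boxtimes> P 2" using Z(5) by simp
  have ZU: "Z \<in> Units E" using Z an by (intro M.Units_near_one) auto
  have P2: "cstar_projection E (P 2)" using k by (intro P_projection) simp
  note pp = M.perturbed_projection[OF P2 x Z(1,2) _ PZ, unfolded D_def[symmetric], OF Z(3)[unfolded a_def]]
  show ?thesis
  proof (rule that[OF ZU PZ refl])
    show "cstar_projection E ((data_block t Y \<boxplus> Z \<boxtimes> P 2) \<boxtimes> (star E (data_block t Y) \<boxplus> Z \<boxtimes> P 2))"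
      using pp(1) by (simp add: x_def)
    have "mnrm ((x \<boxplus> Z \<boxtimes> P 2) \<boxtimes> (star E x \<boxplus> Z \<boxtimes> P 2) \<boxminus> P 2) \<le> 4 * n"
      using le_four_times[OF pp(2) xn order_trans[OF Z(4) an(1)]] .
    then show "mnrm ((data_block t Y \<boxplus> Z \<boxtimes> P 2) \<boxtimes> (star E (data_block t Y) \<boxplus> Z \<boxtimes> P 2) \<boxminus> P 2)
        \<le> 4 * (real (k * l) * real (k * l) * (t * C))"
      by (simp add: x_def n_def)
  qed
qed

end

context unital_cstar_algebra
begin

section \<open>Generation by the perturbed projections\<close>

lemma cstar_subalgebraD:
  assumes "cstar_subalgebra A B"
  shows "x \<in> B \<Longrightarrow> x \<in> carrier A" "\<zero> \<in> B" "\<lbrakk>x \<in> B; y \<in> B\<rbrakk> \<Longrightarrow> x \<oplus> y \<in> B"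
    "\<lbrakk>x \<in> B; y \<in> B\<rbrakk> \<Longrightarrow> x \<otimes> y \<in> B" "x \<in> B \<Longrightarrow> c \<odot> x \<in> B" "x \<in> B \<Longrightarrow> star A x \<in> B"
    "\<lbrakk>range s \<subseteq> B; tends s m\<rbrakk> \<Longrightarrow> m \<in> B"
  using assms unfolding cstar_subalgebra_def closedin_iff_tends by auto

lemma cstar_subalgebra_minus:
  assumes B: "cstar_subalgebra A B" and xy: "x \<in> B" "y \<in> B"
  shows "x \<ominus> y \<in> B"
proof -
  have "x \<oplus> (-1) \<odot> y \<in> B" using xy by (intro cstar_subalgebraD(3,5)[OF B])
  then show ?thesis
    using cstar_subalgebraD(1)[OF B] xy by (simp add: a_minus_def smult_minus_left)
qed

lemma cstar_subalgebra_smult_cancel: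
  assumes B: "cstar_subalgebra A B" and "c \<odot> x \<in> B" "c \<noteq> 0" "x \<in> carrier A"
  shows "x \<in> B"
  using cstar_subalgebraD(5)[OF B assms(2), of "inverse c"] assms(3,4) by (simp add: smult_smult)

lemma cstar_subalgebra_finsum:
  assumes B: "cstar_subalgebra A B" and f: "\<And>i. i \<in> I \<Longrightarrow> f i \<in> B" and fin: "finite I"
  shows "(\<Oplus>i\<in>I. f i) \<in> B"
  using fin f
proof (induction I rule: finite_induct)
  case empty
  then show ?case using cstar_subalgebraD(2)[OF B] by simp
next
  case (insert i I)
  have "f \<in> I \<rightarrow> carrier A" "f i \<in> carrier A"
    using insert.prems cstar_subalgebraD(1)[OF B] by auto
  then show ?case using insert cstar_subalgebraD(3)[OF B] by simp
qed

lemma cstar_generated_subset: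
  "\<lbrakk>cstar_subalgebra A B; S \<subseteq> B\<rbrakk> \<Longrightarrow> cstar_generated A S \<subseteq> B"
  by (auto simp: cstar_generated_def)

end

context block_matrices
begin

lemma mem_of_entries:
  assumes G: "cstar_subalgebra E G" and T: "T \<in> carrier E"
    and mem: "\<And>i j. \<lbrakk>i < k * l; j < k * l\<rbrakk> \<Longrightarrow> U i j (T (i, j)) \<in> G"
  shows "T \<in> G"
proof -
  have "(\<Oplus>\<^bsub>E\<^esub>x\<in>{..<k * l} \<times> {..<k * l}. U (fst x) (snd x) (T x)) \<in> G"
    using mem by (intro M.cstar_subalgebra_finsum[OF G]) auto
  then show ?thesis using mat_eq_finsum_mu[OF T] by simp
qed

text \<open>Lagrange interpolation in a diagonal element with distinct diagonal entries.\<close>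

lemma diagonal_units_mem:
  assumes G: "cstar_subalgebra E G" and k: "0 < k" and one: "P 0 \<in> G" and d: "sh 0 0 d \<in> G"
    and inj: "inj_on d {..<l}" and i: "i < l"
  shows "U i i \<one> \<in> G"
proof -
  note mem = M.cstar_subalgebraD[OF G]
  have factor: "sh 0 0 (\<lambda>m. d m - t) \<in> G" for t
  proof -
    have "sh 0 0 d \<boxminus> complex_of_real t \<odot>\<^bsub>E\<^esub> P 0 \<in> G"
      by (intro M.cstar_subalgebra_minus[OF G] mem(5) d one)
    then show ?thesis by (simp add: sh_smult sh_minus)
  qed
  have prod: "sh 0 0 (\<lambda>m. \<Prod>j\<in>J. (d m - d j)) \<in> G" if "finite J" for J :: "nat set"
    using that
  proof (induction J rule: finite_induct)
    case (insert j J)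
    have "sh 0 0 (\<lambda>m. d m - d j) \<boxtimes> sh 0 0 (\<lambda>m. \<Prod>j\<in>J. (d m - d j)) \<in> G"
      by (intro mem(4) factor insert.IH)
    then show ?case using insert k by (simp add: sh_mult)
  qed (use one in simp)
  define f where "f m = (\<Prod>j\<in>{..<l} - {i}. (d m - d j))" for m
  have f0: "f m = 0" if "m < l" "m \<noteq> i" for m
    unfolding f_def using that by (intro prod_zero) auto
  have fi: "f i \<noteq> 0" unfolding f_def using inj i by (auto simp: inj_on_def)
  have "complex_of_real (1 / f i) \<odot>\<^bsub>E\<^esub> sh 0 0 f \<in> G"
    unfolding f_def by (intro mem(5) prod) auto
  then have "sh 0 0 (\<lambda>m. 1 / f i * f m) \<in> G" by (simp only: sh_smult)
  also have "sh 0 0 (\<lambda>m. 1 / f i * f m) = U i i \<one>"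
  proof (rule mat_eqI)
    fix m n assume "m < k * l" "n < k * l"
    then show "sh 0 0 (\<lambda>m. 1 / f i * f m) (m, n) = U i i \<one> (m, n)"
      using f0[of m] fi i l_pos by (auto simp: sh_entry mu_entry div_eq_0_iff)
  qed auto
  finally show ?thesis .
qed

lemma sh_mult_U:
  assumes "d < k" "i < l" "q < k * l" "a \<in> carrier A"
  shows "sh c d f \<boxtimes> U (d * l + i) q a = (if c < k then U (c * l + i) q (complex_of_real (f i) \<odot> a) else \<zero>\<^bsub>E\<^esub>)"
  by (rule mat_eqI)
    (use assms index_less[OF assms(1)] in
      \<open>auto simp: sh_mult_entry mu_entry mat_zero_entry eq_index_iff scalar_mult_left div_less_k\<close>)

text \<open>\<open>gen\<close> is quantified over all \<open>B\<close> because it will be applied to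
  the set of coefficients that \<open>G\<close> contains in its corner at index 0. Of
  \<open>Z\<close> only invertibility and commutation with \<open>P 2\<close> are available.\<close>

lemma generated_by_projections:
  fixes s :: "nat \<Rightarrow> real" and t :: real
  assumes G: "cstar_subalgebra E G" and k: "3 \<le> k"
    and p0: "P 0 \<in> G"
    and rot: "\<And>b. \<lbrakk>b < k; b \<noteq> 0; b \<noteq> 2\<rbrakk> \<Longrightarrow> rotated s b \<in> G"
    and s: "\<And>i. i < l \<Longrightarrow> 0 < s i \<and> s i < 1" "inj_on s {..<l}"
    and t: "t \<noteq> 0"
    and Y: "\<And>i j. \<lbrakk>i < l; j < l\<rbrakk> \<Longrightarrow> Y i j \<in> carrier A"
    and Y1: "\<And>j. \<lbrakk>1 \<le> j; j < l\<rbrakk> \<Longrightarrow> Y 0 j = \<one>"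
    and gen: "\<And>B. \<lbrakk>cstar_subalgebra A B; \<And>i j. \<lbrakk>i < l; j < l\<rbrakk> \<Longrightarrow> Y i j \<in> B\<rbrakk> \<Longrightarrow> B = carrier A"
    and Z: "Z \<in> Units E" "P 2 \<boxtimes> Z = Z \<boxtimes> P 2"
    and p2: "(data_block t Y \<boxplus> Z \<boxtimes> P 2) \<boxtimes> (star E (data_block t Y) \<boxplus> Z \<boxtimes> P 2) \<in> G"
  shows "G = carrier E"
proof -
  note mem = M.cstar_subalgebraD[OF G]
  have k': "0 < k" "1 < k" "2 < k" using k by auto
  have lt: "i < k * l" "l + i < k * l" "2 * l + i < k * l" if "i < l" for i
    using that index_less[of 0 i] index_less[of 1 i] index_less[of 2 i] k by auto
  have l: "0 < l" by (rule l_pos)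
  have Ustar: "U j i (star A a) \<in> G" if "U i j a \<in> G" "a \<in> carrier A" for i j a
    using mem(6)[OF that(1)] that(2) by (simp add: star_mu)
  have Umult: "U i j (a \<otimes> b) \<in> G"
    if "U i h a \<in> G" "U h j b \<in> G" "a \<in> carrier A" "b \<in> carrier A" "i < k * l" "h < k * l" "j < k * l"
    for i h j a b
    using mem(4)[OF that(1,2)] that(3-) by (simp add: mu_mult)
  have rotP0: "rotated s b \<boxtimes> P 0 = sh 0 0 (\<lambda>i. s i * s i) \<boxplus> sh b 0 (\<lambda>i. cosine s i * s i)"
    "P 0 \<boxtimes> (rotated s b \<boxtimes> P 0) = sh 0 0 (\<lambda>i. s i * s i)"
    if b: "b < k" "b \<noteq> 0" for b
  proof -
    have "(sh b 0 s \<boxplus> sh b b (cosine s)) \<boxtimes> P 0 = sh b 0 s"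
      using b k' by (simp add: M.l_distr sh_mult sh_mult_zero)
    then have "rotated s b \<boxtimes> P 0 = (sh 0 b s \<boxplus> sh b b (cosine s)) \<boxtimes> sh b 0 s"
      unfolding rotated_def by (simp add: M.m_assoc)
    then show 1: "rotated s b \<boxtimes> P 0 = sh 0 0 (\<lambda>i. s i * s i) \<boxplus> sh b 0 (\<lambda>i. cosine s i * s i)"
      using b k' by (simp add: M.l_distr sh_mult)
    show "P 0 \<boxtimes> (rotated s b \<boxtimes> P 0) = sh 0 0 (\<lambda>i. s i * s i)"
      unfolding 1 using b k' by (simp add: M.r_distr sh_mult sh_mult_zero)
  qed
  \<comment> \<open>Block 1 supplies the diagonal element; it is among the rotated ones since
    \<open>1 < k\<close> and \<open>1 \<noteq> 2\<close>.\<close>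
  have D: "sh 0 0 (\<lambda>i. s i * s i) \<in> G"
    using mem(4)[OF p0 mem(4)[OF rot[of 1] p0]] rotP0(2)[of 1] k' by simp
  have inj: "inj_on (\<lambda>i. s i * s i) {..<l}"
  proof (rule inj_onI)
    fix i j assume ij: "i \<in> {..<l}" "j \<in> {..<l}" "s i * s i = s j * s j"
    then have "(s i)\<^sup>2 = (s j)\<^sup>2" "0 \<le> s i" "0 \<le> s j" using s(1) by (auto simp: power2_eq_square less_imp_le)
    then have "s i = s j" by simp
    then show "i = j" using s(2) ij by (auto dest: inj_onD)
  qed
  have U0: "U i i \<one> \<in> G" if "i < l" for i
    by (rule diagonal_units_mem[OF G k'(1) p0 D inj that])
  have Ub: "U (b * l + i) i \<one> \<in> G" if b: "b < k" "b \<noteq> 0" "b \<noteq> 2" and i: "i < l" for b i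
  proof -
    have "rotated s b \<boxtimes> P 0 \<boxminus> sh 0 0 (\<lambda>i. s i * s i) \<in> G"
      by (intro M.cstar_subalgebra_minus[OF G] mem(4) rot D p0 b)
    also have "rotated s b \<boxtimes> P 0 \<boxminus> sh 0 0 (\<lambda>i. s i * s i) = sh b 0 (\<lambda>i. cosine s i * s i)"
      unfolding rotP0(1)[OF b(1,2)]
      by (simp add: a_minus_def M.a_comm[of "sh 0 0 (\<lambda>i. s i * s i)"] M.a_assoc M.r_neg)
    finally have "sh b 0 (\<lambda>i. cosine s i * s i) \<boxtimes> U (0 * l + i) i \<one> \<in> G"
      using U0[OF i] by (intro mem(4)) simp_all
    moreover define r where "r = cosine s i * s i"
    ultimately have "U (b * l + i) i (complex_of_real r \<odot> \<one>) \<in> G"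
      using sh_mult_U[OF k'(1) i lt(1)[OF i] one_closed, of b] b by simp
    then have rG: "complex_of_real r \<odot>\<^bsub>E\<^esub> U (b * l + i) i \<one> \<in> G"
      by (simp add: mu_smult)
    have "(s i)\<^sup>2 < 1" using s(1)[OF i] by (simp add: abs_square_less_1)
    \<comment> \<open>Sine and cosine are both nonzero, as \<open>0 < s i < 1\<close>.\<close>
    then have "complex_of_real r \<noteq> 0" using s(1)[OF i] by (simp add: cosine_def r_def)
    then show ?thesis using M.cstar_subalgebra_smult_cancel[OF G rG] by simp
  qed
  have U1: "U (l + i) i \<one> \<in> G" "U i (l + i) \<one> \<in> G" "U (l + i) (l + i) \<one> \<in> G" if i: "i < l" for i
  proof -
    show 1: "U (l + i) i \<one> \<in> G" using Ub[of 1 i] i k' by simp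
    show 2: "U i (l + i) \<one> \<in> G" using Ustar[OF 1] by simp
    show "U (l + i) (l + i) \<one> \<in> G" using Umult[OF 1 2] lt[OF i] by simp
  qed
  define Xd where "Xd = data_block t Y"
  define Q where "Q = (Xd \<boxplus> Z \<boxtimes> P 2) \<boxtimes> (star E Xd \<boxplus> Z \<boxtimes> P 2)"
  have Zc: "Z \<in> carrier E" using Z by auto
  have Xd: "Xd \<in> carrier E" "P 2 \<boxtimes> Xd = \<zero>\<^bsub>E\<^esub>" "(P 0 \<boxplus> P 1) \<boxtimes> Xd = Xd"
    "P 0 \<boxtimes> Xd = complex_of_real t \<odot>\<^bsub>E\<^esub> V 0 2"
    unfolding Xd_def using data_block_closed[OF k Y] P2_data_block[OF k Y] P01_data_block[OF k Y]
      P0_data_block[OF k Y] by auto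
  have QG: "Q \<in> G" using p2 by (simp add: Q_def Xd_def)
  have Qc: "Q \<in> carrier E" using Xd(1) Zc by (simp add: Q_def)
  have ZPZ: "(Z \<boxtimes> P 2) \<boxtimes> W = P 2 \<boxtimes> (Z \<boxtimes> W)" if "W \<in> carrier E" for W
    using Z(2) Zc that by (simp add: M.m_assoc[symmetric])
  have Qentry: "Q (i, l + j) = complex_of_real (t * t) \<odot> star A (Y j i)" if ij: "i < l" "j < l" for i j
  proof -
    have "Xd \<boxtimes> (Z \<boxtimes> P 2) = Xd \<boxtimes> P 2 \<boxtimes> Z" using Z(2) Zc Xd by (simp add: M.m_assoc)
    \<comment> \<open>Both terms with \<open>Z\<close> vanish: on the right
      \<open>P 2 \<boxtimes> P 1\<close> is zero, and on the left \<open>Z\<close> moves past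
      \<open>P 2\<close> to expose \<open>P 0 \<boxtimes> P 2\<close>.\<close>
    have PQ: "P 0 \<boxtimes> (Q \<boxtimes> P 1) = P 0 \<boxtimes> ((Xd \<boxtimes> star E Xd) \<boxtimes> P 1)"
    proof -
      have "(Z \<boxtimes> P 2) \<boxtimes> P 1 = \<zero>\<^bsub>E\<^esub>"
        using Zc P_orthogonal[OF k'(3), of 1] by (simp add: M.m_assoc)
      then have "(star E Xd \<boxplus> Z \<boxtimes> P 2) \<boxtimes> P 1 = star E Xd \<boxtimes> P 1"
        using Xd(1) Zc by (simp add: M.l_distr)
      then have "Q \<boxtimes> P 1 = (Xd \<boxplus> Z \<boxtimes> P 2) \<boxtimes> (star E Xd \<boxtimes> P 1)"
        using Xd(1) Zc by (simp add: Q_def M.m_assoc)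
      moreover have "P 0 \<boxtimes> ((Z \<boxtimes> P 2) \<boxtimes> W) = \<zero>\<^bsub>E\<^esub>" if "W \<in> carrier E" for W
        unfolding ZPZ[OF that] using Zc that P_orthogonal[OF k'(1), of 2]
        by (simp add: M.m_assoc[symmetric])
      ultimately show ?thesis using Xd(1) Zc by (simp add: M.l_distr M.r_distr M.m_assoc)
    qed
    have div1: "(l + j) div l = 1" "(l + j) mod l = j" using ij l by (auto simp: div_add_self1)
    have "(P 0 \<boxtimes> (T \<boxtimes> P 1)) (i, l + j) = T (i, l + j)" if T: "T \<in> carrier E" for T
      using T ij lt[of i] lt[of j] k' div1 by (simp add: sh_mult_entry mult_sh_entry)
    from this[OF Qc] this[of "Xd \<boxtimes> star E Xd"] have "Q (i, l + j) = (Xd \<boxtimes> star E Xd) (i, l + j)"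
      using PQ Xd(1) by simp
    then show ?thesis unfolding Xd_def using data_block_star_entry[OF k Y ij] by simp
  qed
  have UY: "U i (l + j) (star A (Y j i)) \<in> G" if ij: "i < l" "j < l" for i j
  proof -
    have "U i i \<one> \<boxtimes> Q \<boxtimes> U (l + j) (l + j) \<one> \<in> G"
      by (intro mem(4) U0 U1 QG ij)
    then have "U i (l + j) (complex_of_real (t * t) \<odot> star A (Y j i)) \<in> G"
      using mu_compress[OF Qc lt(1)[OF ij(1)] lt(2)[OF ij(2)]] by (simp add: Qentry[OF ij])
    then have "complex_of_real (t * t) \<odot>\<^bsub>E\<^esub> U i (l + j) (star A (Y j i)) \<in> G"
      using Y[OF ij(2,1)] by (simp add: mu_smult)
    then show ?thesis
      using t Y[OF ij(2,1)] M.cstar_subalgebra_smult_cancel[OF G, of "complex_of_real (t * t)"] by auto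
  qed
  \<comment> \<open>The indices already connected to index 0. Matrix units between members of
    \<open>R\<close> lie in \<open>G\<close>, and the aim is that \<open>R\<close> contains every
    index.\<close>
  define R where "R = {q. q < k * l \<and> U q 0 \<one> \<in> G}"
  have col: "U q j \<one> \<in> G" if "q \<in> R" "j \<in> R" for q j
    using Umult[OF _ Ustar[of j 0 \<one>], of q \<one>] that l lt[of 0] by (auto simp: R_def)
  \<comment> \<open>The entries \<open>Y 0 i = \<one>\<close> give units from index \<open>i\<close>
    to \<open>l\<close>, the first index of block 1, and that index is connected to 0. For
    \<open>i = 0\<close> the unit from 0 to \<open>l\<close> comes from block 1 itself.\<close>
  have R0: "i \<in> R" if i: "i < l" for i
  proof -
    have "U i l \<one> \<in> G"
    proof (cases "i = 0")
      case True
      then show ?thesis using U1(2)[OF l] by simp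
    next
      case False
      then show ?thesis using UY[OF i l] Y1[of i] i by simp
    qed
    moreover have "U l 0 \<one> \<in> G" using U1(1)[OF l] by simp
    ultimately have "U i 0 \<one> \<in> G" using Umult[of i l \<one> 0 \<one>] lt[OF i] lt[OF l] by simp
    then show ?thesis using lt[OF i] by (simp add: R_def)
  qed
  have Rb: "b * l + i \<in> R" if b: "b < k" "b \<noteq> 2" and i: "i < l" for b i
  proof (cases "b = 0")
    case False
    have "U (b * l + i) 0 (\<one> \<otimes> \<one>) \<in> G"
      using R0[OF i] lt[OF i] lt[OF l] index_less[OF b(1) i]
      by (intro Umult[of _ i] Ub b False i) (auto simp: R_def)
    then show ?thesis using index_less[OF b(1) i] by (simp add: R_def)
  qed (use R0 i in simp)
  \<comment> \<open>The corner of \<open>G\<close> at index 0, pulled back to \<open>A\<close>: a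
    C*-subalgebra that contains all \<open>Y i j\<close> and hence is everything.\<close>
  define B where "B = {a \<in> carrier A. U 0 0 a \<in> G}"
  have zero_lt: "0 < k * l" using lt[OF l] by simp
  have "cstar_subalgebra A B"
    unfolding cstar_subalgebra_def closedin_iff_tends
  proof (intro conjI ballI allI impI)
    show "\<zero> \<in> B" using mem(2) by (simp add: B_def mu_zero)
    show "x \<oplus> y \<in> B" if "x \<in> B" "y \<in> B" for x y
      using that mem(3)[of "U 0 0 x" "U 0 0 y"] by (simp add: B_def mu_add)
    show "x \<otimes> y \<in> B" if "x \<in> B" "y \<in> B" for x y
      using that Umult[of 0 0 x 0 y] zero_lt by (simp add: B_def)
    show "c \<odot> x \<in> B" if "x \<in> B" for x c
      using that mem(5)[of "U 0 0 x" c] by (simp add: B_def mu_smult)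
    show "star A x \<in> B" if "x \<in> B" for x
      using that Ustar[of 0 0 x] by (simp add: B_def)
    fix f m assume f: "range f \<subseteq> B \<and> tends f m"
    then have c: "f n \<in> carrier A" "m \<in> carrier A" and fG: "U 0 0 (f n) \<in> G" for n
      by (auto simp: B_def tends_def)
    have "M.tends (\<lambda>n. U 0 0 (f n)) (U 0 0 m)"
    proof (rule M.tends_squeeze)
      show "mnrm (U 0 0 (f n) \<boxminus> U 0 0 m) \<le> cnorm A (f n \<ominus> m)" for n
        using c by (simp add: mu_minus cnorm_mat mat_norm_mu_le)
      show "(\<lambda>n. cnorm A (f n \<ominus> m)) \<longlonglongrightarrow> 0" using f by (simp add: tends_def)
    qed (use c in auto)
    then have "U 0 0 m \<in> G" using fG by (intro mem(7)) auto
    then show "m \<in> B" using c by (simp add: B_def)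
  qed (auto simp: B_def)
  moreover have "Y i j \<in> B" if ij: "i < l" "j < l" for i j
  proof -
    have "U 0 j \<one> \<in> G" "U (l + i) 0 \<one> \<in> G"
      using col[OF R0[OF l] R0[OF ij(2)]] Rb[of 1 i] k' ij by (auto simp: R_def)
    \<comment> \<open>The path through the indices \<open>0\<close>, \<open>j\<close>,
      \<open>l + i\<close>, \<open>0\<close>, whose middle step carries the star of
      \<open>Y i j\<close>.\<close>
    then have "U 0 0 (\<one> \<otimes> star A (Y i j) \<otimes> \<one>) \<in> G"
      using UY[OF ij(2,1)] Y[OF ij] lt[OF l] lt[OF ij(1)] lt[OF ij(2)]
      by (intro Umult[of 0 "l + i"] Umult[of 0 j]) auto
    then have "U 0 0 (star A (Y i j)) \<in> G" using Y[OF ij] by simp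
    then show ?thesis using Ustar[of 0 0 "star A (Y i j)"] Y[OF ij] by (simp add: B_def)
  qed
  ultimately have "B = carrier A" by (rule gen)
  then have U00: "U 0 0 a \<in> G" if "a \<in> carrier A" for a using that by (auto simp: B_def)
  have full: "U i j a \<in> G" if "i \<in> R" "j \<in> R" "a \<in> carrier A" for i j a
  proof -
    have ij: "i < k * l" "j < k * l" "U i 0 \<one> \<in> G" "U 0 j \<one> \<in> G"
      using that Ustar[of j 0 \<one>] by (auto simp: R_def)
    have "U i j (\<one> \<otimes> a \<otimes> \<one>) \<in> G"
      using ij U00[OF that(3)] that(3) zero_lt by (intro Umult[of i 0] ) auto
    then show ?thesis using that(3) by simp
  qed
  \<comment> \<open>Block 2 is still missing and is reached only by
    \<open>Z \<boxtimes> V 2 0\<close>. The inverse of \<open>Z\<close>, compressed to block 2 and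
    moved to block 0, lies in the part already generated.\<close>
  define W where "W = inv\<^bsub>E\<^esub> Z"
  have W: "W \<in> carrier E" "Z \<boxtimes> W = \<one>\<^bsub>E\<^esub>" using Z(1) by (auto simp: W_def)
  define C where "C = V 0 2 \<boxtimes> W \<boxtimes> V 2 0"
  have Cc: "C \<in> carrier E" using W by (simp add: C_def)
  have "C \<in> G"
  proof (rule mem_of_entries[OF G Cc])
    fix i j assume ij: "i < k * l" "j < k * l"
    show "U i j (C (i, j)) \<in> G"
    proof (cases "i div l = 0 \<and> j div l = 0")
      case True
      then have "i < l" "j < l" using l by (auto simp: div_eq_0_iff)
      then show ?thesis using Cc ij by (intro full R0) auto
    next
      case False
      have "C (i, j) = \<zero>"
        unfolding C_def using False W(1) ij k' index_less[OF k'(3)]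
        by (auto simp: mult_sh_entry sh_mult_entry)
      then show ?thesis using mem(2) by (simp add: mu_zero)
    qed
  qed
  \<comment> \<open>Multiplication by \<open>P01\<close> fixes \<open>Xd\<close> and kills the block
    2 part, so removing \<open>P01 \<boxtimes> (Q \<boxtimes> P 0)\<close> from
    \<open>Q \<boxtimes> P 0\<close> isolates the term with \<open>Z\<close>.\<close>
  define P01 where "P01 = P 0 \<boxplus> P 1"
  have P01: "P01 \<in> carrier E" by (simp add: P01_def)
  have P01G: "P01 \<in> G"
  proof (rule mem_of_entries[OF G P01])
    fix i j assume ij: "i < k * l" "j < k * l"
    show "U i j (P01 (i, j)) \<in> G"
    proof (cases "i div l < 2 \<and> j div l < 2")
      case True
      then have "i \<in> R" "j \<in> R"
        using Rb[of "i div l" "i mod l"] Rb[of "j div l" "j mod l"] k' by auto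
      then show ?thesis using P01 ij by (intro full) auto
    next
      case False
      then have "P01 (i, j) = \<zero>" unfolding P01_def using ij by (auto simp: mat_add_entry sh_entry)
      then show ?thesis using mem(2) by (simp add: mu_zero)
    qed
  qed
  define T where "T = Q \<boxtimes> P 0 \<boxminus> P01 \<boxtimes> (Q \<boxtimes> P 0)"
  have TG: "T \<in> G" unfolding T_def by (intro M.cstar_subalgebra_minus[OF G] mem(4) P01G QG p0)
  have "star E Xd \<boxtimes> P 0 = star E (P 0 \<boxtimes> Xd)" using Xd(1) by (simp add: M.star_mult)
  then have XP: "star E Xd \<boxtimes> P 0 = complex_of_real t \<odot>\<^bsub>E\<^esub> V 2 0" unfolding Xd(4) by (simp add: M.star_smult)
  have "(Z \<boxtimes> P 2) \<boxtimes> P 0 = \<zero>\<^bsub>E\<^esub>"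
    using Zc P_orthogonal[OF k'(3), of 0] by (simp add: M.m_assoc)
  then have "Q \<boxtimes> P 0 = (Xd \<boxplus> Z \<boxtimes> P 2) \<boxtimes> (complex_of_real t \<odot>\<^bsub>E\<^esub> V 2 0)"
    using Xd(1) Zc by (simp add: Q_def M.m_assoc M.l_distr XP)
  also have "\<dots> = complex_of_real t \<odot>\<^bsub>E\<^esub> (Xd \<boxtimes> V 2 0 \<boxplus> Z \<boxtimes> V 2 0)"
    using Xd(1) Zc k' by (simp add: M.smult_mult_right M.l_distr M.m_assoc V_mult)
  finally have QP: "Q \<boxtimes> P 0 = complex_of_real t \<odot>\<^bsub>E\<^esub> (Xd \<boxtimes> V 2 0 \<boxplus> Z \<boxtimes> V 2 0)" .
  have "Z \<boxtimes> V 2 0 = P 2 \<boxtimes> Z \<boxtimes> V 2 0" unfolding Z(2) using Zc k' by (simp add: M.m_assoc V_mult)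
  moreover have "P01 \<boxtimes> P 2 = \<zero>\<^bsub>E\<^esub>"
    unfolding P01_def using P_orthogonal[OF k'(1), of 2] P_orthogonal[OF k'(2), of 2] by (simp add: M.l_distr)
  ultimately have PZ: "P01 \<boxtimes> (Z \<boxtimes> V 2 0) = \<zero>\<^bsub>E\<^esub>"
    using P01 Zc by (metis M.l_null M.m_assoc M.m_closed sh_closed)
  have PX: "P01 \<boxtimes> (Xd \<boxtimes> V 2 0) = Xd \<boxtimes> V 2 0"
    using Xd(1,3) P01 by (simp add: P01_def M.m_assoc[symmetric])
  have "T = complex_of_real t \<odot>\<^bsub>E\<^esub> (Z \<boxtimes> V 2 0)"
    unfolding T_def QP using P01 Xd(1) Zc
    by (simp add: M.smult_mult_right M.r_distr PZ PX M.smult_diff_right[symmetric])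
      (simp add: a_minus_def M.a_comm[of "Xd \<boxtimes> V 2 0"] M.a_assoc M.r_neg)
  then have "complex_of_real t \<odot>\<^bsub>E\<^esub> (Z \<boxtimes> V 2 0) \<in> G" using TG by simp
  then have "Z \<boxtimes> V 2 0 \<in> G"
    using t Zc M.cstar_subalgebra_smult_cancel[OF G, of "complex_of_real t" "Z \<boxtimes> V 2 0"] by simp
  then have "Z \<boxtimes> V 2 0 \<boxtimes> C \<in> G" using \<open>C \<in> G\<close> by (rule mem(4))
  also have "Z \<boxtimes> V 2 0 \<boxtimes> C = (Z \<boxtimes> P 2) \<boxtimes> W \<boxtimes> V 2 0"
    unfolding C_def using Zc W(1) V_mult[OF k'(1), of 2 2] by (simp add: M.m_assoc) (simp add: M.m_assoc[symmetric])
  also have "\<dots> = V 2 0"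
    unfolding ZPZ[OF W(1)] W(2) using k' by (simp add: V_mult)
  finally have V20: "V 2 0 \<in> G" .
  have R: "q \<in> R" if q: "q < k * l" for q
  proof (cases "q div l = 2")
    case False
    then show ?thesis using Rb[of "q div l" "q mod l"] div_less_k[OF q] by simp
  next
    case True
    define i where "i = q mod l"
    have i: "i < l" "q = 2 * l + i" using True div_mult_mod_eq[of q l] by (auto simp: i_def)
    have "V 2 0 \<boxtimes> U (0 * l + i) 0 \<one> \<in> G" using R0[OF i(1)] V20 by (intro mem(4)) (auto simp: R_def)
    then have "U (2 * l + i) 0 \<one> \<in> G"
      using sh_mult_U[OF k'(1) i(1) zero_lt one_closed, of 2 "\<lambda>_. 1"] k' by simp
    then show ?thesis using q i by (simp add: R_def)
  qed
  have "S \<in> G" if S: "S \<in> carrier E" for S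
    by (rule mem_of_entries[OF G S], rule full[OF R R]) (use S in auto)
  then show ?thesis using mem(1) by blast
qed

end

context unital_cstar_algebra
begin

text \<open>Reserving the \<open>l - 1\<close> entries \<open>Y 0 j\<close>, \<open>j \<ge> 1\<close>, leaves \<open>l\<^sup>2 - l + 1\<close> entries, each of which
  stores two self-adjoint generators as \<open>a + i b\<close>; this suffices since
  \<open>2 (l\<^sup>2 - l + 1) - (l\<^sup>2 + 1) = (l - 1)\<^sup>2\<close>.\<close>

lemma store_generators:
  assumes a: "\<And>m. m < n \<Longrightarrow> self_adjoint A (a m)" and l: "1 \<le> l" and n: "n \<le> l * l + 1"
  obtains Y :: "nat \<Rightarrow> nat \<Rightarrow> 'a"
  where "\<And>i j. \<lbrakk>i < l; j < l\<rbrakk> \<Longrightarrow> Y i j \<in> carrier A"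
    and "\<And>j. \<lbrakk>1 \<le> j; j < l\<rbrakk> \<Longrightarrow> Y 0 j = \<one>"
    and "\<And>B m. \<lbrakk>cstar_subalgebra A B; \<And>i j. \<lbrakk>i < l; j < l\<rbrakk> \<Longrightarrow> Y i j \<in> B; m < n\<rbrakk> \<Longrightarrow> a m \<in> B"
proof -
  define S where "S = ({..<l} \<times> {..<l} - {0} \<times> {1..<l} :: (nat \<times> nat) set)"
  have "card S = l * l - (l - 1)"
    unfolding S_def using l by (subst card_Diff_subset) (auto simp: card_cartesian_product)
  moreover have "n \<le> 2 * (l * l - (l - 1))"
  proof -
    obtain d where "l = Suc d" using l by (cases l) auto
    then show ?thesis using n by (simp add: algebra_simps)
  qed
  ultimately have N: "n \<le> 2 * card S" by simp
  have "finite S" by (simp add: S_def)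
  then obtain g where g: "bij_betw g S {0..<card S}" using ex_bij_betw_finite_nat by blast
  \<comment> \<open>Padding with \<open>\<zero>\<close>, so that every position of \<open>S\<close>
    holds two elements whatever \<open>n\<close> is.\<close>
  define b where "b m = (if m < n then a m else \<zero>)" for m
  have b: "b m \<in> carrier A" "star A (b m) = b m" for m
    using a by (auto simp: b_def self_adjoint_def)
  define Y where "Y i j = (if (i, j) \<in> S then b (2 * g (i, j)) \<oplus> \<i> \<odot> b (2 * g (i, j) + 1) else \<one>)" for i j
  have Yc: "Y i j \<in> carrier A" for i j using b by (auto simp: Y_def)
  show ?thesis
  proof (rule that[of Y])
    show "Y 0 j = \<one>" if "1 \<le> j" "j < l" for j using that by (simp add: Y_def S_def)
    fix B m assume B: "cstar_subalgebra A B" and YB: "\<And>i j. \<lbrakk>i < l; j < l\<rbrakk> \<Longrightarrow> Y i j \<in> B" and m: "m < n"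
    have "m div 2 \<in> {0..<card S}" using m N by auto
    then obtain i j where ij: "(i, j) \<in> S" "g (i, j) = m div 2"
      using g unfolding bij_betw_def by (metis imageE surj_pair)
    define p where "p = b (2 * (m div 2))"
    define q where "q = b (2 * (m div 2) + 1)"
    have pq: "p \<in> carrier A" "star A p = p" "q \<in> carrier A" "star A q = q" using b by (auto simp: p_def q_def)
    have y: "Y i j = p \<oplus> \<i> \<odot> q" using ij by (simp add: Y_def p_def q_def)
    have ys: "star A (Y i j) = p \<ominus> \<i> \<odot> q"
      unfolding y using pq by (simp add: star_add star_smult smult_minus_left a_minus_def)
    have "i < l" "j < l" using ij by (auto simp: S_def)
    then have mem: "Y i j \<in> B" "star A (Y i j) \<in> B"
      using YB cstar_subalgebraD(6)[OF B] by auto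
    have iq: "\<i> \<odot> q \<in> carrier A" using pq by simp
    have "Y i j \<oplus> star A (Y i j) = p \<oplus> p"
      unfolding ys unfolding y using pq(1) iq by algebra
    then have "2 \<odot> p \<in> B" using cstar_subalgebraD(3)[OF B mem] pq by (simp add: add_self)
    then have pB: "p \<in> B" using cstar_subalgebra_smult_cancel[OF B] pq by auto
    have "Y i j \<ominus> star A (Y i j) = \<i> \<odot> q \<oplus> \<i> \<odot> q"
      unfolding ys unfolding y using pq(1) iq by algebra
    then have "(2 * \<i>) \<odot> q \<in> B"
      using cstar_subalgebra_minus[OF B mem] pq by (simp add: add_self smult_smult)
    then have qB: "q \<in> B" using cstar_subalgebra_smult_cancel[OF B] pq by auto
    have "b m = p \<or> b m = q" unfolding p_def q_def by (metis mult_div_mod_eq add.right_neutral mod2_eq_if)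
    then show "a m \<in> B" using pB qB m by (auto simp: b_def)
  qed (use Yc in auto)
qed

end

section \<open>Choice of the parameters\<close>

lemma (in block_matrices) generated_by_almost_orthogonal:
  assumes k: "3 \<le> k" and gen: "generated_by_self_adjoints A n" and n: "n \<le> l * l + 1"
  shows "generated_by_almost_orthogonal_projections E k"
  unfolding generated_by_almost_orthogonal_projections_def
proof (intro conjI allI impI)
  show "2 \<le> k" using k by simp
  obtain a where a: "\<And>m. m < n \<Longrightarrow> self_adjoint A (a m)" and gen: "cstar_generated A (a ` {..<n}) = carrier A"
    using gen unfolding generated_by_self_adjoints_def by blast
  obtain Y where Y: "\<And>i j. \<lbrakk>i < l; j < l\<rbrakk> \<Longrightarrow> Y i j \<in> carrier A"
    and Y1: "\<And>j. \<lbrakk>1 \<le> j; j < l\<rbrakk> \<Longrightarrow> Y 0 j = \<one>"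
    and Ya: "\<And>B m. \<lbrakk>cstar_subalgebra A B; \<And>i j. \<lbrakk>i < l; j < l\<rbrakk> \<Longrightarrow> Y i j \<in> B; m < n\<rbrakk> \<Longrightarrow> a m \<in> B"
    using store_generators[of n a l] a l_pos n by (metis One_nat_def Suc_leI)
  have Ygen: "B = carrier A" if "cstar_subalgebra A B" "\<And>i j. \<lbrakk>i < l; j < l\<rbrakk> \<Longrightarrow> Y i j \<in> B" for B
    using cstar_generated_subset[OF that(1), of "a ` {..<n}"] Ya[OF that] gen cstar_subalgebraD(1)[OF that(1)]
    by blast
  \<comment> \<open>The summand 1 ensures \<open>1 \<le> C\<close>, so that \<open>C\<close> bounds
    the identity entries of the data block as well as those of \<open>Y\<close>.\<close>
  define C where "C = 1 + (\<Sum>i<l. \<Sum>j<l. cnorm A (Y i j))"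
  have C1: "1 \<le> C" unfolding C_def using Y by (auto intro!: sum_nonneg)
  have YC: "cnorm A (Y i j) \<le> C" if ij: "i < l" "j < l" for i j
  proof -
    have "cnorm A (Y i j) \<le> (\<Sum>j<l. cnorm A (Y i j))"
      using Y ij by (intro member_le_sum) auto
    also have "\<dots> \<le> (\<Sum>i<l. \<Sum>j<l. cnorm A (Y i j))"
      using Y ij by (intro member_le_sum[of i _ "\<lambda>i. \<Sum>j<l. cnorm A (Y i j)"]) (auto intro!: sum_nonneg)
    finally show ?thesis by (simp add: C_def)
  qed
  fix \<epsilon> :: real assume \<epsilon>: "0 < \<epsilon>"
  \<comment> \<open>\<open>\<epsilon> / 4\<close> makes the products, bounded by
    \<open>2 * d\<close>, smaller than \<open>\<epsilon>\<close>; \<open>1 / (2 * real k)\<close>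
    keeps the sum of the projections invertible.\<close>
  define d where "d = min (\<epsilon> / 4) (1 / (2 * real k))"
  have d: "0 < d" "2 * d < \<epsilon>" "real k * d < 1"
  proof -
    show d0: "0 < d" using \<epsilon> k by (simp add: d_def)
    have "d \<le> \<epsilon> / 4" by (simp add: d_def)
    then show "2 * d < \<epsilon>" using \<epsilon> by simp
    have "real k * d \<le> real k * (1 / (2 * real k))" by (intro mult_left_mono) (auto simp: d_def)
    then show "real k * d < 1" using k by simp
  qed
  have d1: "d < 1"
  proof -
    have "1 * d \<le> real k * d" using k d by (intro mult_right_mono) auto
    then show ?thesis using d(3) unfolding mult_1 by (rule order_le_less_trans)
  qed
  \<comment> \<open>The number of entries, which is the loss in estimating the operator norm
    entrywise.\<close>
  define K where "K = real (k * l) * real (k * l)"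
  have K: "1 \<le> K"
  proof -
    have "1 \<le> real (k * l)" using k l_pos by (metis One_nat_def Suc_leI mult_pos_pos of_nat_1 of_nat_le_iff order_less_le_trans zero_less_numeral)
    then show ?thesis unfolding K_def using mult_mono[of 1 "real (k * l)" 1 "real (k * l)"] by simp
  qed
  \<comment> \<open>Chosen so that the distance bound of \<open>data_projection\<close> is exactly
    \<open>d\<close>.\<close>
  define t where "t = d / (4 * K * C)"
  have t0: "0 < t" using d K C1 by (simp add: t_def)
  have KtC: "4 * (K * (t * C)) = d" using K C1 by (simp add: t_def field_simps)
  then have KtC1: "K * (t * C) < 1" using d1 d by simp
  have Kt: "4 * (K * t) \<le> d"
  proof -
    have "K * (t * 1) \<le> K * (t * C)" using K t0 C1 by (intro mult_left_mono) auto
    then show ?thesis using KtC by simp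
  qed
  have t1: "t < 1"
  proof -
    have "t \<le> K * t" "K * t \<le> 4 * (K * t)" using K t0 by simp_all
    then show ?thesis using Kt d1 by (meson order_trans order_le_less_trans)
  qed
  \<comment> \<open>Distinct positive values for the interpolation, none exceeding
    \<open>t\<close>.\<close>
  define s where "s i = t / (real i + 1)" for i :: nat
  have s: "0 < s i" "s i \<le> t" for i using t0 by (auto simp: s_def field_simps)
  have s1: "s i < 1" for i using s(2)[of i] t1 by linarith
  have sabs: "\<bar>s i\<bar> \<le> t" for i using s[of i] by simp
  have s_inj: "inj_on s {..<l}" using t0 by (auto simp: inj_on_def s_def)
  obtain Z q where Z: "Z \<in> Units E" "P 2 \<boxtimes> Z = Z \<boxtimes> P 2"
    and q: "q = (data_block t Y \<boxplus> Z \<boxtimes> P 2) \<boxtimes> (star E (data_block t Y) \<boxplus> Z \<boxtimes> P 2)"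
      "cstar_projection E q" "mnrm (q \<boxminus> P 2) \<le> 4 * (K * (t * C))"
    using data_projection[OF k, of Y C t] Y YC C1 t0 KtC1 unfolding K_def by (metis less_imp_le)
  define p where "p b = (if b = 0 then P 0 else if b = 2 then q else rotated s b)" for b
  have p: "cstar_projection E (p b)" "mnrm (p b \<boxminus> P b) \<le> d" if b: "b < k" for b
  proof -
    show "cstar_projection E (p b)"
      using b k q(2) P_projection[of 0] rotated_projection(1)[OF b _ sabs] t0 t1 by (simp add: p_def)
    have "mnrm (rotated s b \<boxminus> P b) \<le> d" if "b \<noteq> 0"
      using rotated_projection(2)[OF b that sabs] t0 t1
      by (intro order_trans[OF _ Kt]) (simp only: K_def less_imp_le)
    then show "mnrm (p b \<boxminus> P b) \<le> d"
      using q(3) KtC d(1) by (auto simp: p_def)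
  qed
  note near = near_block_projections[of p d, OF p less_imp_le[OF d(1)] d(3)]
  have Ggen: "cstar_generated E (p ` {..<k}) = carrier E"
  proof
    have "cstar_subalgebra E (carrier E)"
      unfolding cstar_subalgebra_def M.closedin_iff_tends by (auto simp: M.tends_def)
    moreover have "p ` {..<k} \<subseteq> carrier E" using p(1) M.cstar_projectionD(1) by blast
    ultimately show "cstar_generated E (p ` {..<k}) \<subseteq> carrier E"
      by (rule M.cstar_generated_subset)
    \<comment> \<open>The generated algebra is an intersection, so it is enough that every member is
      the whole carrier.\<close>
    have "G = carrier E" if G: "cstar_subalgebra E G" "p ` {..<k} \<subseteq> G" for G
    proof (rule generated_by_projections[OF G(1) k])
      have pG: "p b \<in> G" if "b < k" for b using G(2) that by auto
      show "P 0 \<in> G" using pG[of 0] k by (simp add: p_def)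
      show "rotated s b \<in> G" if "b < k" "b \<noteq> 0" "b \<noteq> 2" for b using pG[of b] that by (simp add: p_def)
      show "(data_block t Y \<boxplus> Z \<boxtimes> P 2) \<boxtimes> (star E (data_block t Y) \<boxplus> Z \<boxtimes> P 2) \<in> G"
        using pG[of 2] k q(1) by (simp add: p_def)
      show "t \<noteq> 0" using t0 by simp
    qed (use s s1 s_inj Y Y1 Ygen Z in auto)
    then show "carrier E \<subseteq> cstar_generated E (p ` {..<k})" by (auto simp: cstar_generated_def)
  qed
  show "\<exists>p. (\<forall>i<k. cstar_projection E (p i)) \<and> (\<Oplus>\<^bsub>E\<^esub>i\<in>{..<k}. p i) \<in> Units E \<and>
      cstar_generated E (p ` {..<k}) = carrier E \<and>
      (\<forall>i<k. \<forall>j<k. i \<noteq> j \<longrightarrow> unitarily_equivalent E (p i) (p j) \<and> cnorm E (p i \<boxtimes> p j) < \<epsilon>)"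
  proof (intro exI[of _ p] conjI allI impI)
    show "(\<Oplus>\<^bsub>E\<^esub>i\<in>{..<k}. p i) \<in> Units E" by (rule near(1))
    fix i j assume ij: "i < k" "j < k" "i \<noteq> j"
    show "unitarily_equivalent E (p i) (p j)" by (rule near(2)) (use ij in auto)
    show "cnorm E (p i \<boxtimes> p j) < \<epsilon>" using near(3)[of i j] ij d(2) by auto
  qed (use p Ggen in auto)
qed

theorem proposition3p4:
  fixes A :: "'a cstar" and n l k :: nat
  assumes "n \<ge> 1"
    and "unital_cstar_algebra A"
    and "generated_by_self_adjoints A n"
    and "l \<ge> 1" and "l \<ge> nat \<lceil>sqrt (real n - 1)\<rceil>"
    and "k \<ge> 3"
  shows "Pgen (mat_algebra (k * l) A) \<le> enat k"
proof -
  interpret block_matrices A k l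
    using assms by (intro block_matrices.intro block_matrices_axioms.intro) auto
  \<comment> \<open>The bound by the square root enters as \<open>n \<le> l * l + 1\<close>, the
    number of generators that \<open>store_generators\<close> can place.\<close>
  have "sqrt (real n - 1) \<le> real l" using assms(5) by linarith
  then have "real n - 1 \<le> (real l)\<^sup>2" by (rule sqrt_le_D)
  then have "real n \<le> real (l * l + 1)" by (simp add: power2_eq_square)
  then have "n \<le> l * l + 1" by (simp only: of_nat_le_iff)
  then have "generated_by_almost_orthogonal_projections E k"
    by (rule generated_by_almost_orthogonal[OF assms(6,3)])
  then show ?thesis
    unfolding Pgen_def using assms(6) by (intro Inf_lower) auto
qed

end
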